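(* Let $U\subset\mathbb{RP}^2$ be a nonempty open set and let $F:U\to\mathbb{RP}^3$ be a sufficiently smooth planarization. Then there exists a nonempty open subset $U'\subset U$ such that at least one of the following holds: (1) the map $F|_{U'}$ is a trivial planarization; (2) the map $F|_{U'}$ is a co-trivial planarization; (3) the map $F|_{U'}$ is (the restriction to $U'$ of) a rational map $\mathbb{RP}^2\dashrightarrow\mathbb{RP}^3$ of degree at most $3$.
   Context: "Sufficiently smooth" means of class $C^r$ for a sufficiently large absolute constant $r$; that is, the statement asserts that there is an integer $r$ such that it holds for all planarizations of class $C^r$. Let $U\subset\mathbb{RP}^2$ be open. A map $F:U\to\mathbb{RP}^n$ is a planarization if there exists a nonempty open set $\mathcal U$ of projective lines in $\mathbb{RP}^2$ (open in the dual plane $\mathbb{RP}^{2*}$) such that for every $L\in\mathcal U$ we have $U\cap L\neq\varnothing$ and the set $F(U\cap L)$ lies in a projective hyperplane of $\mathbb{RP}^n$. A trivial planarization is a map $F:U\to\mathbb{RP}^n$ whose image lies in some hyperplane. A planarization $F:U\to\mathbb{RP}^n$ is co-trivial if there is a point $o\in\mathbb{RP}^n$ such that, for some nonempty open set $\mathcal U$ of lines, every $L\in\mathcal U$ satisfies $U\cap L\ne\varnothing$ and $F(U\cap L)$ is contained in a hyperplane passing through $o$. A rational degree $d$ map $\mathbb{RP}^2\dashrightarrow\mathbb{RP}^n$ is a map given in homogeneous coordinates by homogeneous polynomials of degree $d$ (not all zero) without a nonconstant common polynomial factor; it may have points of indeterminacy, where all defining polynomials vanish. *)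

theory Defs
  imports "HOL-Analysis.Analysis" "HOL-Library.Poly_Mapping"
begin

text \<open>
  \<open>'n rproj\<close> is the real projective space of lines in \<open>real ^ 'n\<close>, of dimension \<open>CARD('n) - 1\<close>;
  so \<open>3 rproj\<close> is the projective plane and \<open>4 rproj\<close> is projective 3-space.
\<close>

definition proj_rel :: "real ^ 'n \<Rightarrow> real ^ 'n \<Rightarrow> bool" where
  "proj_rel x y \<longleftrightarrow> x \<noteq> 0 \<and> y \<noteq> 0 \<and> (\<exists>c. c \<noteq> 0 \<and> y = c *\<^sub>R x)"

lemma part_equivp_proj_rel: "part_equivp (proj_rel :: real ^ 'n \<Rightarrow> _)"
proof (rule part_equivpI)
  show "\<exists>x :: real ^ 'n. proj_rel x x"
    by (rule exI[of _ "\<chi> i. 1"]) (auto simp: proj_rel_def vec_eq_iff intro: exI[of _ 1])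
  show "symp (proj_rel :: real ^ 'n \<Rightarrow> _)"
  proof (rule sympI)
    fix x y :: "real ^ 'n"
    assume "proj_rel x y"
    then obtain c where "x \<noteq> 0" "y \<noteq> 0" "c \<noteq> 0" "y = c *\<^sub>R x"
      by (auto simp: proj_rel_def)
    then show "proj_rel y x"
      unfolding proj_rel_def by (auto intro!: exI[of _ "inverse c"])
  qed
  show "transp (proj_rel :: real ^ 'n \<Rightarrow> _)"
  proof (rule transpI)
    fix x y z :: "real ^ 'n"
    assume "proj_rel x y" "proj_rel y z"
    then obtain c d where "x \<noteq> 0" "z \<noteq> 0" "c \<noteq> 0" "y = c *\<^sub>R x" "d \<noteq> 0" "z = d *\<^sub>R y"
      by (auto simp: proj_rel_def)
    then show "proj_rel x z"
      unfolding proj_rel_def by (auto intro!: exI[of _ "d * c"])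
  qed
qed

quotient_type 'n rproj = "real ^ 'n" / partial: "proj_rel :: real ^ 'n \<Rightarrow> real ^ 'n \<Rightarrow> bool"
  by (rule part_equivp_proj_rel)

text \<open>\<open>proj x\<close> is the point with homogeneous coordinates \<open>x\<close>; it is meaningful only for \<open>x \<noteq> 0\<close>.\<close>

definition proj :: "real ^ 'n \<Rightarrow> 'n::finite rproj" where
  "proj x = abs_rproj x"

lemma proj_eq_iff:
  assumes "x \<noteq> 0" "y \<noteq> 0"
  shows "proj x = proj y \<longleftrightarrow> (\<exists>c. c \<noteq> 0 \<and> y = c *\<^sub>R x)"
proof -
  have "proj_rel x x" "proj_rel y y"
    using assms by (auto simp: proj_rel_def intro: exI[of _ 1])
  then have "proj_rel x y \<longleftrightarrow> proj x = proj y"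
    unfolding proj_def using Quotient3_rel[OF Quotient3_rproj, of x y] by simp
  then show ?thesis
    using assms by (simp add: proj_rel_def)
qed

lemma proj_surj: "\<exists>x. x \<noteq> 0 \<and> p = proj x"
  unfolding proj_def
  by (metis Quotient3_abs_rep[OF Quotient3_rproj] Quotient3_rep_reflp[OF Quotient3_rproj]
      proj_rel_def)

text \<open>The quotient topology.\<close>

instantiation rproj :: (finite) topological_space
begin

definition open_rproj :: "'a rproj set \<Rightarrow> bool" where
  "open_rproj A \<longleftrightarrow> open {x. x \<noteq> 0 \<and> proj x \<in> A}"

instance
proof
  have "{x :: real ^ 'a. x \<noteq> 0 \<and> proj x \<in> UNIV} = - {0}"
    by auto
  then show "open (UNIV :: 'a rproj set)"
    by (simp add: open_rproj_def open_Compl)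
next
  fix S T :: "'a rproj set"
  assume "open S" "open T"
  moreover have "{x. x \<noteq> 0 \<and> proj x \<in> S \<inter> T} = {x. x \<noteq> 0 \<and> proj x \<in> S} \<inter> {x. x \<noteq> 0 \<and> proj x \<in> T}"
    by auto
  ultimately show "open (S \<inter> T)"
    by (simp only: open_rproj_def open_Int)
next
  fix K :: "'a rproj set set"
  assume "\<forall>S\<in>K. open S"
  moreover have "{x. x \<noteq> 0 \<and> proj x \<in> \<Union>K} = (\<Union>S\<in>K. {x. x \<noteq> 0 \<and> proj x \<in> S})"
    by auto
  ultimately show "open (\<Union>K)"
    by (simp only: open_rproj_def) (rule open_UN)
qed

end

text \<open>
  The dual projective space is identified with \<open>'n rproj\<close> by homogeneous dual coordinates:
  \<open>proj a\<close> corresponds to the hyperplane \<open>{proj x | a \<bullet> x = 0}\<close>. In particular \<open>hyperplane a\<close>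
  for \<open>a :: 3 rproj\<close> is a line of the projective plane, and an open set of lines is an open set of
  such \<open>a\<close>.
\<close>

lift_definition incident :: "'n::finite rproj \<Rightarrow> 'n rproj \<Rightarrow> bool" is "\<lambda>a x. a \<bullet> x = 0"
  by (auto simp: proj_rel_def)

definition hyperplane :: "'n::finite rproj \<Rightarrow> 'n rproj set" where
  "hyperplane a = {p. incident a p}"

text \<open>Maps are total functions, of which only the values on \<open>U\<close> are used.\<close>

definition planarization :: "3 rproj set \<Rightarrow> (3 rproj \<Rightarrow> 'n::finite rproj) \<Rightarrow> bool" where
  "planarization U F \<longleftrightarrow> open U \<and>
     (\<exists>\<L>. open \<L> \<and> \<L> \<noteq> {} \<and>
       (\<forall>l\<in>\<L>. U \<inter> hyperplane l \<noteq> {} \<and> (\<exists>h. F ` (U \<inter> hyperplane l) \<subseteq> hyperplane h)))"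

definition trivial_planarization :: "3 rproj set \<Rightarrow> (3 rproj \<Rightarrow> 'n::finite rproj) \<Rightarrow> bool" where
  "trivial_planarization U F \<longleftrightarrow> open U \<and> (\<exists>h. F ` U \<subseteq> hyperplane h)"

definition cotrivial_planarization :: "3 rproj set \<Rightarrow> (3 rproj \<Rightarrow> 'n::finite rproj) \<Rightarrow> bool" where
  "cotrivial_planarization U F \<longleftrightarrow> planarization U F \<and>
     (\<exists>o'. \<exists>\<L>. open \<L> \<and> \<L> \<noteq> {} \<and>
       (\<forall>l\<in>\<L>. U \<inter> hyperplane l \<noteq> {} \<and>
         (\<exists>h. o' \<in> hyperplane h \<and> F ` (U \<inter> hyperplane l) \<subseteq> hyperplane h)))"

text \<open>\<open>C_on r S f\<close>: the function \<open>f\<close> is of class $C^r$ on the open set \<open>S\<close>.\<close>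

primrec C_on :: "nat \<Rightarrow> 'a set \<Rightarrow> ('a::real_normed_vector \<Rightarrow> 'b::real_normed_vector) \<Rightarrow> bool" where
  "C_on 0 S f \<longleftrightarrow> continuous_on S f"
| "C_on (Suc r) S f \<longleftrightarrow> (\<forall>x\<in>S. f differentiable (at x)) \<and>
     (\<forall>v. C_on r S (\<lambda>x. frechet_derivative f (at x) v))"

text \<open>
  The standard affine chart of the plane in which the \<open>i\<close>-th homogeneous coordinate is 1; indices
  of type \<open>3\<close> are taken modulo 3, so the affine coordinates occupy the positions \<open>i + 1\<close>, \<open>i + 2\<close>.
\<close>

definition affine_point :: "3 \<Rightarrow> real ^ 2 \<Rightarrow> 3 rproj" where
  "affine_point i u = proj (\<chi> k. if k = i then 1 else if k = i + 1 then u $ 1 else u $ 2)"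

text \<open>
  On the standard affine chart \<open>{p. in_chart j p}\<close> of the target, \<open>affine_coord j k\<close> is the \<open>k\<close>-th
  affine coordinate, i.e. the ratio of the \<open>k\<close>-th and \<open>j\<close>-th homogeneous coordinates.
\<close>

lift_definition in_chart :: "'n::finite \<Rightarrow> 'n rproj \<Rightarrow> bool" is "\<lambda>j x. x $ j \<noteq> 0"
  by (auto simp: proj_rel_def)

lift_definition affine_coord :: "'n::finite \<Rightarrow> 'n \<Rightarrow> 'n rproj \<Rightarrow> real" is "\<lambda>j k x. x $ k / x $ j"
  by (auto simp: proj_rel_def)

definition C_map_on :: "nat \<Rightarrow> 3 rproj set \<Rightarrow> (3 rproj \<Rightarrow> 'n::finite rproj) \<Rightarrow> bool" where
  "C_map_on r U F \<longleftrightarrow> continuous_on U F \<and>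
     (\<forall>i j k. C_on r {u. affine_point i u \<in> U \<and> in_chart j (F (affine_point i u))}
                     (\<lambda>u. affine_coord j k (F (affine_point i u))))"

text \<open>
  Real polynomials in variables indexed by \<open>'v\<close>, as finitely supported maps from monomials (exponent
  vectors) to coefficients; multiplication is the convolution product of
  \<^theory>\<open>HOL-Library.Poly_Mapping\<close>.
\<close>

type_synonym 'v rpoly = "('v \<Rightarrow>\<^sub>0 nat) \<Rightarrow>\<^sub>0 real"

definition eval_poly :: "'v::finite rpoly \<Rightarrow> real ^ 'v \<Rightarrow> real" where
  "eval_poly P x = (\<Sum>m\<in>Poly_Mapping.keys P. Poly_Mapping.lookup P m * (\<Prod>i\<in>UNIV. x $ i ^ Poly_Mapping.lookup m i))"

definition homogeneous :: "nat \<Rightarrow> 'v::finite rpoly \<Rightarrow> bool" where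
  "homogeneous d P \<longleftrightarrow> (\<forall>m\<in>Poly_Mapping.keys P. (\<Sum>i\<in>UNIV. Poly_Mapping.lookup m i) = d)"

definition constant_poly :: "'v rpoly \<Rightarrow> bool" where
  "constant_poly P \<longleftrightarrow> Poly_Mapping.keys P \<subseteq> {0}"

text \<open>\<open>P $ j\<close> is the \<open>j\<close>-th homogeneous component of the rational map.\<close>

definition rational_map_of_degree :: "nat \<Rightarrow> (3 rpoly) ^ 'n \<Rightarrow> bool" where
  "rational_map_of_degree d P \<longleftrightarrow> (\<forall>j. homogeneous d (P $ j)) \<and> (\<exists>j. P $ j \<noteq> 0) \<and>
     (\<forall>Q. (\<forall>j. Q dvd P $ j) \<longrightarrow> constant_poly Q)"

text \<open>\<open>F\<close> is on \<open>U\<close> the restriction of the rational map \<open>P\<close>; no point of \<open>U\<close> is a point of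
  indeterminacy of \<open>P\<close>.\<close>

definition restriction_of_rational :: "3 rproj set \<Rightarrow> (3 rproj \<Rightarrow> 'n::finite rproj) \<Rightarrow> (3 rpoly) ^ 'n \<Rightarrow> bool" where
  "restriction_of_rational U F P \<longleftrightarrow>
     (\<forall>x. x \<noteq> 0 \<and> proj x \<in> U \<longrightarrow>
        (\<chi> j. eval_poly (P $ j) x) \<noteq> 0 \<and> F (proj x) = proj (\<chi> j. eval_poly (P $ j) x))"

end

theory Submission
  imports Defs "HOL-Computational_Algebra.Polynomial_Factorial" "HOL-Computational_Algebra.Field_as_Ring"
begin

text \<open>
  Lift the map, in affine coordinates \<open>(x, y)\<close> of the source, to a function \<open>f\<close> with values in
  \<open>real ^ 4\<close>, and write \<open>f\<^sub>v\<close> for its derivative along \<open>v = (1, c)\<close>. If a line of slope \<open>c\<close> is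
  mapped into a plane, the covector of that plane annihilates \<open>f\<close>, \<open>f\<^sub>v\<close> and \<open>f\<^sub>v\<^sub>v\<close> along the
  line. Where these three vectors are independent the covector is therefore a multiple of
  \<open>\<Xi> = cross4 f f\<^sub>v f\<^sub>v\<^sub>v\<close>, a cubic polynomial in \<open>c\<close>. If \<open>\<Xi>\<close> vanishes identically, then lines go
  to lines and a moving frame confines the image to a plane (\<open>jet2.hyperplane_of_flat_lines\<close>):
  this is the trivial case.

  Otherwise the planes form a map \<open>h\<close> from the lines \<open>y = a x + b\<close> to the dual projective space, with
  \<open>h(l) \<bullet> f(p) = 0\<close> whenever \<open>p\<close> lies on \<open>l\<close>. This relation is symmetric. The lines through a fixed
  point form a line in the \<open>(a, b)\<close>-plane, of direction \<open>w = (1, -x)\<close>, and \<open>h\<close> maps it into the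
  plane of covectors annihilating \<open>f(p)\<close>. So \<open>h\<close> is a planarization too and the same dichotomy applies
  to it. Either \<open>h\<close> takes its values in a plane, which means that all the planes \<open>h(l)\<close> have a
  common point: this is the co-trivial case. Or \<open>f\<close> is proportional to
  \<open>cross4 h h\<^sub>w h\<^sub>w\<^sub>w\<close>, which for a fixed line is a cubic polynomial in \<open>x\<close>. The map \<open>\<Xi>\<close> takes two
  derivatives of \<open>f\<close> and the last expression two more, so class \<open>C\<^sup>4\<close> suffices
  (\<open>local_trichotomy\<close>).

  There remain maps that are, up to a scalar factor, cubic on every line of an open set of
  lines. Comparing two directions of lines, the coefficients of the cubic curves on the lines of one
  direction solve a linear system whose entries are polynomials in the parameter of the other
  direction. So \<open>f\<close> is proportional to a polynomial map of degree at most 3 along the first direction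
  (\<open>polynomial_lift_in_direction\<close>). Division by the common factor leaves a primitive map \<open>P\<close>, and by
  unique factorization the polynomial maps obtained from all the other directions are multiples of
  \<open>P\<close>. Hence \<open>P\<close> has degree at most 3 along infinitely many directions, that is, total degree at
  most 3 (\<open>cubic_lines_imp_polynomial\<close>). Among the homogeneous representations of the map, one of
  minimal degree has no common factor (\<open>rational_map_of_minimal_degree\<close>).
\<close>

section \<open>The cross product of three vectors in four-space\<close>

text \<open>
  The covector annihilating three vectors: \<open>cross4 u v w \<bullet> z\<close> is, up to sign, the determinant
  of the matrix with rows \<open>u\<close>, \<open>v\<close>, \<open>w\<close>, \<open>z\<close>.
\<close>

definition cross4 :: "real ^ 4 \<Rightarrow> real ^ 4 \<Rightarrow> real ^ 4 \<Rightarrow> real ^ 4" where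
  "cross4 u v w = vector
    [u$2 * (v$3 * w$4 - v$4 * w$3) - u$3 * (v$2 * w$4 - v$4 * w$2) + u$4 * (v$2 * w$3 - v$3 * w$2),
     u$3 * (v$1 * w$4 - v$4 * w$1) - u$1 * (v$3 * w$4 - v$4 * w$3) - u$4 * (v$1 * w$3 - v$3 * w$1),
     u$1 * (v$2 * w$4 - v$4 * w$2) - u$2 * (v$1 * w$4 - v$4 * w$1) + u$4 * (v$1 * w$2 - v$2 * w$1),
     u$2 * (v$1 * w$3 - v$3 * w$1) - u$1 * (v$2 * w$3 - v$3 * w$2) - u$3 * (v$1 * w$2 - v$2 * w$1)]"

lemma vector_4_nth [simp]:
  "(vector [w,x,y,z] :: 'a::zero ^ 4) $ 1 = w"
  "(vector [w,x,y,z] :: 'a ^ 4) $ 2 = x"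
  "(vector [w,x,y,z] :: 'a ^ 4) $ 3 = y"
  "(vector [w,x,y,z] :: 'a ^ 4) $ 4 = z"
  unfolding vector_def by simp_all

lemma vec4_eq_iff: "(u :: 'a ^ 4) = v \<longleftrightarrow> u$1 = v$1 \<and> u$2 = v$2 \<and> u$3 = v$3 \<and> u$4 = v$4"
  by (simp add: vec_eq_iff forall_4)

lemma inner4: "(u :: real ^ 4) \<bullet> v = u$1 * v$1 + u$2 * v$2 + u$3 * v$3 + u$4 * v$4"
  by (simp add: inner_vec_def sum_4)

lemma cross4_nth:
  "cross4 u v w $ 1 = u$2 * (v$3 * w$4 - v$4 * w$3) - u$3 * (v$2 * w$4 - v$4 * w$2) + u$4 * (v$2 * w$3 - v$3 * w$2)"
  "cross4 u v w $ 2 = u$3 * (v$1 * w$4 - v$4 * w$1) - u$1 * (v$3 * w$4 - v$4 * w$3) - u$4 * (v$1 * w$3 - v$3 * w$1)"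
  "cross4 u v w $ 3 = u$1 * (v$2 * w$4 - v$4 * w$2) - u$2 * (v$1 * w$4 - v$4 * w$1) + u$4 * (v$1 * w$2 - v$2 * w$1)"
  "cross4 u v w $ 4 = u$2 * (v$1 * w$3 - v$3 * w$1) - u$1 * (v$2 * w$3 - v$3 * w$2) - u$3 * (v$1 * w$2 - v$2 * w$1)"
  unfolding cross4_def by (simp_all only: vector_4_nth)

lemma cross4_swap_inner:
  "cross4 u v w \<bullet> z = - (cross4 u v z \<bullet> w)"
  "cross4 u v w \<bullet> z = - (cross4 u w v \<bullet> z)"
  "cross4 u v w \<bullet> z = - (cross4 v u w \<bullet> z)"
  by (simp_all add: cross4_nth inner4 algebra_simps)

lemma cross4_annihilates [simp]:
  "cross4 u v w \<bullet> u = 0" "cross4 u v w \<bullet> v = 0" "cross4 u v w \<bullet> w = 0"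
  "u \<bullet> cross4 u v w = 0" "v \<bullet> cross4 u v w = 0" "w \<bullet> cross4 u v w = 0"
  by (simp_all add: cross4_nth inner4 algebra_simps)

lemma cross4_refl [simp]: "cross4 u u w = 0" "cross4 u v u = 0" "cross4 u v v = 0"
  by (simp_all add: cross4_nth vec4_eq_iff algebra_simps)

lemma cross4_swap: "cross4 u w v = - cross4 u v w" "cross4 v u w = - cross4 u v w"
  by (simp_all add: cross4_nth vec4_eq_iff algebra_simps)

lemma cross4_add:
  "cross4 (u + u') v w = cross4 u v w + cross4 u' v w"
  "cross4 u (v + v') w = cross4 u v w + cross4 u v' w"
  "cross4 u v (w + w') = cross4 u v w + cross4 u v w'"
  by (simp_all add: cross4_nth vec4_eq_iff algebra_simps)

lemma cross4_scale:
  "cross4 (c *\<^sub>R u) v w = c *\<^sub>R cross4 u v w"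
  "cross4 u (c *\<^sub>R v) w = c *\<^sub>R cross4 u v w"
  "cross4 u v (c *\<^sub>R w) = c *\<^sub>R cross4 u v w"
  by (simp_all add: cross4_nth vec4_eq_iff algebra_simps)

lemma cross4_zero [simp]: "cross4 0 v w = 0" "cross4 u 0 w = 0" "cross4 u v 0 = 0"
  by (simp_all add: cross4_nth vec4_eq_iff algebra_simps)

text \<open>
  Equality of the points of projective space represented by nonzero vectors. The \<open>2 \<times> 2\<close> minors
  make the relation polynomial, and the zero vector is parallel to everything.
\<close>

definition parallel :: "real ^ 4 \<Rightarrow> real ^ 4 \<Rightarrow> bool" where
  "parallel u v \<longleftrightarrow> (\<forall>i j. u$i * v$j = u$j * v$i)"

lemma parallel_sym: "parallel u v \<Longrightarrow> parallel v u"
  by (simp add: parallel_def mult.commute)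

lemma parallel_scale: assumes "parallel u v" "v \<noteq> 0" shows "\<exists>k. u = k *\<^sub>R v"
proof -
  obtain i where i: "v $ i \<noteq> 0" using assms(2) by (auto simp: vec_eq_iff)
  have "u = (u$i / v$i) *\<^sub>R v"
    using assms(1) i by (simp add: parallel_def vec_eq_iff field_simps)
  then show ?thesis by blast
qed

lemma parallel_trans: assumes "parallel u v" "parallel v w" "v \<noteq> 0" shows "parallel u w"
proof -
  obtain i where i: "v $ i \<noteq> 0" using assms(3) by (auto simp: vec_eq_iff)
  obtain k where "u = k *\<^sub>R v" using parallel_scale assms by blast
  then show ?thesis using assms(2) by (simp add: parallel_def)
qed

text \<open>
  Up to sign, the minor of \<open>z\<close> and \<open>cross4 u v w\<close> in two coordinates is the combination of
  \<open>z \<bullet> u\<close>, \<open>z \<bullet> v\<close>, \<open>z \<bullet> w\<close> whose coefficients are minors of \<open>u\<close>, \<open>v\<close>, \<open>w\<close> in the two complementary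
  coordinates.
\<close>

lemma parallel_cross4:
  fixes u v w z :: "real ^ 4"
  assumes "z \<bullet> u = 0" "z \<bullet> v = 0" "z \<bullet> w = 0"
  shows "parallel z (cross4 u v w)"
proof -
  have *: "z$1 * u$1 + z$2 * u$2 + z$3 * u$3 + z$4 * u$4 = 0"
    "z$1 * v$1 + z$2 * v$2 + z$3 * v$3 + z$4 * v$4 = 0"
    "z$1 * w$1 + z$2 * w$2 + z$3 * w$3 + z$4 * w$4 = 0"
    using assms by (simp_all add: inner4)
  have "z$1 * cross4 u v w $ 2 = z$2 * cross4 u v w $ 1"
    "z$1 * cross4 u v w $ 3 = z$3 * cross4 u v w $ 1"
    "z$1 * cross4 u v w $ 4 = z$4 * cross4 u v w $ 1"
    "z$2 * cross4 u v w $ 3 = z$3 * cross4 u v w $ 2"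
    "z$2 * cross4 u v w $ 4 = z$4 * cross4 u v w $ 2"
    "z$3 * cross4 u v w $ 4 = z$4 * cross4 u v w $ 3"
    unfolding cross4_nth
    using * by algebra+
  then show ?thesis
    unfolding parallel_def forall_4 by auto
qed

text \<open>
  Cramer's rule: the second hypothesis says that \<open>u\<close> and \<open>v\<close> are independent, which provides
  a nonzero minor \<open>d\<close> to divide by.
\<close>

lemma cross4_dependent:
  assumes c: "cross4 u v w = 0" and e: "cross4 u v e \<noteq> 0"
  shows "\<exists>\<alpha> \<beta>. w = \<alpha> *\<^sub>R u + \<beta> *\<^sub>R v"
proof -
  have ne: "\<exists>i j. u$i * v$j - u$j * v$i \<noteq> 0"
  proof (rule ccontr)
    assume "\<not> ?thesis"
    then have *: "u$i * v$j = u$j * v$i" for i j by auto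
    have "cross4 u v e = 0"
      unfolding vec4_eq_iff cross4_nth zero_index
      using *[of 1 2] *[of 1 3] *[of 1 4] *[of 2 3] *[of 2 4] *[of 3 4] by algebra+
    with e show False by simp
  qed
  then obtain i j where ij: "u$i * v$j - u$j * v$i \<noteq> 0" by blast
  define d where "d = u$i * v$j - u$j * v$i"
  have "d * w$k = (w$i * v$j - w$j * v$i) * u$k + (u$i * w$j - u$j * w$i) * v$k" for k
  proof -
    have c': "cross4 u v w $ 1 = 0" "cross4 u v w $ 2 = 0" "cross4 u v w $ 3 = 0" "cross4 u v w $ 4 = 0"
      using c by simp_all
    have "\<forall>i j k. (u$i * v$j - u$j * v$i) * w$k = (w$i * v$j - w$j * v$i) * u$k + (u$i * w$j - u$j * w$i) * v$k"
      using c' unfolding forall_4 cross4_nth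
      by (auto simp: algebra_simps)
    then show ?thesis by (simp add: d_def)
  qed
  then have dw: "d * w$k = (w$i * v$j - w$j * v$i) * u$k + (u$i * w$j - u$j * w$i) * v$k" for k .
  have d0: "d \<noteq> 0" using ij by (simp add: d_def)
  have "w$k = (w$i * v$j - w$j * v$i) / d * u$k + (u$i * w$j - u$j * w$i) / d * v$k" for k
  proof -
    have "w$k = (d * w$k) / d" using d0 by simp
    also have "\<dots> = ((w$i * v$j - w$j * v$i) * u$k + (u$i * w$j - u$j * w$i) * v$k) / d"
      by (simp only: dw)
    finally show ?thesis by (simp only: add_divide_distrib times_divide_eq_left)
  qed
  then have "w = ((w$i * v$j - w$j * v$i) / d) *\<^sub>R u + ((u$i * w$j - u$j * w$i) / d) *\<^sub>R v"
    unfolding vec_eq_iff vector_add_component vector_scaleR_component real_scaleR_def by (rule allI)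
  then show ?thesis by blast
qed

lemma has_vector_derivative_vec:
  fixes f :: "real \<Rightarrow> real ^ 'n"
  shows "(f has_vector_derivative f') (at t) \<longleftrightarrow> (\<forall>i. ((\<lambda>t. f t $ i) has_real_derivative f' $ i) (at t))"
  unfolding has_vector_derivative_def has_field_derivative_def
  by (subst has_derivative_componentwise_within[of f])
    (auto simp: Basis_vec_def inner_axis mult.commute[of _ "f' $ _"] mult_commute_abs)

lemma cross4_has_vector_derivative [derivative_intros]:
  assumes "(u has_vector_derivative u') (at t)" "(v has_vector_derivative v') (at t)"
    "(w has_vector_derivative w') (at t)"
  shows "((\<lambda>t. cross4 (u t) (v t) (w t)) has_vector_derivative
     cross4 u' (v t) (w t) + cross4 (u t) v' (w t) + cross4 (u t) (v t) w') (at t)"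
  using assms unfolding has_vector_derivative_vec forall_4 cross4_nth vector_add_component
  by (auto intro!: derivative_eq_intros simp: algebra_simps)

lemma continuous_on_cross4 [continuous_intros]:
  assumes "continuous_on S u" "continuous_on S v" "continuous_on S w"
  shows "continuous_on S (\<lambda>t. cross4 (u t) (v t) (w t))"
proof -
  have c: "continuous_on S (\<lambda>t. u t $ i)" "continuous_on S (\<lambda>t. v t $ i)" "continuous_on S (\<lambda>t. w t $ i)" for i
    using assms by (auto intro: continuous_on_component)
  have "\<forall>i. continuous_on S (\<lambda>t. cross4 (u t) (v t) (w t) $ i)"
    unfolding forall_4 cross4_nth
    by (intro conjI continuous_on_add continuous_on_diff continuous_on_mult c)
  then have "continuous_on S (\<lambda>t. \<chi> i. cross4 (u t) (v t) (w t) $ i)"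
    by (intro continuous_on_vec_lambda) simp
  then show ?thesis by simp
qed

section \<open>Maps that take lines to lines\<close>

text \<open>
  Functions on the plane are curried, so that a partial derivative is a derivative of a
  function of one real variable.
\<close>

definition has_partial1 :: "(real \<Rightarrow> real \<Rightarrow> 'a::real_normed_vector) \<Rightarrow> (real \<Rightarrow> real \<Rightarrow> 'a) \<Rightarrow> (real \<times> real) set \<Rightarrow> bool" where
  "has_partial1 g gx D \<longleftrightarrow> (\<forall>(x, y)\<in>D. ((\<lambda>t. g t y) has_vector_derivative gx x y) (at x))"

definition has_partial2 :: "(real \<Rightarrow> real \<Rightarrow> 'a::real_normed_vector) \<Rightarrow> (real \<Rightarrow> real \<Rightarrow> 'a) \<Rightarrow> (real \<times> real) set \<Rightarrow> bool" where
  "has_partial2 g gy D \<longleftrightarrow> (\<forall>(x, y)\<in>D. ((\<lambda>t. g x t) has_vector_derivative gy x y) (at y))"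

abbreviation square :: "real \<Rightarrow> real \<Rightarrow> real \<Rightarrow> (real \<times> real) set" where
  "square x y d \<equiv> ball x d \<times> ball y d"

lemma open_contains_square:
  assumes "open D" "(x, y) \<in> D"
  shows "\<exists>d>0. square x y d \<subseteq> D"
proof -
  obtain A B where AB: "open A" "open B" "(x,y) \<in> A \<times> B" "A \<times> B \<subseteq> D"
    using open_prod_elim[OF assms] by metis
  then obtain d1 d2 where d: "d1 > 0" "d2 > 0" "ball x d1 \<subseteq> A" "ball y d2 \<subseteq> B"
    by (meson mem_Sigma_iff open_contains_ball)
  have "square x y (min d1 d2) \<subseteq> D"
    using d AB(4) by (force simp: subset_iff)
  then show ?thesis using d by (metis min_less_iff_conj)
qed

text \<open>
  If the derivatives of a covector field \<open>N\<close> are multiples of \<open>N\<close>, then the quotients of its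
  components have vanishing derivatives. So the direction of \<open>N\<close> is constant, and a single covector
  annihilates \<open>f\<close>.
\<close>

lemma hyperplane_of_parallel_normal:
  fixes N :: "real \<Rightarrow> real \<Rightarrow> real ^ 4"
  assumes D: "open D" "(x0, y0) \<in> D"
    and cont: "continuous_on D (\<lambda>(x, y). N x y)"
    and N0: "N x0 y0 \<noteq> 0"
    and d1: "has_partial1 N Nx D" and d2: "has_partial2 N Ny D"
    and p: "\<And>x y. (x, y) \<in> D \<Longrightarrow> N x y \<noteq> 0 \<Longrightarrow> parallel (Nx x y) (N x y) \<and> parallel (Ny x y) (N x y)"
    and f: "\<And>x y. (x, y) \<in> D \<Longrightarrow> N x y \<bullet> f x y = 0"
  shows "\<exists>d \<xi>. d > 0 \<and> square x0 y0 d \<subseteq> D \<and> \<xi> \<noteq> 0 \<and> (\<forall>(x, y)\<in>square x0 y0 d. \<xi> \<bullet> f x y = 0)"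
proof -
  obtain i where i: "N x0 y0 $ i \<noteq> 0" using N0 by (auto simp: vec_eq_iff)
  have "continuous_on D (\<lambda>(x, y). N x y $ i)"
    using continuous_on_component[OF cont, of i] by (simp add: case_prod_unfold)
  then have "open {z \<in> D. (case z of (x, y) \<Rightarrow> N x y $ i) \<in> - {0}}"
  proof -
    have "open (D \<inter> (\<lambda>(x, y). N x y $ i) -` (- {0}))"
      by (rule continuous_open_preimage[OF \<open>continuous_on D (\<lambda>(x, y). N x y $ i)\<close> D(1)]) auto
    then show ?thesis by (simp only: vimage_def Int_def mem_Collect_eq)
  qed
  moreover have "(x0, y0) \<in> {z \<in> D. (case z of (x, y) \<Rightarrow> N x y $ i) \<in> - {0}}"
    using D i by simp
  ultimately obtain d where d: "d > 0" "square x0 y0 d \<subseteq> {z \<in> D. (case z of (x, y) \<Rightarrow> N x y $ i) \<in> - {0}}"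
    using open_contains_square by blast
  have inD: "(x, y) \<in> D" and nz: "N x y $ i \<noteq> 0" "N x y \<noteq> 0" if "x \<in> ball x0 d" "y \<in> ball y0 d" for x y
  proof -
    have "(x, y) \<in> square x0 y0 d" using that by simp
    from subsetD[OF d(2) this] have "(x, y) \<in> D \<and> N x y $ i \<noteq> 0" by simp
    then show "(x, y) \<in> D" "N x y $ i \<noteq> 0" "N x y \<noteq> 0" by auto
  qed
  define R where "R k x y = N x y $ k / N x y $ i" for k x y
  have Rx: "((\<lambda>t. R k t y) has_real_derivative 0) (at x)"
    if "x \<in> ball x0 d" "y \<in> ball y0 d" for x y k
  proof -
    note xy = inD[OF that] nz[OF that]
    have 1: "\<forall>i. ((\<lambda>t. N t y $ i) has_real_derivative Nx x y $ i) (at x)"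
      using d1 xy unfolding has_partial1_def has_vector_derivative_vec by auto
    have "Nx x y $ k * N x y $ i = Nx x y $ i * N x y $ k"
      using p xy unfolding parallel_def by simp
    then show ?thesis unfolding R_def
      using xy by (auto intro!: derivative_eq_intros 1[rule_format] simp: algebra_simps)
  qed
  have Ry: "((\<lambda>t. R k x t) has_real_derivative 0) (at y)"
    if "x \<in> ball x0 d" "y \<in> ball y0 d" for x y k
  proof -
    note xy = inD[OF that] nz[OF that]
    have 1: "\<forall>i. ((\<lambda>t. N x t $ i) has_real_derivative Ny x y $ i) (at y)"
      using d2 xy unfolding has_partial2_def has_vector_derivative_vec by auto
    have "Ny x y $ k * N x y $ i = Ny x y $ i * N x y $ k"
      using p xy unfolding parallel_def by simp
    then show ?thesis unfolding R_def
      using xy by (auto intro!: derivative_eq_intros 1[rule_format] simp: algebra_simps)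
  qed
  have const: "R k x y = R k x0 y0" if xy: "x \<in> ball x0 d" "y \<in> ball y0 d" for x y k
  proof -
    have "\<exists>c. \<forall>t\<in>ball x0 d. R k t y = c"
      by (rule has_field_derivative_zero_constant) (use Rx xy in \<open>auto intro: has_field_derivative_at_within\<close>)
    moreover have "\<exists>c. \<forall>t\<in>ball y0 d. R k x0 t = c"
      by (rule has_field_derivative_zero_constant) (use Ry d in \<open>auto intro: has_field_derivative_at_within\<close>)
    ultimately show ?thesis using xy d by (metis centre_in_ball)
  qed
  have "N x0 y0 \<bullet> f x y = 0" if xy: "x \<in> ball x0 d" "y \<in> ball y0 d" for x y
  proof -
    have "N x0 y0 $ k = (N x0 y0 $ i / N x y $ i) * N x y $ k" for k
      using const[OF xy, of k] nz[OF xy] i by (simp add: R_def field_simps)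
    then have "N x0 y0 = (N x0 y0 $ i / N x y $ i) *\<^sub>R N x y"
      unfolding vec_eq_iff vector_scaleR_component real_scaleR_def by (rule allI)
    then show ?thesis using f[OF inD[OF xy]] by (metis inner_scaleR_left mult_zero_right)
  qed
  then have "\<forall>(x, y)\<in>square x0 y0 d. N x0 y0 \<bullet> f x y = 0" by blast
  moreover have "square x0 y0 d \<subseteq> D" by (rule order_trans[OF d(2) Collect_restrict])
  ultimately show ?thesis using d(1) N0 by blast
qed


lemma parallel_add: "parallel u w \<Longrightarrow> parallel v w \<Longrightarrow> parallel (u + v) w"
  by (simp add: parallel_def algebra_simps)

lemma parallel_zero [simp]: "parallel 0 w"
  by (simp add: parallel_def)

text \<open>
  A vector \<open>t\<close> in the span of \<open>u\<close>, \<open>v\<close>, \<open>w\<close> may replace any of the three in the cross product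
  without changing its direction. This is how the derivative of a cross product of a frame is seen to
  be parallel to it.
\<close>

lemma parallel_cross4_replace:
  assumes "cross4 u v w \<bullet> t = 0"
  shows "parallel (cross4 t v w) (cross4 u v w)" "parallel (cross4 u t w) (cross4 u v w)" "parallel (cross4 u v t) (cross4 u v w)"
proof -
  have "cross4 t v w \<bullet> u = 0" "cross4 u t w \<bullet> v = 0" "cross4 u v t \<bullet> w = 0"
    using assms by (simp_all add: cross4_nth inner4 algebra_simps)
  then show "parallel (cross4 t v w) (cross4 u v w)" "parallel (cross4 u t w) (cross4 u v w)" "parallel (cross4 u v t) (cross4 u v w)"
    by (auto intro!: parallel_cross4)
qed

text \<open>
  With \<open>u\<close> a function of two variables and subscripts for its derivatives, the left side is the
  normal of the osculating plane in direction \<open>(1, c)\<close>: a cubic polynomial in \<open>c\<close>.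
\<close>

lemma cross4_along_direction:
  "cross4 u (u1 + c *\<^sub>R u2) (u11 + (2 * c) *\<^sub>R u12 + c\<^sup>2 *\<^sub>R u22) =
     cross4 u u1 u11 + c *\<^sub>R (cross4 u u2 u11 + (cross4 u u1 u12 + cross4 u u1 u12))
     + c\<^sup>2 *\<^sub>R (cross4 u u1 u22 + (cross4 u u2 u12 + cross4 u u2 u12)) + c ^ 3 *\<^sub>R cross4 u u2 u22"
  unfolding cross4_add cross4_scale
  by (simp add: vec_eq_iff algebra_simps power2_eq_square power3_eq_cube)

lemma cross4_spanning:
  assumes "u \<noteq> 0"
  shows "\<exists>e e'. cross4 u e e' \<noteq> 0"
proof (rule ccontr)
  assume "\<not> ?thesis"
  then have *: "cross4 u e e' = 0" for e e' by blast
  have "cross4 u (axis 1 1) (axis 2 1) = 0" "cross4 u (axis 2 1) (axis 3 1) = 0"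
    "cross4 u (axis 3 1) (axis 4 1) = 0" using * by blast+
  then have "u = 0" by (simp add: vec4_eq_iff cross4_nth axis_def)
  with assms show False by simp
qed

lemma has_partial1_cross4:
  assumes "has_partial1 u u' D" "has_partial1 v v' D" "has_partial1 w w' D"
  shows "has_partial1 (\<lambda>x y. cross4 (u x y) (v x y) (w x y))
    (\<lambda>x y. cross4 (u' x y) (v x y) (w x y) + cross4 (u x y) (v' x y) (w x y) + cross4 (u x y) (v x y) (w' x y)) D"
  using assms unfolding has_partial1_def by (auto intro!: cross4_has_vector_derivative)

lemma has_partial2_cross4:
  assumes "has_partial2 u u' D" "has_partial2 v v' D" "has_partial2 w w' D"
  shows "has_partial2 (\<lambda>x y. cross4 (u x y) (v x y) (w x y))
    (\<lambda>x y. cross4 (u' x y) (v x y) (w x y) + cross4 (u x y) (v' x y) (w x y) + cross4 (u x y) (v x y) (w' x y)) D"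
  using assms unfolding has_partial2_def by (auto intro!: cross4_has_vector_derivative)

lemma has_partial_const [simp]: "has_partial1 (\<lambda>x y. c) (\<lambda>x y. 0) D" "has_partial2 (\<lambda>x y. c) (\<lambda>x y. 0) D"
  by (auto simp: has_partial1_def has_partial2_def)

lemma continuous_on_cross4_2:
  assumes "continuous_on D (\<lambda>(x, y). u x y)" "continuous_on D (\<lambda>(x, y). v x y)" "continuous_on D (\<lambda>(x, y). w x y)"
  shows "continuous_on D (\<lambda>(x, y). cross4 (u x y) (v x y) (w x y))"
  using continuous_on_cross4[OF assms] by (simp add: case_prod_unfold)

lemma has_partial1_zero:
  assumes "has_partial1 g g' D" "open D" "(x, y) \<in> D" "\<And>x y. (x, y) \<in> D \<Longrightarrow> g x y = 0"
  shows "g' x y = 0"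
proof -
  obtain d where d: "d > 0" "square x y d \<subseteq> D" using open_contains_square assms by blast
  have "((\<lambda>t. g t y) has_vector_derivative g' x y) (at x)"
    using assms unfolding has_partial1_def by auto
  moreover have "((\<lambda>t. g t y) has_vector_derivative 0) (at x)"
  proof (rule has_vector_derivative_transform_within_open[of "\<lambda>t. 0" _ _ "ball x d"])
    fix t assume "t \<in> ball x d"
    then have "(t, y) \<in> D" using d by auto
    then show "0 = g t y" using assms by simp
  qed (use d in auto)
  ultimately show ?thesis using vector_derivative_unique_at by blast
qed

text \<open>
  A function with its partial derivatives up to order two. The mixed derivative \<open>f12\<close> serves for
  both orders of differentiation.
\<close>

locale jet2 =
  fixes D :: "(real \<times> real) set" and f f1 f2 f11 f12 f22 :: "real \<Rightarrow> real \<Rightarrow> real ^ 4"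
  assumes op: "open D"
    and hp: "has_partial1 f f1 D" "has_partial2 f f2 D" "has_partial1 f1 f11 D" "has_partial2 f1 f12 D"
      "has_partial1 f2 f12 D" "has_partial2 f2 f22 D"
    and cont: "continuous_on D (\<lambda>(x, y). f x y)" "continuous_on D (\<lambda>(x, y). f1 x y)"
      "continuous_on D (\<lambda>(x, y). f2 x y)"
begin

text \<open>
  The covector field \<open>cross4 f f1 f2\<close> annihilates the second derivatives, so the span of \<open>f\<close>,
  \<open>f1\<close>, \<open>f2\<close> is closed under differentiation.
\<close>

lemma hyperplane_rank3:
  assumes p: "(x0, y0) \<in> D" and ne: "cross4 (f x0 y0) (f1 x0 y0) (f2 x0 y0) \<noteq> 0"
    and z: "\<And>x y. (x, y) \<in> D \<Longrightarrow> cross4 (f x y) (f1 x y) (f2 x y) \<bullet> f11 x y = 0"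
      "\<And>x y. (x, y) \<in> D \<Longrightarrow> cross4 (f x y) (f1 x y) (f2 x y) \<bullet> f12 x y = 0"
      "\<And>x y. (x, y) \<in> D \<Longrightarrow> cross4 (f x y) (f1 x y) (f2 x y) \<bullet> f22 x y = 0"
  shows "\<exists>d \<xi>. d > 0 \<and> square x0 y0 d \<subseteq> D \<and> \<xi> \<noteq> 0 \<and> (\<forall>(x, y)\<in>square x0 y0 d. \<xi> \<bullet> f x y = 0)"
  by (rule hyperplane_of_parallel_normal[OF op p
        continuous_on_cross4_2[OF cont(1-3)] ne
        has_partial1_cross4[OF hp(1,3,5)] has_partial2_cross4[OF hp(2,4,6)]])
    (auto intro!: parallel_add parallel_cross4_replace z)

text \<open>
  Here \<open>f2\<close> lies in the span of \<open>f\<close> and \<open>f1\<close>, and so does \<open>f11\<close>. Differentiating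
  \<open>cross4 f f1 f2 = 0\<close> shows that \<open>f12\<close> does too. The constant vector \<open>e\<close> completes the frame \<open>f\<close>, \<open>f1\<close>.
\<close>

lemma hyperplane_rank2:
  assumes p: "(x0, y0) \<in> D" and ne: "cross4 (f x0 y0) (f1 x0 y0) e \<noteq> 0"
    and z: "\<And>x y. (x, y) \<in> D \<Longrightarrow> cross4 (f x y) (f1 x y) (f11 x y) = 0"
      "\<And>x y. (x, y) \<in> D \<Longrightarrow> cross4 (f x y) (f1 x y) (f2 x y) = 0"
  shows "\<exists>d \<xi>. d > 0 \<and> square x0 y0 d \<subseteq> D \<and> \<xi> \<noteq> 0 \<and> (\<forall>(x, y)\<in>square x0 y0 d. \<xi> \<bullet> f x y = 0)"
proof (rule hyperplane_of_parallel_normal[OF op p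
        continuous_on_cross4_2[OF cont(1,2), of "\<lambda>_ _. e"] _
        has_partial1_cross4[OF hp(1,3) has_partial_const(1)[of e]] has_partial2_cross4[OF hp(2,4) has_partial_const(2)[of e]]])
  show "continuous_on D (\<lambda>(x, y). e)" by (simp add: case_prod_unfold)
  show "cross4 (f x0 y0) (f1 x0 y0) e \<noteq> 0" by (rule ne)
  fix x y assume xy: "(x, y) \<in> D"
  show "cross4 (f x y) (f1 x y) e \<bullet> f x y = 0" by simp
  assume N: "cross4 (f x y) (f1 x y) e \<noteq> 0"
  obtain \<alpha> \<beta> where f11: "f11 x y = \<alpha> *\<^sub>R f x y + \<beta> *\<^sub>R f1 x y"
    using cross4_dependent[OF z(1)[OF xy] N] by blast
  have "cross4 (f1 x y) (f1 x y) (f2 x y) + cross4 (f x y) (f11 x y) (f2 x y) + cross4 (f x y) (f1 x y) (f12 x y) = 0"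
    by (rule has_partial1_zero[OF has_partial1_cross4[OF hp(1,3,5)] op xy]) (rule z(2))
  then have z12: "cross4 (f x y) (f1 x y) (f12 x y) = 0"
    using z(2)[OF xy] by (simp add: f11 cross4_add cross4_scale)
  have *: "cross4 (f x y) (f1 x y) e \<bullet> t = 0" if "cross4 (f x y) (f1 x y) t = 0" for t
    using that cross4_swap_inner(1)[of "f x y" "f1 x y" e t] by simp
  show "parallel (cross4 (f1 x y) (f1 x y) e + cross4 (f x y) (f11 x y) e + cross4 (f x y) (f1 x y) 0) (cross4 (f x y) (f1 x y) e)
    \<and> parallel (cross4 (f2 x y) (f1 x y) e + cross4 (f x y) (f12 x y) e + cross4 (f x y) (f1 x y) 0) (cross4 (f x y) (f1 x y) e)"
    by (auto intro!: parallel_add parallel_cross4_replace * z12 z[OF xy])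
qed

text \<open>
  Both derivatives are multiples of \<open>f\<close>, so any two constant vectors independent of \<open>f\<close> complete
  it to a frame whose normal has constant direction.
\<close>

lemma hyperplane_rank1:
  assumes p: "(x0, y0) \<in> D" and ne: "f x0 y0 \<noteq> 0"
    and z: "\<And>x y e. (x, y) \<in> D \<Longrightarrow> cross4 (f x y) (f1 x y) e = 0"
      "\<And>x y e. (x, y) \<in> D \<Longrightarrow> cross4 (f x y) (f2 x y) e = 0"
  shows "\<exists>d \<xi>. d > 0 \<and> square x0 y0 d \<subseteq> D \<and> \<xi> \<noteq> 0 \<and> (\<forall>(x, y)\<in>square x0 y0 d. \<xi> \<bullet> f x y = 0)"
proof -
  obtain e e' where ee: "cross4 (f x0 y0) e e' \<noteq> 0" using cross4_spanning[OF ne] by blast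
  have *: "cross4 u e e' \<bullet> t = 0" if "cross4 u t e = 0" for t u
    using that cross4_swap_inner[of u e e' t] cross4_swap_inner[of u e t e'] by simp
  show ?thesis
    by (rule hyperplane_of_parallel_normal[OF op p
        continuous_on_cross4_2[OF cont(1), of "\<lambda>_ _. e" "\<lambda>_ _. e'"] ee
        has_partial1_cross4[OF hp(1) has_partial_const(1) has_partial_const(1)]
        has_partial2_cross4[OF hp(2) has_partial_const(2) has_partial_const(2)]])
     (auto simp: case_prod_unfold intro!: parallel_cross4_replace * z)
qed

end

lemma cubic_zero_on_interval:
  fixes a0 :: real
  assumes "c1 < c2" and "\<And>c. c \<in> {c1<..<c2} \<Longrightarrow> a0 + a1 * c + a2 * c^2 + a3 * c^3 = 0"
  shows "a0 = 0 \<and> a1 = 0 \<and> a2 = 0 \<and> a3 = 0"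
proof -
  have "poly [:a0, a1, a2, a3:] c = 0" if "c \<in> {c1<..<c2}" for c
    using assms(2)[OF that] by (simp add: algebra_simps power2_eq_square power3_eq_cube)
  then have "{c1<..<c2} \<subseteq> {c. poly [:a0, a1, a2, a3:] c = 0}" by blast
  then have "infinite {c. poly [:a0, a1, a2, a3:] c = 0}"
    using assms(1) infinite_Ioo infinite_super by blast
  then have "[:a0, a1, a2, a3:] = 0" using poly_roots_finite by blast
  then show ?thesis by (simp add: pCons_eq_0_iff)
qed

lemma jet2_swap:
  assumes "jet2 D f f1 f2 f11 f12 f22"
  shows "jet2 ((\<lambda>(x, y). (y, x)) ` D) (\<lambda>x y. f y x) (\<lambda>x y. f2 y x) (\<lambda>x y. f1 y x) (\<lambda>x y. f22 y x) (\<lambda>x y. f12 y x) (\<lambda>x y. f11 y x)"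
proof -
  interpret jet2 D f f1 f2 f11 f12 f22 by fact
  have im: "(\<lambda>(x, y). (y, x)) ` D = (\<lambda>(x, y). (y, x)) -` D" by auto
  have c: "continuous_on ((\<lambda>(x, y). (y, x)) -` D) (\<lambda>(x, y). g y x)" if "continuous_on D (\<lambda>(x, y). g x y)" for g :: "real \<Rightarrow> real \<Rightarrow> real ^ 4"
  proof -
    have "continuous_on ((\<lambda>(x, y). (y, x)) -` D) (\<lambda>z. (\<lambda>(x, y). g x y) ((\<lambda>(x, y). (y, x)) z))"
      by (rule continuous_on_compose2[OF that]) (auto simp: case_prod_unfold intro!: continuous_intros)
    then show ?thesis by (simp add: case_prod_unfold)
  qed
  show ?thesis
    unfolding im
  proof
    show "open ((\<lambda>(x, y). (y, x)) -` D)"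
      by (rule open_vimage[OF op]) (auto simp: case_prod_unfold intro!: continuous_intros)
  qed (use hp in \<open>auto simp: has_partial1_def has_partial2_def intro!: c cont\<close>)
qed

text \<open>
  The hypothesis says that the map given by \<open>f\<close> takes the lines with slopes in an interval to
  lines. The coefficients of a polynomial in the slope that vanishes on an interval are zero, which
  gives the relations required by \<open>hyperplane_rank3\<close> and \<open>hyperplane_rank2\<close>. Which of the lemmas
  applies depends on the dimension of the span of \<open>f\<close>, \<open>f1\<close>, \<open>f2\<close>; in dimension two the variables are
  exchanged if \<open>f1\<close> is a multiple of \<open>f\<close>.
\<close>

lemma (in jet2) hyperplane_of_flat_lines:
  assumes ne: "D \<noteq> {}" and nz: "\<And>x y. (x, y) \<in> D \<Longrightarrow> f x y \<noteq> 0"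
    and c12: "c1 < c2"
    and flat: "\<And>x y c. (x, y) \<in> D \<Longrightarrow> c \<in> {c1<..<c2} \<Longrightarrow>
      cross4 (f x y) (f1 x y + c *\<^sub>R f2 x y) (f11 x y + (2 * c) *\<^sub>R f12 x y + c^2 *\<^sub>R f22 x y) = 0"
  shows "\<exists>x0 y0 d \<xi>. d > 0 \<and> square x0 y0 d \<subseteq> D \<and> \<xi> \<noteq> 0 \<and> (\<forall>(x, y)\<in>square x0 y0 d. \<xi> \<bullet> f x y = 0)"
proof -
  \<comment> \<open>The extreme coefficients of the cubic in \<open>c\<close>.\<close>
  have z: "cross4 (f x y) (f1 x y) (f11 x y) = 0" "cross4 (f x y) (f2 x y) (f22 x y) = 0"
    if xy: "(x, y) \<in> D" for x y
  proof -
    have "cross4 (f x y) (f1 x y) (f11 x y) $ i = 0 \<and>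
      (cross4 (f x y) (f2 x y) (f11 x y) + (cross4 (f x y) (f1 x y) (f12 x y) + cross4 (f x y) (f1 x y) (f12 x y))) $ i = 0 \<and>
      (cross4 (f x y) (f1 x y) (f22 x y) + (cross4 (f x y) (f2 x y) (f12 x y) + cross4 (f x y) (f2 x y) (f12 x y))) $ i = 0 \<and>
      cross4 (f x y) (f2 x y) (f22 x y) $ i = 0" for i
    proof (rule cubic_zero_on_interval[OF c12])
      fix c assume c: "c \<in> {c1<..<c2}"
      from arg_cong[OF flat[OF xy c, unfolded cross4_along_direction], of "\<lambda>v. v $ i"]
      show "cross4 (f x y) (f1 x y) (f11 x y) $ i +
        (cross4 (f x y) (f2 x y) (f11 x y) + (cross4 (f x y) (f1 x y) (f12 x y) + cross4 (f x y) (f1 x y) (f12 x y))) $ i * c +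
        (cross4 (f x y) (f1 x y) (f22 x y) + (cross4 (f x y) (f2 x y) (f12 x y) + cross4 (f x y) (f2 x y) (f12 x y))) $ i * c\<^sup>2 +
        cross4 (f x y) (f2 x y) (f22 x y) $ i * c ^ 3 = 0"
        by (simp only: vector_add_component vector_scaleR_component real_scaleR_def mult.commute zero_index)
    qed
    then show "cross4 (f x y) (f1 x y) (f11 x y) = 0" "cross4 (f x y) (f2 x y) (f22 x y) = 0"
      by (auto simp: vec_eq_iff)
  qed
  \<comment> \<open>Pairing the cubic with \<open>f2\<close> cancels its leading coefficient and leaves a quadratic.\<close>
  have n: "cross4 (f x y) (f1 x y) (f2 x y) \<bullet> f11 x y = 0" "cross4 (f x y) (f1 x y) (f2 x y) \<bullet> f12 x y = 0"
    "cross4 (f x y) (f1 x y) (f2 x y) \<bullet> f22 x y = 0"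
    if xy: "(x, y) \<in> D" for x y
  proof -
    let ?n = "cross4 (f x y) (f1 x y) (f2 x y)"
    have "?n \<bullet> f11 x y = 0 \<and> 2 * (?n \<bullet> f12 x y) = 0 \<and> ?n \<bullet> f22 x y = 0 \<and> (0::real) = 0"
    proof (rule cubic_zero_on_interval[OF c12])
      fix c assume c: "c \<in> {c1<..<c2}"
      have "?n \<bullet> z = - (cross4 (f x y) (f1 x y + c *\<^sub>R f2 x y) z \<bullet> f2 x y)" for z
        unfolding cross4_swap_inner(1)[of _ _ "f2 x y" z]
        by (simp add: cross4_add cross4_scale inner_add_left)
      then have "?n \<bullet> (f11 x y + (2 * c) *\<^sub>R f12 x y + c^2 *\<^sub>R f22 x y) = 0"
        using flat[OF xy c] by simp
      then show "?n \<bullet> f11 x y + 2 * (?n \<bullet> f12 x y) * c + ?n \<bullet> f22 x y * c\<^sup>2 + 0 * c ^ 3 = 0"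
        by (simp add: inner_add_right algebra_simps)
    qed
    then show "?n \<bullet> f11 x y = 0" "?n \<bullet> f12 x y = 0" "?n \<bullet> f22 x y = 0" by auto
  qed
  show ?thesis
  proof (cases "\<exists>(x, y)\<in>D. cross4 (f x y) (f1 x y) (f2 x y) \<noteq> 0")
    case True
    then show ?thesis using hyperplane_rank3 n by blast
  next
    case False
    then have n0: "cross4 (f x y) (f1 x y) (f2 x y) = 0" if "(x, y) \<in> D" for x y using that by blast
    show ?thesis
    proof (cases "\<exists>(x, y)\<in>D. \<exists>e. cross4 (f x y) (f1 x y) e \<noteq> 0")
      case True
      then show ?thesis using hyperplane_rank2 z(1) n0 by blast
    next
      case f1: False
      show ?thesis
      proof (cases "\<exists>(x, y)\<in>D. \<exists>e. cross4 (f x y) (f2 x y) e \<noteq> 0")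
        case True
        then obtain x y e where xy: "(x, y) \<in> D" "cross4 (f x y) (f2 x y) e \<noteq> 0" by blast
        interpret S: jet2 "(\<lambda>(x, y). (y, x)) ` D" "\<lambda>x y. f y x" "\<lambda>x y. f2 y x" "\<lambda>x y. f1 y x"
          "\<lambda>x y. f22 y x" "\<lambda>x y. f12 y x" "\<lambda>x y. f11 y x"
          by (rule jet2_swap) (rule jet2_axioms)
        have "cross4 (f x y) (f2 x y) (f1 x y) = 0" if "(x, y) \<in> D" for x y
          using n0[OF that] cross4_swap(1)[of "f x y" "f1 x y" "f2 x y"] by simp
        then have "\<exists>d \<xi>. d > 0 \<and> square y x d \<subseteq> (\<lambda>(x, y). (y, x)) ` D \<and> \<xi> \<noteq> 0 \<and> (\<forall>(u, v)\<in>square y x d. \<xi> \<bullet> f v u = 0)"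
          using xy z(2) by (intro S.hyperplane_rank2[of _ _ e]) auto
        then obtain d \<xi> where "d > 0" "square y x d \<subseteq> (\<lambda>(x, y). (y, x)) ` D" "\<xi> \<noteq> 0" "\<forall>(u, v)\<in>square y x d. \<xi> \<bullet> f v u = 0"
          by blast
        then have "d > 0 \<and> square x y d \<subseteq> D \<and> \<xi> \<noteq> 0 \<and> (\<forall>(u, v)\<in>square x y d. \<xi> \<bullet> f u v = 0)"
          by (auto simp: subset_iff)
        then show ?thesis by blast
      next
        case f2: False
        obtain x y where "(x, y) \<in> D" using ne by auto
        then show ?thesis using hyperplane_rank1[of x y] nz f1 f2 by blast
      qed
    qed
  qed
qed

section \<open>The dual map on the space of lines\<close>

text \<open>
  Rational cubic curves in projective space, possibly of lower degree.
\<close>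

definition cubic_curve :: "(real \<Rightarrow> real ^ 4) \<Rightarrow> bool" where
  "cubic_curve g \<longleftrightarrow> (\<exists>p :: 4 \<Rightarrow> real poly. \<forall>i. degree (p i) \<le> 3 \<and> (\<forall>x. g x $ i = poly (p i) x))"

lemma cubic_curveI:
  assumes "\<And>x. g x = C0 + x *\<^sub>R C1 + x^2 *\<^sub>R C2 + x^3 *\<^sub>R C3"
  shows "cubic_curve g"
  unfolding cubic_curve_def
proof (rule exI[of _ "\<lambda>i. [:C0 $ i, C1 $ i, C2 $ i, C3 $ i:]"], intro allI conjI)
  fix i
  have "degree [:C0 $ i, C1 $ i, C2 $ i, C3 $ i:] < 4"
    by (rule le_less_trans[OF degree_pCons_le]) (auto intro: le_less_trans[OF degree_pCons_le] simp: degree_pCons_eq_if)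
  then show "degree [:C0 $ i, C1 $ i, C2 $ i, C3 $ i:] \<le> 3" by simp
  fix x show "g x $ i = poly [:C0 $ i, C1 $ i, C2 $ i, C3 $ i:] x"
    by (simp add: assms algebra_simps power2_eq_square power3_eq_cube)
qed

lemma cubic_curve_shift:
  assumes "cubic_curve g" shows "cubic_curve (\<lambda>x. g (c + s * x))"
proof -
  obtain p where p: "\<And>i. degree (p i) \<le> 3" "\<And>i x. g x $ i = poly (p i) x"
    using assms unfolding cubic_curve_def by blast
  have "degree (pcompose (p i) [:c, s:]) \<le> 3" for i
    using p(1)[of i] degree_pcompose_le[of "p i" "[:c, s:]"] degree_pCons_le[of c "[:s:]"]
    by (simp add: degree_pCons_eq_if split: if_splits)
  then show ?thesis unfolding cubic_curve_def
    by (intro exI[of _ "\<lambda>i. pcompose (p i) [:c, s:]"]) (simp add: p(2) poly_pcompose mult.commute)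
qed

text \<open>
  On \<open>W\<close>, the map given by \<open>f\<close> is a rational cubic curve along each line of slope in \<open>(c1, c2)\<close>.
  The intercept \<open>b\<close> ranges over all reals; for a line that misses \<open>W\<close> the condition is void.
\<close>

definition cubic_lines :: "(real \<times> real) set \<Rightarrow> real \<Rightarrow> real \<Rightarrow> (real \<Rightarrow> real \<Rightarrow> real ^ 4) \<Rightarrow> bool" where
  "cubic_lines W c1 c2 f \<longleftrightarrow> (\<forall>a b. c1 < a \<longrightarrow> a < c2 \<longrightarrow>
     (\<exists>g. cubic_curve g \<and> (\<forall>x. (x, a * x + b) \<in> W \<longrightarrow> g x \<noteq> 0 \<and> parallel (f x (a * x + b)) (g x))))"

text \<open>
  The covector of the line \<open>y = a x + b\<close> is normalized by its value at a fixed abscissa, where it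
  is the cubic \<open>\<Xi>\<close> in the slope \<open>a\<close> with coefficients depending on \<open>b\<close> alone. All derivatives in \<open>a\<close> are
  then explicit, and only functions of one variable have to be differentiated.
\<close>

definition cubic_family :: "(nat \<Rightarrow> real \<Rightarrow> real ^ 4) \<Rightarrow> real \<Rightarrow> real \<Rightarrow> real ^ 4" where
  "cubic_family H a b = H 0 b + a *\<^sub>R H 1 b + a^2 *\<^sub>R H 2 b + a^3 *\<^sub>R H 3 b"
definition cubic_family_deriv :: "(nat \<Rightarrow> real \<Rightarrow> real ^ 4) \<Rightarrow> real \<Rightarrow> real \<Rightarrow> real ^ 4" where
  "cubic_family_deriv H a b = H 1 b + (2 * a) *\<^sub>R H 2 b + (3 * a^2) *\<^sub>R H 3 b"
definition cubic_family_deriv2 :: "(nat \<Rightarrow> real \<Rightarrow> real ^ 4) \<Rightarrow> real \<Rightarrow> real \<Rightarrow> real ^ 4" where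
  "cubic_family_deriv2 H a b = 2 *\<^sub>R H 2 b + (6 * a) *\<^sub>R H 3 b"

text \<open>
  Here \<open>cubic_family H a b\<close> is a covector annihilating \<open>f\<close> along the line \<open>y = a x + b\<close> over
  \<open>x1 < x < x2\<close>.
\<close>

locale dual_map =
  fixes A B :: "real set" and x1 x2 :: real and f :: "real \<Rightarrow> real \<Rightarrow> real ^ 4"
    and H H' H'' :: "nat \<Rightarrow> real \<Rightarrow> real ^ 4"
  assumes opA: "open A" "A \<noteq> {}" and opB: "open B" "B \<noteq> {}" and x12: "x1 < x2"
    and d1: "\<And>k b. b \<in> B \<Longrightarrow> (H k has_vector_derivative H' k b) (at b)"
    and d2: "\<And>k b. b \<in> B \<Longrightarrow> (H' k has_vector_derivative H'' k b) (at b)"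
    and c2: "\<And>k. continuous_on B (H'' k)"
    and nz: "\<And>a b. a \<in> A \<Longrightarrow> b \<in> B \<Longrightarrow> cubic_family H a b \<noteq> 0"
    and inc: "\<And>a b x. a \<in> A \<Longrightarrow> b \<in> B \<Longrightarrow> x1 < x \<Longrightarrow> x < x2 \<Longrightarrow> cubic_family H a b \<bullet> f x (a * x + b) = 0"
begin

lemma continuous_H: "continuous_on B (H k)" and continuous_H1: "continuous_on B (H' k)"
  using d1 d2 by (auto intro!: continuous_at_imp_continuous_on has_vector_derivative_continuous)

lemma cont_snd:
  assumes "continuous_on B g" shows "continuous_on (A \<times> B) (\<lambda>z. g (snd z))"
  by (rule continuous_on_compose2[OF assms]) (auto intro!: continuous_intros)

lemma jet: "jet2 (A \<times> B) (cubic_family H) (cubic_family_deriv H) (cubic_family H') (cubic_family_deriv2 H) (cubic_family_deriv H') (cubic_family H'')"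
proof
  show "open (A \<times> B)" using opA opB by (simp add: open_Times)
  show "has_partial1 (cubic_family H) (cubic_family_deriv H) (A \<times> B)" "has_partial1 (cubic_family_deriv H) (cubic_family_deriv2 H) (A \<times> B)" "has_partial1 (cubic_family H') (cubic_family_deriv H') (A \<times> B)"
    unfolding has_partial1_def cubic_family_def cubic_family_deriv_def cubic_family_deriv2_def
    by (auto intro!: derivative_eq_intros simp: algebra_simps)
  show "has_partial2 (cubic_family H) (cubic_family H') (A \<times> B)" "has_partial2 (cubic_family_deriv H) (cubic_family_deriv H') (A \<times> B)" "has_partial2 (cubic_family H') (cubic_family H'') (A \<times> B)"
    unfolding has_partial2_def cubic_family_def cubic_family_deriv_def
    by (auto intro!: derivative_eq_intros d1 d2 simp: algebra_simps)
  show "continuous_on (A \<times> B) (\<lambda>(x, y). cubic_family H x y)" "continuous_on (A \<times> B) (\<lambda>(x, y). cubic_family_deriv H x y)" "continuous_on (A \<times> B) (\<lambda>(x, y). cubic_family H' x y)"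
    unfolding cubic_family_def cubic_family_deriv_def case_prod_unfold
    by (intro continuous_intros cont_snd continuous_H continuous_H1)+
qed

text \<open>
  The cross product of \<open>h = cubic_family H\<close> with its first and second derivatives in the direction
  \<open>(1, -x)\<close>, the direction in the \<open>(a, b)\<close>-plane of the pencil of lines through a point of abscissa \<open>x\<close>.
\<close>

definition Psi :: "real \<Rightarrow> real \<Rightarrow> real \<Rightarrow> real ^ 4" where
  "Psi a b x = cross4 (cubic_family H a b) (cubic_family_deriv H a b + (-x) *\<^sub>R cubic_family H' a b)
     (cubic_family_deriv2 H a b + (2 * (-x)) *\<^sub>R cubic_family_deriv H' a b + (-x)^2 *\<^sub>R cubic_family H'' a b)"

lemma Psi_cubic: "cubic_curve (Psi a b)"
proof -
  let ?h = "cubic_family H a b" let ?h1 = "cubic_family_deriv H a b" let ?h2 = "cubic_family H' a b"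
  let ?h11 = "cubic_family_deriv2 H a b" let ?h12 = "cubic_family_deriv H' a b" let ?h22 = "cubic_family H'' a b"
  show ?thesis
  proof (rule cubic_curveI)
    fix x
    show "Psi a b x = cross4 ?h ?h1 ?h11
      + x *\<^sub>R (- (cross4 ?h ?h2 ?h11 + (cross4 ?h ?h1 ?h12 + cross4 ?h ?h1 ?h12)))
      + x\<^sup>2 *\<^sub>R (cross4 ?h ?h1 ?h22 + (cross4 ?h ?h2 ?h12 + cross4 ?h ?h2 ?h12))
      + x ^ 3 *\<^sub>R (- cross4 ?h ?h2 ?h22)"
    proof -
      have "(- x) ^ 3 = - (x ^ 3)" by (simp add: power3_eq_cube)
      then show ?thesis unfolding Psi_def cross4_along_direction
        by (simp only: power2_minus scaleR_minus_left scaleR_minus_right)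
    qed
  qed
qed

text \<open>
  Along the pencil of lines through the point \<open>(x, y)\<close>, that is for \<open>b = y - a x\<close>, the product of
  \<open>h\<close> with the fixed vector \<open>f x y\<close> vanishes. Differentiating twice in \<open>a\<close> shows that \<open>f x y\<close> annihilates
  the three factors of \<open>Psi\<close>.
\<close>

lemma f_parallel_Psi:
  assumes a: "a \<in> A" and b: "b \<in> B" and x: "x1 < x" "x < x2"
  shows "parallel (f x (a * x + b)) (Psi a b x)"
proof -
  define y where "y = a * x + b"
  define F where "F = f x y"
  define S where "S = A \<inter> (\<lambda>a. y - a * x) -` B"
  have S: "open S" unfolding S_def
    by (intro open_Int opA open_vimage[OF opB(1)]) (auto intro!: continuous_intros)
  have aS: "a \<in> S" using a b by (simp add: S_def y_def)
  have y': "y = t * x + (y - t * x)" for t by simp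
  have z0: "cubic_family H t (y - t * x) \<bullet> F = 0" if "t \<in> S" for t
    using inc[of t "y - t * x" x] that x unfolding S_def F_def by auto
  have G1: "((\<lambda>b. H k b \<bullet> F) has_real_derivative H' k b \<bullet> F) (at b)" if "b \<in> B" for k b
    using bounded_linear.has_vector_derivative[OF bounded_linear_inner_left d1[OF that, of k], of F]
    by (simp add: has_real_derivative_iff_has_vector_derivative)
  have G2: "((\<lambda>b. H' k b \<bullet> F) has_real_derivative H'' k b \<bullet> F) (at b)" if "b \<in> B" for k b
    using bounded_linear.has_vector_derivative[OF bounded_linear_inner_left d2[OF that, of k], of F]
    by (simp add: has_real_derivative_iff_has_vector_derivative)
  have l: "((\<lambda>t. y - t * x) has_real_derivative - x) (at t)" for t
    by (auto intro!: derivative_eq_intros)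
  have C1: "((\<lambda>t. H k (y - t * x) \<bullet> F) has_real_derivative (H' k (y - t * x) \<bullet> F) * (- x)) (at t)" if "t \<in> S" for k t
    by (rule DERIV_chain2[OF G1 l]) (use that in \<open>simp add: S_def\<close>)
  have C2: "((\<lambda>t. H' k (y - t * x) \<bullet> F) has_real_derivative (H'' k (y - t * x) \<bullet> F) * (- x)) (at t)" if "t \<in> S" for k t
    by (rule DERIV_chain2[OF G2 l]) (use that in \<open>simp add: S_def\<close>)
  have zero: "D = 0" if "(\<phi> has_real_derivative D) (at t)" "t \<in> S" "\<And>t. t \<in> S \<Longrightarrow> \<phi> t = 0" for \<phi> D t
  proof -
    have "((\<lambda>t. 0) has_real_derivative D) (at t)"
      by (rule has_field_derivative_transform_within_open[OF that(1) S that(2)]) (use that(3) in auto)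
    then show ?thesis using DERIV_unique DERIV_const by blast
  qed
  have z1: "(cubic_family_deriv H t (y - t * x) + (-x) *\<^sub>R cubic_family H' t (y - t * x)) \<bullet> F = 0" if "t \<in> S" for t
  proof (rule zero[OF _ that z0])
    show "((\<lambda>t. cubic_family H t (y - t * x) \<bullet> F) has_real_derivative
      (cubic_family_deriv H t (y - t * x) + (-x) *\<^sub>R cubic_family H' t (y - t * x)) \<bullet> F) (at t)"
      unfolding cubic_family_def cubic_family_deriv_def inner_add_left inner_scaleR_left
      by (auto intro!: derivative_eq_intros C1 that simp: algebra_simps)
  qed
  have z2: "(cubic_family_deriv2 H t (y - t * x) + (2 * (-x)) *\<^sub>R cubic_family_deriv H' t (y - t * x) + (-x)^2 *\<^sub>R cubic_family H'' t (y - t * x)) \<bullet> F = 0" if "t \<in> S" for t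
  proof (rule zero[OF _ that z1])
    show "((\<lambda>t. (cubic_family_deriv H t (y - t * x) + (-x) *\<^sub>R cubic_family H' t (y - t * x)) \<bullet> F) has_real_derivative
      (cubic_family_deriv2 H t (y - t * x) + (2 * (-x)) *\<^sub>R cubic_family_deriv H' t (y - t * x) + (-x)^2 *\<^sub>R cubic_family H'' t (y - t * x)) \<bullet> F) (at t)"
      unfolding cubic_family_def cubic_family_deriv_def cubic_family_deriv2_def inner_add_left inner_scaleR_left
      by (auto intro!: derivative_eq_intros C1 C2 that simp: algebra_simps power2_eq_square power3_eq_cube)
  qed
  have "y - a * x = b" by (simp add: y_def)
  then show ?thesis
    unfolding Psi_def using z0[OF aS] z1[OF aS] z2[OF aS]
    by (intro parallel_cross4) (simp_all add: F_def y_def inner_commute)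
qed

lemma Psi_continuous: "continuous_on (A \<times> B \<times> UNIV) (\<lambda>(a, b, x). Psi a b x)"
proof -
  have *: "continuous_on (A \<times> B \<times> UNIV) (\<lambda>z. g (fst (snd z)))" if "continuous_on B g" for g :: "real \<Rightarrow> real ^ 4"
    by (rule continuous_on_compose2[OF that]) (auto intro!: continuous_intros)
  show ?thesis
    unfolding Psi_def cubic_family_def cubic_family_deriv_def cubic_family_deriv2_def case_prod_unfold
    by (intro continuous_on_cross4 continuous_intros * continuous_H continuous_H1 c2)
qed

text \<open>
  On a small neighbourhood \<open>Psi\<close> does not vanish and is the required cubic curve. The strip \<open>W\<close>
  around the line \<open>y = a0 x + b0\<close> and the range \<open>r\<close> of slopes are chosen so that every line of such a
  slope that meets \<open>W\<close> has an intercept close to \<open>b0\<close>.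
\<close>

lemma cubic_lines_near_Psi_nonzero:
  assumes a: "a0 \<in> A" and b: "b0 \<in> B" and x: "x1 < x0" "x0 < x2" and nz: "Psi a0 b0 x0 \<noteq> 0"
  shows "\<exists>W c1 c2. open W \<and> W \<noteq> {} \<and> c1 < c2 \<and> (\<forall>(x, y)\<in>W. x1 < x \<and> x < x2 \<and> y - a0 * x \<in> B) \<and> cubic_lines W c1 c2 f"
proof -
  have op: "open (A \<times> B \<times> {x1<..<x2})" using opA opB by (simp add: open_Times)
  have cont: "continuous_on (A \<times> B \<times> {x1<..<x2}) (\<lambda>(a, b, x). Psi a b x)"
    by (rule continuous_on_subset[OF Psi_continuous]) auto
  define N where "N = (A \<times> B \<times> {x1<..<x2}) \<inter> (\<lambda>(a, b, x). Psi a b x) -` (- {0})"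
  have "open N" unfolding N_def
    by (rule continuous_open_preimage[OF cont op]) auto
  moreover have "(a0, b0, x0) \<in> N" using assms by (simp add: N_def)
  ultimately obtain e where e: "e > 0" "ball (a0, b0, x0) e \<subseteq> N"
    by (meson open_contains_ball)
  define d where "d = e / 3"
  have d: "d > 0" using e by (simp add: d_def)
  have inN: "(a, b, x) \<in> N" if "\<bar>a - a0\<bar> < d" "\<bar>b - b0\<bar> < d" "\<bar>x - x0\<bar> < d" for a b x
  proof -
    have "dist (a0, b0, x0) (a, b, x) \<le> dist a0 a + dist (b0, x0) (b, x)"
      unfolding dist_Pair_Pair by (rule sqrt_sum_squares_le_sum) auto
    also have "dist (b0, x0) (b, x) \<le> dist b0 b + dist x0 x"
      unfolding dist_Pair_Pair by (rule sqrt_sum_squares_le_sum) auto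
    finally have "dist (a0, b0, x0) (a, b, x) < e"
      using that unfolding d_def dist_real_def abs_minus_commute[of a] abs_minus_commute[of b] abs_minus_commute[of x]
      by linarith
    then show ?thesis using e(2) by auto
  qed
  define W where "W = {(x, y). \<bar>x - x0\<bar> < d \<and> \<bar>y - a0 * x - b0\<bar> < d / 2}"
  define r where "r = min d (d / (2 * (\<bar>x0\<bar> + d)))"
  have r: "r > 0" using d by (simp add: r_def)
  have opW: "open W"
    unfolding W_def case_prod_unfold
    by (intro open_Collect_conj open_Collect_less continuous_intros)
  have ptW: "(x0, a0 * x0 + b0) \<in> W" using d by (simp add: W_def)
  have "cubic_lines W (a0 - r) (a0 + r) f"
    unfolding cubic_lines_def
  proof (intro allI impI)
    fix a b assume "a0 - r < a" "a < a0 + r"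
    then have ar: "\<bar>a - a0\<bar> < r" by (simp add: abs_less_iff)
    show "\<exists>g. cubic_curve g \<and> (\<forall>x. (x, a * x + b) \<in> W \<longrightarrow> g x \<noteq> 0 \<and> parallel (f x (a * x + b)) (g x))"
    proof (rule exI[of _ "Psi a b"], intro conjI allI impI Psi_cubic)
      fix x assume xW: "(x, a * x + b) \<in> W"
      then have xd: "\<bar>x - x0\<bar> < d" and yd: "\<bar>a * x + b - a0 * x - b0\<bar> < d / 2" by (auto simp: W_def)
      have "\<bar>x\<bar> \<le> \<bar>x0\<bar> + d" using xd by linarith
      then have "\<bar>a - a0\<bar> * \<bar>x\<bar> \<le> r * (\<bar>x0\<bar> + d)" using ar r by (intro mult_mono) auto
      also have "\<dots> \<le> d / (2 * (\<bar>x0\<bar> + d)) * (\<bar>x0\<bar> + d)"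
        using d by (intro mult_right_mono) (auto simp: r_def)
      also have "\<dots> = d / 2"
      proof -
        have "\<bar>x0\<bar> + d \<noteq> 0" using d by linarith
        then show ?thesis by (simp add: field_simps)
      qed
      finally have "\<bar>(a - a0) * x\<bar> \<le> d / 2" by (simp add: abs_mult)
      moreover have "b - b0 = (a * x + b - a0 * x - b0) - (a - a0) * x" by (simp add: algebra_simps)
      ultimately have "\<bar>b - b0\<bar> < d" using yd by linarith
      then have "(a, b, x) \<in> N" using inN ar xd by (simp add: r_def)
      then show "Psi a b x \<noteq> 0" "parallel (f x (a * x + b)) (Psi a b x)"
        using f_parallel_Psi by (auto simp: N_def)
    qed
  qed
  moreover have "x1 < x \<and> x < x2 \<and> y - a0 * x \<in> B" if "(x, y) \<in> W" for x y
    using inN[of a0 "y - a0 * x" x] that d by (auto simp: W_def N_def)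
  ultimately show ?thesis using opW ptW r
    by (intro exI[of _ W] exI[of _ "a0 - r"] exI[of _ "a0 + r"]) auto
qed

text \<open>
  If \<open>Psi\<close> vanishes identically, then \<open>h\<close> takes lines to lines and \<open>hyperplane_of_flat_lines\<close>
  applies to \<open>h\<close>, with slopes \<open>-x\<close>.
\<close>

theorem dual_dichotomy:
  "(\<exists>a0 b0 d \<xi>. d > 0 \<and> square a0 b0 d \<subseteq> A \<times> B \<and> \<xi> \<noteq> 0 \<and> (\<forall>(a, b)\<in>square a0 b0 d. \<xi> \<bullet> cubic_family H a b = 0)) \<or>
   (\<exists>W c1 c2 a0. open W \<and> W \<noteq> {} \<and> c1 < c2 \<and> a0 \<in> A \<and> (\<forall>(x, y)\<in>W. x1 < x \<and> x < x2 \<and> y - a0 * x \<in> B) \<and> cubic_lines W c1 c2 f)"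
proof (cases "\<exists>a\<in>A. \<exists>b\<in>B. \<exists>x. x1 < x \<and> x < x2 \<and> Psi a b x \<noteq> 0")
  case True
  then obtain a b x where abx: "a \<in> A" "b \<in> B" "x1 < x" "x < x2" "Psi a b x \<noteq> 0" by auto
  from cubic_lines_near_Psi_nonzero[OF abx] obtain W c1 c2 where
    "open W \<and> W \<noteq> {} \<and> c1 < c2 \<and> (\<forall>(x, y)\<in>W. x1 < x \<and> x < x2 \<and> y - a * x \<in> B) \<and> cubic_lines W c1 c2 f"
    by (elim exE)
  with abx(1) show ?thesis by (intro disjI2 exI[of _ W] exI[of _ c1] exI[of _ c2] exI[of _ a]) (elim conjE, intro conjI)
next
  case False
  interpret J: jet2 "A \<times> B" "cubic_family H" "cubic_family_deriv H" "cubic_family H'" "cubic_family_deriv2 H" "cubic_family_deriv H'" "cubic_family H''" by (rule jet)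
  have "\<exists>x0 y0 d \<xi>. d > 0 \<and> square x0 y0 d \<subseteq> A \<times> B \<and> \<xi> \<noteq> 0 \<and> (\<forall>(x, y)\<in>square x0 y0 d. \<xi> \<bullet> cubic_family H x y = 0)"
  proof (rule J.hyperplane_of_flat_lines[of "-x2" "-x1"])
    fix a b c assume ab: "(a, b) \<in> A \<times> B" and c: "c \<in> {- x2<..<- x1}"
    then have "Psi a b (- c) = 0" using False by auto
    then show "cross4 (cubic_family H a b) (cubic_family_deriv H a b + c *\<^sub>R cubic_family H' a b)
        (cubic_family_deriv2 H a b + (2 * c) *\<^sub>R cubic_family_deriv H' a b + c\<^sup>2 *\<^sub>R cubic_family H'' a b) = 0"
      by (simp add: Psi_def)
  qed (use opA opB nz x12 in auto)
  then show ?thesis by blast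
qed

end

section \<open>Smooth lifts of planarizations\<close>

definition total_derivative :: "(real \<Rightarrow> real \<Rightarrow> 'a::real_normed_vector) \<Rightarrow> (real \<Rightarrow> real \<Rightarrow> 'a) \<Rightarrow> (real \<Rightarrow> real \<Rightarrow> 'a) \<Rightarrow> (real \<times> real) set \<Rightarrow> bool" where
  "total_derivative g g1 g2 D \<longleftrightarrow> (\<forall>(x, y)\<in>D.
     ((\<lambda>z. g (fst z) (snd z)) has_derivative (\<lambda>v. fst v *\<^sub>R g1 x y + snd v *\<^sub>R g2 x y)) (at (x, y)))"

text \<open>
  Total rather than partial derivatives, because \<open>f\<close> has to be differentiated along oblique
  lines.
\<close>

primrec smooth2 :: "nat \<Rightarrow> (real \<times> real) set \<Rightarrow> (real \<Rightarrow> real \<Rightarrow> 'a::real_normed_vector) \<Rightarrow> bool" where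
  "smooth2 0 D g \<longleftrightarrow> continuous_on D (\<lambda>(x, y). g x y)"
| "smooth2 (Suc n) D g \<longleftrightarrow> (\<exists>g1 g2. total_derivative g g1 g2 D \<and> smooth2 n D g1 \<and> smooth2 n D g2)"

lemma total_derivative_line:
  assumes "total_derivative g g1 g2 D" "(p + s * t, q + r * t) \<in> D"
  shows "((\<lambda>t. g (p + s * t) (q + r * t)) has_vector_derivative
    s *\<^sub>R g1 (p + s * t) (q + r * t) + r *\<^sub>R g2 (p + s * t) (q + r * t)) (at t)"
proof -
  have l: "((\<lambda>t. (p + s * t, q + r * t)) has_derivative (\<lambda>h. (s * h, r * h))) (at t)"
    by (auto intro!: derivative_eq_intros)
  have "((\<lambda>z. g (fst z) (snd z)) has_derivative
     (\<lambda>v. fst v *\<^sub>R g1 (p + s * t) (q + r * t) + snd v *\<^sub>R g2 (p + s * t) (q + r * t))) (at (p + s * t, q + r * t))"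
    using assms unfolding total_derivative_def by auto
  from has_derivative_compose[OF l this] show ?thesis
    by (simp add: has_vector_derivative_def scaleR_add_right mult.commute)
qed

lemma total_derivative_partials:
  assumes "total_derivative g g1 g2 D"
  shows "has_partial1 g g1 D" "has_partial2 g g2 D"
proof -
  show "has_partial1 g g1 D"
    using total_derivative_line[OF assms, of 0 1 _ _ 0] by (auto simp: has_partial1_def)
  show "has_partial2 g g2 D"
    using total_derivative_line[OF assms, of _ 0 _ 0 1] by (auto simp: has_partial2_def)
qed

lemma total_derivative_continuous:
  assumes "total_derivative g g1 g2 D"
  shows "continuous_on D (\<lambda>(x, y). g x y)"
proof -
  have "isCont (\<lambda>z. g (fst z) (snd z)) z" if "z \<in> D" for z
    using assms that unfolding total_derivative_def by (cases z) (auto intro: has_derivative_continuous)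
  then show ?thesis by (simp add: case_prod_unfold continuous_at_imp_continuous_on)
qed

lemma smooth2_continuous: "smooth2 n D g \<Longrightarrow> continuous_on D (\<lambda>(x, y). g x y)"
  by (cases n) (auto dest: total_derivative_continuous)

lemma smooth2_Suc_D: "smooth2 (Suc n) D g \<Longrightarrow> smooth2 n D g"
proof (induction n arbitrary: g)
  case 0 then show ?case using smooth2_continuous[of "Suc 0" D g] by (simp del: smooth2.simps(2))
next
  case (Suc n)
  obtain g1 g2 where "total_derivative g g1 g2 D" "smooth2 (Suc n) D g1" "smooth2 (Suc n) D g2"
    using smooth2.simps(2)[THEN iffD1, OF Suc.prems] by (elim exE conjE)
  then have "total_derivative g g1 g2 D \<and> smooth2 n D g1 \<and> smooth2 n D g2" using Suc.IH by blast
  then show ?case by (intro smooth2.simps(2)[THEN iffD2] exI)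
qed

text \<open>
  The mean value theorem applied to \<open>g (x + h) - g x\<close> as a function of the first argument and then
  to \<open>g1\<close> as a function of the second.
\<close>

lemma mixed_difference_mvt:
  fixes g :: "real \<Rightarrow> real \<Rightarrow> real"
  assumes D: "square x y d \<subseteq> D" and h: "0 < h" "h < d"
    and d1: "has_partial1 g g1 D" and d12: "has_partial2 g1 g12 D"
  shows "\<exists>s t. 0 < s \<and> s < h \<and> 0 < t \<and> t < h \<and>
    g (x + h) (y + h) - g (x + h) y - g x (y + h) + g x y = h * (h * g12 (x + s) (y + t))"
proof -
  have inD: "(u, v) \<in> D" if "x \<le> u" "u \<le> x + h" "y \<le> v" "v \<le> y + h" for u v
    by (rule subsetD[OF D]) (use that h in \<open>auto simp: dist_real_def\<close>)
  have "\<exists>z. x < z \<and> z < x + h \<and> (g (x + h) (y + h) - g (x + h) y) - (g x (y + h) - g x y)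
    = (x + h - x) * (g1 z (y + h) - g1 z y)"
  proof (rule MVT2)
    show "x < x + h" using h by simp
    fix u assume "x \<le> u" "u \<le> x + h"
    then have "(u, y + h) \<in> D" "(u, y) \<in> D" using inD h by auto
    then show "((\<lambda>u. g u (y + h) - g u y) has_real_derivative g1 u (y + h) - g1 u y) (at u)"
      using d1 unfolding has_partial1_def has_real_derivative_iff_has_vector_derivative
      by (auto intro!: derivative_intros)
  qed
  then obtain u where u: "x < u" "u < x + h"
    "(g (x + h) (y + h) - g (x + h) y) - (g x (y + h) - g x y) = h * (g1 u (y + h) - g1 u y)" by auto
  have "\<exists>z. y < z \<and> z < y + h \<and> g1 u (y + h) - g1 u y = (y + h - y) * g12 u z"
  proof (rule MVT2)
    show "y < y + h" using h by simp
    fix v assume "y \<le> v" "v \<le> y + h"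
    then have "(u, v) \<in> D" using inD u by auto
    then show "((\<lambda>v. g1 u v) has_real_derivative g12 u v) (at v)"
      using d12 unfolding has_partial2_def has_real_derivative_iff_has_vector_derivative by auto
  qed
  then obtain v where v: "y < v" "v < y + h" "g1 u (y + h) - g1 u y = h * g12 u v" by auto
  show ?thesis
    by (rule exI[of _ "u - x"], rule exI[of _ "v - y"]) (use u v in auto)
qed

text \<open>
  The second difference is symmetric in the two variables. By the preceding lemma it equals
  \<open>h\<^sup>2\<close> times a value of \<open>g12\<close>, and also \<open>h\<^sup>2\<close> times a value of \<open>g21\<close>, at points tending to \<open>(x, y)\<close>.
\<close>

lemma mixed_partials_real:
  fixes g :: "real \<Rightarrow> real \<Rightarrow> real"
  assumes D: "open D" "(x, y) \<in> D"
    and d1: "has_partial1 g g1 D" and d2: "has_partial2 g g2 D" and d12: "has_partial2 g1 g12 D" and d21: "has_partial1 g2 g21 D"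
    and c: "continuous_on D (\<lambda>(x, y). g12 x y)" "continuous_on D (\<lambda>(x, y). g21 x y)"
  shows "g12 x y = g21 x y"
proof (rule ccontr)
  assume ne: "g12 x y \<noteq> g21 x y"
  define e where "e = \<bar>g12 x y - g21 x y\<bar> / 2"
  have e: "e > 0" using ne by (simp add: e_def)
  have *: "\<exists>d>0. square x y d \<subseteq> D \<and> (\<forall>s t. (s, t) \<in> square x y d \<longrightarrow> \<bar>k s t - k x y\<bar> < e)"
    if k: "continuous_on D (\<lambda>(x, y). k x y)" for k :: "real \<Rightarrow> real \<Rightarrow> real"
  proof -
    have "open (D \<inter> (\<lambda>(x, y). k x y) -` ball (k x y) e)"
      by (rule continuous_open_preimage[OF k D(1)]) auto
    moreover have "(x, y) \<in> D \<inter> (\<lambda>(x, y). k x y) -` ball (k x y) e" using D e by simp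
    ultimately obtain d where "d > 0" "square x y d \<subseteq> D \<inter> (\<lambda>(x, y). k x y) -` ball (k x y) e"
      using open_contains_square by blast
    then show ?thesis
      by (intro exI[of _ d]) (auto simp: subset_iff dist_real_def abs_minus_commute)
  qed
  obtain da where da: "da > 0" "square x y da \<subseteq> D" "\<And>s t. (s, t) \<in> square x y da \<Longrightarrow> \<bar>g12 s t - g12 x y\<bar> < e"
    using *[OF c(1)] by blast
  obtain db where db: "db > 0" "square x y db \<subseteq> D" "\<And>s t. (s, t) \<in> square x y db \<Longrightarrow> \<bar>g21 s t - g21 x y\<bar> < e"
    using *[OF c(2)] by blast
  define h where "h = min da db / 2"
  have h: "0 < h" "h < da" "h < db" using da db by (auto simp: h_def)
  obtain s t where st: "0 < s" "s < h" "0 < t" "t < h"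
    "g (x + h) (y + h) - g (x + h) y - g x (y + h) + g x y = h * (h * g12 (x + s) (y + t))"
    using mixed_difference_mvt[OF da(2) h(1,2) d1 d12] by blast
  define D' where "D' = (\<lambda>(x, y). (y, x)) ` D"
  have sD': "square y x db \<subseteq> D'" using db(2) by (force simp: D'_def subset_iff)
  have p': "has_partial1 (\<lambda>x y. g y x) (\<lambda>x y. g2 y x) D'" "has_partial2 (\<lambda>x y. g2 y x) (\<lambda>x y. g21 y x) D'"
    using d2 d21 by (auto simp: has_partial1_def has_partial2_def D'_def)
  obtain s' t' where st': "0 < s'" "s' < h" "0 < t'" "t' < h"
    "g (x + h) (y + h) - g x (y + h) - g (x + h) y + g x y = h * (h * g21 (x + t') (y + s'))"
    using mixed_difference_mvt[OF sD' h(1,3) p'] by auto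
  have "h * (h * g12 (x + s) (y + t)) = h * (h * g21 (x + t') (y + s'))"
    using st(5) st'(5) by linarith
  then have eq: "g12 (x + s) (y + t) = g21 (x + t') (y + s')" using h by simp
  have "\<bar>g12 (x + s) (y + t) - g12 x y\<bar> < e" "\<bar>g21 (x + t') (y + s') - g21 x y\<bar> < e"
    using da(3) db(3) st st' h by (auto simp: dist_real_def)
  moreover have "\<bar>g12 x y - g21 x y\<bar> \<le> \<bar>g12 (x + s) (y + t) - g12 x y\<bar> + \<bar>g12 (x + s) (y + t) - g21 x y\<bar>"
    by arith
  ultimately show False unfolding eq e_def by simp
qed

lemma mixed_partials:
  fixes g :: "real \<Rightarrow> real \<Rightarrow> real ^ 4"
  assumes "open D" "(x, y) \<in> D"
    and "has_partial1 g g1 D" "has_partial2 g g2 D" "has_partial2 g1 g12 D" "has_partial1 g2 g21 D"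
    and "continuous_on D (\<lambda>(x, y). g12 x y)" "continuous_on D (\<lambda>(x, y). g21 x y)"
  shows "g12 x y = g21 x y"
  unfolding vec_eq_iff
proof
  fix i
  have *: "has_partial1 (\<lambda>x y. k x y $ i) (\<lambda>x y. k' x y $ i) D" if "has_partial1 k k' D" for k k' :: "real \<Rightarrow> real \<Rightarrow> real ^ 4"
    using that unfolding has_partial1_def has_vector_derivative_vec has_real_derivative_iff_has_vector_derivative by auto
  have **: "has_partial2 (\<lambda>x y. k x y $ i) (\<lambda>x y. k' x y $ i) D" if "has_partial2 k k' D" for k k' :: "real \<Rightarrow> real \<Rightarrow> real ^ 4"
    using that unfolding has_partial2_def has_vector_derivative_vec has_real_derivative_iff_has_vector_derivative by auto
  have c: "continuous_on D (\<lambda>(x, y). k x y $ i)" if "continuous_on D (\<lambda>(x, y). k x y)" for k :: "real \<Rightarrow> real \<Rightarrow> real ^ 4"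
    using continuous_on_component[OF that, of i] by (simp add: case_prod_unfold)
  show "g12 x y $ i = g21 x y $ i"
    by (rule mixed_partials_real[OF assms(1,2) *[OF assms(3)] **[OF assms(4)] **[OF assms(5)] *[OF assms(6)] c[OF assms(7)] c[OF assms(8)]])
qed

primrec smooth1 :: "nat \<Rightarrow> real set \<Rightarrow> (real \<Rightarrow> real ^ 4) \<Rightarrow> bool" where
  "smooth1 0 B g \<longleftrightarrow> continuous_on B g"
| "smooth1 (Suc n) B g \<longleftrightarrow> (\<exists>g'. (\<forall>b\<in>B. (g has_vector_derivative g' b) (at b)) \<and> smooth1 n B g')"

lemma smooth1_continuous: "smooth1 n B g \<Longrightarrow> continuous_on B g"
proof (cases n)
  case (Suc m)
  assume "smooth1 n B g"
  then obtain g' where "\<forall>b\<in>B. (g has_vector_derivative g' b) (at b)" using Suc by auto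
  then show ?thesis
    by (intro continuous_at_imp_continuous_on) (blast intro: has_vector_derivative_continuous)
qed simp

lemma smooth1_Suc_D: "smooth1 (Suc n) B g \<Longrightarrow> smooth1 n B g"
proof (induction n arbitrary: g)
  case 0 then show ?case by (metis smooth1.simps(1) smooth1_continuous)
next
  case (Suc n) then show ?case by (metis smooth1.simps(2))
qed

lemma smooth1_add: "smooth1 n B u \<Longrightarrow> smooth1 n B v \<Longrightarrow> smooth1 n B (\<lambda>b. u b + v b)"
proof (induction n arbitrary: u v)
  case 0 then show ?case by (auto intro: continuous_intros)
next
  case (Suc n)
  then obtain u' v' where "\<forall>b\<in>B. (u has_vector_derivative u' b) (at b)" "smooth1 n B u'"
    "\<forall>b\<in>B. (v has_vector_derivative v' b) (at b)" "smooth1 n B v'" by auto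
  then show ?case
    by (auto intro!: exI[of _ "\<lambda>b. u' b + v' b"] Suc.IH has_vector_derivative_add)
qed

lemma smooth1_if: "smooth1 n B u \<Longrightarrow> smooth1 n B v \<Longrightarrow> smooth1 n B (if P then u else v)"
  by simp

lemma smooth1_zero: "smooth1 n B (\<lambda>b. 0)"
  by (induction n) (auto intro!: exI[of _ "\<lambda>b. 0"])

lemma smooth1_cross4: "smooth1 n B u \<Longrightarrow> smooth1 n B v \<Longrightarrow> smooth1 n B w \<Longrightarrow> smooth1 n B (\<lambda>b. cross4 (u b) (v b) (w b))"
proof (induction n arbitrary: u v w)
  case 0 then show ?case by (auto intro: continuous_on_cross4)
next
  case (Suc n)
  then obtain u' v' w' where *: "\<forall>b\<in>B. (u has_vector_derivative u' b) (at b)" "smooth1 n B u'"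
    "\<forall>b\<in>B. (v has_vector_derivative v' b) (at b)" "smooth1 n B v'"
    "\<forall>b\<in>B. (w has_vector_derivative w' b) (at b)" "smooth1 n B w'" by auto
  show ?case
    unfolding smooth1.simps
    by (rule exI[of _ "\<lambda>b. cross4 (u' b) (v b) (w b) + cross4 (u b) (v' b) (w b) + cross4 (u b) (v b) (w' b)"])
      (use * smooth1_Suc_D[OF Suc.prems(1)] smooth1_Suc_D[OF Suc.prems(2)] smooth1_Suc_D[OF Suc.prems(3)]
       in \<open>auto intro!: cross4_has_vector_derivative smooth1_add Suc.IH\<close>)
qed

lemma smooth2_imp_smooth1:
  assumes "smooth2 n D g" "\<And>b. b \<in> B \<Longrightarrow> (x, b) \<in> D"
  shows "smooth1 n B (g x)"
  using assms
proof (induction n arbitrary: g)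
  case 0
  have "continuous_on D (\<lambda>(x, y). g x y)" using 0 by simp
  moreover have "continuous_on B (\<lambda>b. (x, b))" by (intro continuous_intros)
  ultimately have "continuous_on B (\<lambda>b. (\<lambda>(x, y). g x y) (x, b))"
    by (rule continuous_on_compose2) (use 0(2) in auto)
  then show ?case by simp
next
  case (Suc n)
  then obtain g1 g2 where g: "total_derivative g g1 g2 D" "smooth2 n D g2" by auto
  then have "has_partial2 g g2 D" by (simp add: total_derivative_partials)
  then show ?case using Suc.IH[OF g(2)] Suc.prems(2)
    by (auto simp: has_partial2_def intro!: exI[of _ "g2 x"])
qed


text \<open>
  The three cases are the trivial, the co-trivial and the rational one. If \<open>\<Xi>\<close> does not vanish at
  \<open>(x1, y1)\<close> for the slope \<open>s1\<close>, lines near the corresponding one are described by their slope and their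
  ordinate at \<open>x1\<close>, so that the covector of a line is \<open>\<Xi>\<close> evaluated at \<open>x1\<close>. The bound \<open>d \<le> 1\<close> keeps
  the lines under consideration inside the domain of \<open>f\<close>.
\<close>

theorem local_trichotomy:
  fixes f :: "real \<Rightarrow> real \<Rightarrow> real ^ 4"
  assumes d: "0 < d" "d \<le> 1" and sm: "smooth2 4 (square 0 0 (2 * d)) f"
    and nonzero: "\<forall>x y. (x, y) \<in> square 0 0 (2 * d) \<longrightarrow> f x y \<noteq> 0"
    and planar: "\<forall>a b. \<bar>a\<bar> < d \<longrightarrow> \<bar>b\<bar> < d \<longrightarrow> (\<exists>\<xi>. \<xi> \<noteq> 0 \<and> (\<forall>x. \<bar>x\<bar> < d \<longrightarrow> \<xi> \<bullet> f x (a * x + b) = 0))"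
  shows "(\<exists>x0 y0 e \<xi>. e > 0 \<and> square x0 y0 e \<subseteq> square 0 0 d \<and> \<xi> \<noteq> 0 \<and> (\<forall>(x, y)\<in>square x0 y0 e. \<xi> \<bullet> f x y = 0)) \<or>
    (\<exists>M \<omega>. open M \<and> M \<noteq> {} \<and> M \<subseteq> square 0 0 d \<and> \<omega> \<noteq> 0 \<and>
      (\<forall>(a, b)\<in>M. \<exists>\<xi>. \<xi> \<noteq> 0 \<and> \<xi> \<bullet> \<omega> = 0 \<and> (\<forall>x. \<bar>x\<bar> < d \<longrightarrow> \<xi> \<bullet> f x (a * x + b) = 0))) \<or>
    (\<exists>W c1 c2. open W \<and> W \<noteq> {} \<and> W \<subseteq> square 0 0 d \<and> c1 < c2 \<and> cubic_lines W c1 c2 f)"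
    (is "?T \<or> ?C \<or> ?Cub")
proof -
  let ?D2 = "square 0 0 (2 * d)" and ?D = "square 0 0 (d / 2)"
  have sm': "smooth2 (Suc (Suc (Suc (Suc 0)))) ?D2 f" using sm by (simp only: numeral_eq_Suc pred_numeral_simps BitM.simps)
  obtain f1 f2 where f: "total_derivative f f1 f2 ?D2"
    and sm1: "smooth2 (Suc (Suc (Suc 0))) ?D2 f1" "smooth2 (Suc (Suc (Suc 0))) ?D2 f2"
    using smooth2.simps(2)[THEN iffD1, OF sm'] by (elim exE conjE)
  obtain f11 f12 where f1: "total_derivative f1 f11 f12 ?D2"
    and sm11: "smooth2 (Suc (Suc 0)) ?D2 f11" "smooth2 (Suc (Suc 0)) ?D2 f12"
    using smooth2.simps(2)[THEN iffD1, OF sm1(1)] by (elim exE conjE)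
  obtain f21 f22 where f2: "total_derivative f2 f21 f22 ?D2"
    and sm22: "smooth2 (Suc (Suc 0)) ?D2 f21" "smooth2 (Suc (Suc 0)) ?D2 f22"
    using smooth2.simps(2)[THEN iffD1, OF sm1(2)] by (elim exE conjE)
  note h0 = total_derivative_partials[OF f] and h1 = total_derivative_partials[OF f1] and h2 = total_derivative_partials[OF f2]
  have opD: "open ?D" "open ?D2" by (simp_all add: open_Times)
  have DD: "?D \<subseteq> ?D2" using d by auto
  have sym: "f12 x y = f21 x y" if "(x, y) \<in> ?D2" for x y
    by (rule mixed_partials[OF opD(2) that h0 h1(2) h2(1) smooth2_continuous[OF sm11(2)] smooth2_continuous[OF sm22(1)]])
  have jet: "jet2 ?D f f1 f2 f11 f12 f22"
  proof
    show "has_partial1 f f1 ?D" "has_partial2 f f2 ?D" "has_partial1 f1 f11 ?D" "has_partial2 f1 f12 ?D"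
      "has_partial1 f2 f12 ?D" "has_partial2 f2 f22 ?D"
      using h0 h1 h2 DD sym unfolding has_partial1_def has_partial2_def by (auto simp: subset_iff)
    show "continuous_on ?D (\<lambda>(x, y). f x y)" "continuous_on ?D (\<lambda>(x, y). f1 x y)" "continuous_on ?D (\<lambda>(x, y). f2 x y)"
      using smooth2_continuous[OF sm] smooth2_continuous[OF sm1(1)] smooth2_continuous[OF sm1(2)] continuous_on_subset[OF _ DD] by blast+
  qed (rule opD)
  interpret jet2 ?D f f1 f2 f11 f12 f22 by (rule jet)
  define \<Xi> where "\<Xi> x y c = cross4 (f x y) (f1 x y + c *\<^sub>R f2 x y) (f11 x y + (2 * c) *\<^sub>R f12 x y + c^2 *\<^sub>R f22 x y)" for x y c
  show ?thesis
  proof (cases "\<forall>x y c. (x, y) \<in> ?D \<and> c \<in> {-d<..<d} \<longrightarrow> \<Xi> x y c = 0")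
    case True
    have "\<exists>x0 y0 e \<xi>. e > 0 \<and> square x0 y0 e \<subseteq> ?D \<and> \<xi> \<noteq> 0 \<and> (\<forall>(x, y)\<in>square x0 y0 e. \<xi> \<bullet> f x y = 0)"
    proof (rule hyperplane_of_flat_lines[of "-d" d])
      show "?D \<noteq> {}" using d by auto
      show "-d < d" using d by simp
      show "f x y \<noteq> 0" if "(x, y) \<in> ?D" for x y using nonzero that DD by blast
    qed (use True in \<open>auto simp: \<Xi>_def\<close>)
    then obtain x0 y0 e \<xi> where *: "e > 0" "square x0 y0 e \<subseteq> ?D" "\<xi> \<noteq> 0" "\<forall>(x, y)\<in>square x0 y0 e. \<xi> \<bullet> f x y = 0"
      by (elim exE conjE)
    have "?D \<subseteq> square 0 0 d" using d by auto
    then have "square x0 y0 e \<subseteq> square 0 0 d" using *(2) by (rule order_trans[rotated])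
    then have ?T using *(1,3,4) by (intro exI conjI)
    then show ?thesis ..
  next
    case False
    then obtain x1 y1 s1 where xys: "(x1, y1) \<in> ?D" "s1 \<in> {-d<..<d}" "\<Xi> x1 y1 s1 \<noteq> 0"
      by blast
    have s1: "\<bar>s1\<bar> < d" using xys(2) by auto
    have x1: "\<bar>x1\<bar> < d / 2" and y1: "\<bar>y1\<bar> < d / 2" using xys(1) by (auto simp: dist_real_def)
    define H :: "nat \<Rightarrow> real \<Rightarrow> real ^ 4" where "H k = 
      (if k = 0 then (\<lambda>b. cross4 (f x1 b) (f1 x1 b) (f11 x1 b))
       else if k = 1 then (\<lambda>b. cross4 (f x1 b) (f2 x1 b) (f11 x1 b) + (cross4 (f x1 b) (f1 x1 b) (f12 x1 b) + cross4 (f x1 b) (f1 x1 b) (f12 x1 b)))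
       else if k = 2 then (\<lambda>b. cross4 (f x1 b) (f1 x1 b) (f22 x1 b) + (cross4 (f x1 b) (f2 x1 b) (f12 x1 b) + cross4 (f x1 b) (f2 x1 b) (f12 x1 b)))
       else if k = 3 then (\<lambda>b. cross4 (f x1 b) (f2 x1 b) (f22 x1 b))
       else (\<lambda>b. 0))" for k
    have cubH: "cubic_family H a b = \<Xi> x1 b a" for a b
      unfolding cubic_family_def \<Xi>_def cross4_along_direction by (simp add: H_def)
    let ?I = "ball 0 (d / 2) :: real set"
    have B0: "(x1, b) \<in> ?D2" if "b \<in> ?I" for b using that x1 d by (auto simp: dist_real_def)
    have cn: "smooth1 (Suc (Suc 0)) ?I (g x1)" if "smooth2 (Suc (Suc 0)) ?D2 g" for g
      by (rule smooth2_imp_smooth1[OF that B0])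
    have sm3: "smooth2 (Suc (Suc 0)) ?D2 f" "smooth2 (Suc (Suc 0)) ?D2 f1" "smooth2 (Suc (Suc 0)) ?D2 f2"
      by (fact smooth2_Suc_D[OF smooth2_Suc_D[OF sm']] smooth2_Suc_D[OF sm1(1)] smooth2_Suc_D[OF sm1(2)])+
    have "smooth1 (Suc (Suc 0)) ?I (H k)" for k
      unfolding H_def
      by (intro smooth1_if smooth1_add smooth1_cross4 smooth1_zero cn[OF sm3(1)] cn[OF sm3(2)] cn[OF sm3(3)]
        cn[OF sm11(1)] cn[OF sm11(2)] cn[OF sm22(2)])
    from smooth1.simps(2)[THEN iffD1, OF this] have "\<exists>g' g''. (\<forall>b\<in>?I. (H k has_vector_derivative g' b) (at b)) \<and> (\<forall>b\<in>?I. (g' has_vector_derivative g'' b) (at b)) \<and> continuous_on ?I g''" for k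
      unfolding smooth1.simps by blast
    then obtain H' H'' where H: "\<And>k b. b \<in> ?I \<Longrightarrow> (H k has_vector_derivative H' k b) (at b)"
      "\<And>k b. b \<in> ?I \<Longrightarrow> (H' k has_vector_derivative H'' k b) (at b)"
      "\<And>k. continuous_on ?I (H'' k)" by metis
    have cH: "continuous_on (UNIV \<times> ?I) (\<lambda>z. H k (snd z))" for k
    proof (rule continuous_on_compose2[of ?I "H k"])
      show "continuous_on ?I (H k)"
        using H(1) by (intro continuous_at_imp_continuous_on) (blast intro: has_vector_derivative_continuous)
    qed (auto intro!: continuous_intros)
    define N where "N = (ball 0 d \<times> ?I) \<inter> (\<lambda>(a, b). cubic_family H a b) -` (- {0})"
    have "open N" unfolding N_def
    proof (rule continuous_open_preimage)
      show "continuous_on (ball 0 d \<times> ?I) (\<lambda>(a, b). cubic_family H a b)"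
        unfolding cubic_family_def case_prod_unfold
        by (intro continuous_intros continuous_on_subset[OF cH]) auto
    qed (auto simp: open_Times)
    moreover have "(s1, y1) \<in> N" using xys y1 s1 by (simp add: N_def cubH dist_real_def)
    ultimately obtain \<delta> where \<delta>: "\<delta> > 0" "square s1 y1 \<delta> \<subseteq> N" using open_contains_square by blast
    let ?A = "ball s1 \<delta>" and ?B = "ball y1 \<delta>"
    have AB: "\<bar>a\<bar> < d" "\<bar>b\<bar> < d / 2" "cubic_family H a b \<noteq> 0" "\<bar>a * x1\<bar> < d / 2" if "a \<in> ?A" "b \<in> ?B" for a b
    proof -
      have "(a, b) \<in> square s1 y1 \<delta>" using that by simp
      from subsetD[OF \<delta>(2) this] show *: "\<bar>a\<bar> < d" "\<bar>b\<bar> < d / 2" "cubic_family H a b \<noteq> 0" by (auto simp: N_def)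
      have "\<bar>a\<bar> * \<bar>x1\<bar> \<le> 1 * \<bar>x1\<bar>" using * d by (intro mult_right_mono) auto
      then show "\<bar>a * x1\<bar> < d / 2" using x1 by (simp add: abs_mult)
    qed
    have BB0: "?B \<subseteq> ?I"
      using AB(2)[of s1] \<delta>(1) by (auto simp: dist_real_def)
    \<comment> \<open>The covector \<open>\<xi>\<close> provided by the hypothesis annihilates \<open>f\<close> and its first two derivatives along the
      line at \<open>x1\<close>, so it is a multiple of \<open>\<Xi>\<close> there; hence \<open>\<Xi>\<close> annihilates \<open>f\<close> along the whole line.\<close>
    have K: "cubic_family H a b \<bullet> f x (a * x + (b - a * x1)) = 0" if a: "a \<in> ?A" and b: "b \<in> ?B" and x: "\<bar>x\<bar> < d" for a b x
    proof -
      note ab = AB[OF a b]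
      have b': "\<bar>b - a * x1\<bar> < d" using ab by linarith
      obtain \<xi> where \<xi>: "\<xi> \<noteq> 0" "\<And>x. \<bar>x\<bar> < d \<Longrightarrow> \<xi> \<bullet> f x (a * x + (b - a * x1)) = 0"
        using planar ab(1) b' by blast
      let ?b = "b - a * x1"
      have inD2: "(x, a * x + ?b) \<in> ?D2" if "\<bar>x\<bar> < d" for x
      proof -
        have "\<bar>a\<bar> * \<bar>x\<bar> \<le> 1 * \<bar>x\<bar>" using ab d by (intro mult_right_mono) auto
        then have "\<bar>a * x\<bar> < d" using that by (simp add: abs_mult)
        then have "\<bar>a * x + ?b\<bar> < 2 * d" using b' by linarith
        then show ?thesis using that
          unfolding mem_Times_iff mem_ball dist_real_def fst_conv snd_conv by linarith
      qed
      have der: "((\<lambda>x. \<xi> \<bullet> g x (a * x + ?b)) has_real_derivative \<xi> \<bullet> (g1 x (a * x + ?b) + a *\<^sub>R g2 x (a * x + ?b))) (at x)"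
        if "total_derivative g g1 g2 ?D2" "\<bar>x\<bar> < d" for g g1 g2 x
        using bounded_linear.has_vector_derivative[OF bounded_linear_inner_right
            total_derivative_line[OF that(1), of 0 1 x ?b a], of \<xi>] inD2[OF that(2)]
        by (simp add: has_real_derivative_iff_has_vector_derivative add.commute)
      have zero: "D = 0" if "(\<phi> has_real_derivative D) (at t)" "\<bar>t\<bar> < d" "\<And>t. \<bar>t\<bar> < d \<Longrightarrow> \<phi> t = 0" for \<phi> D t
      proof -
        have "((\<lambda>t. 0) has_real_derivative D) (at t)"
          by (rule has_field_derivative_transform_within_open[OF that(1) open_ball[of 0 d]]) (use that(2,3) in \<open>auto simp: dist_real_def\<close>)
        then show ?thesis using DERIV_unique DERIV_const by blast
      qed
      have z1: "\<xi> \<bullet> f1 x (a * x + ?b) + a * (\<xi> \<bullet> f2 x (a * x + ?b)) = 0" if "\<bar>x\<bar> < d" for x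
        using zero[OF der[OF f that] that \<xi>(2)] by (simp add: inner_add_right)
      have "((\<lambda>x. \<xi> \<bullet> f1 x (a * x + ?b) + a * (\<xi> \<bullet> f2 x (a * x + ?b))) has_real_derivative
          \<xi> \<bullet> (f11 x (a * x + ?b) + a *\<^sub>R f12 x (a * x + ?b)) + a * (\<xi> \<bullet> (f21 x (a * x + ?b) + a *\<^sub>R f22 x (a * x + ?b)))) (at x)"
        if "\<bar>x\<bar> < d" for x
        by (auto intro!: derivative_eq_intros der[OF f1 that] der[OF f2 that])
      from zero[OF this _ z1] have z2: "\<xi> \<bullet> (f11 x (a * x + ?b) + a *\<^sub>R f12 x (a * x + ?b)) + a * (\<xi> \<bullet> (f21 x (a * x + ?b) + a *\<^sub>R f22 x (a * x + ?b))) = 0"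
        if "\<bar>x\<bar> < d" for x using that by blast
      have x1d: "\<bar>x1\<bar> < d" using x1 d by linarith
      have y: "a * x1 + ?b = b" by simp
      have "(x1, b) \<in> ?D2" using inD2[OF x1d] by simp
      then have "parallel \<xi> (\<Xi> x1 b a)" unfolding \<Xi>_def
        using \<xi>(2)[OF x1d] z1[OF x1d] z2[OF x1d] sym[of x1 b]
        by (intro parallel_cross4) (simp_all add: inner_add_right algebra_simps power2_eq_square)
      then obtain k where "cubic_family H a b = k *\<^sub>R \<xi>"
        using parallel_scale[OF parallel_sym \<xi>(1)] by (auto simp: cubH)
      then show ?thesis using \<xi>(2)[OF x] by simp
    qed
    interpret dual_map ?A ?B "- (d / 2)" "d / 2" "\<lambda>x y. f (x1 + x) y" H H' H''
    proof
      show "- (d / 2) < d / 2" using d by simp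
      fix a b x assume "a \<in> ?A" "b \<in> ?B" "- (d / 2) < x" "x < d / 2"
      then show "cubic_family H a b \<bullet> f (x1 + x) (a * x + b) = 0"
        using K[of a b "x1 + x"] x1 by (simp add: algebra_simps)
    next
      show "continuous_on ?B (H'' k)" for k by (rule continuous_on_subset[OF H(3) BB0])
    qed (use \<delta> H BB0 AB in auto)
    from dual_dichotomy show ?thesis
    proof (elim disjE exE conjE)
      fix a0 b0 e \<omega> assume *: "e > 0" "square a0 b0 e \<subseteq> ?A \<times> ?B" "\<omega> \<noteq> 0" "\<forall>(a, b)\<in>square a0 b0 e. \<omega> \<bullet> cubic_family H a b = 0"
      define M where "M = (\<lambda>(a, b). (a, b + a * x1)) -` square a0 b0 e"
      have M: "a \<in> ?A \<and> b + a * x1 \<in> ?B \<and> \<omega> \<bullet> cubic_family H a (b + a * x1) = 0" if "(a, b) \<in> M" for a b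
      proof -
        have "(a, b + a * x1) \<in> square a0 b0 e" using that by (simp add: M_def)
        then show ?thesis using subsetD[OF *(2), of "(a, b + a * x1)"] *(4) by blast
      qed
      have "open M" unfolding M_def case_prod_unfold
        by (rule open_vimage) (auto intro!: open_Times continuous_intros)
      moreover have "(a0, b0 - a0 * x1) \<in> M" using *(1) by (simp add: M_def)
      moreover have "M \<subseteq> square 0 0 d"
      proof (rule subrelI)
        fix a b assume "(a, b) \<in> M"
        then have "a \<in> ?A" "b + a * x1 \<in> ?B" using M by auto
        note ab = AB[OF this]
        have "\<bar>b\<bar> < d" using ab by linarith
        then show "(a, b) \<in> square 0 0 d" using ab by simp
      qed
      moreover have "\<forall>(a, b)\<in>M. \<exists>\<xi>. \<xi> \<noteq> 0 \<and> \<xi> \<bullet> \<omega> = 0 \<and> (\<forall>x. \<bar>x\<bar> < d \<longrightarrow> \<xi> \<bullet> f x (a * x + b) = 0)"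
      proof (clarify)
        fix a b assume "(a, b) \<in> M"
        then have ab: "a \<in> ?A" "b + a * x1 \<in> ?B" "\<omega> \<bullet> cubic_family H a (b + a * x1) = 0" using M by auto
        show "\<exists>\<xi>. \<xi> \<noteq> 0 \<and> \<xi> \<bullet> \<omega> = 0 \<and> (\<forall>x. \<bar>x\<bar> < d \<longrightarrow> \<xi> \<bullet> f x (a * x + b) = 0)"
          using ab AB(3)[OF ab(1,2)] K[OF ab(1,2)]
          by (intro exI[of _ "cubic_family H a (b + a * x1)"]) (simp add: inner_commute)
      qed
      ultimately have ?C using *(3) by blast
      then show ?thesis by blast
    next
      fix W c1 c2 a0 assume *: "open W" "W \<noteq> {}" "c1 < c2" "a0 \<in> ?A"
        "\<forall>(x, y)\<in>W. - (d / 2) < x \<and> x < d / 2 \<and> y - a0 * x \<in> ?B" "cubic_lines W c1 c2 (\<lambda>x y. f (x1 + x) y)"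
      define W' where "W' = (\<lambda>(x, y). (x - x1, y)) -` W"
      have "open W'" unfolding W'_def case_prod_unfold
        by (rule open_vimage[OF *(1)]) (auto intro!: continuous_intros)
      moreover obtain x y where "(x, y) \<in> W" using *(2) by auto
      then have "(x + x1, y) \<in> W'" by (simp add: W'_def)
      moreover have "W' \<subseteq> square 0 0 d"
      proof (rule subrelI)
        fix x y assume "(x, y) \<in> W'"
        then have **: "- (d / 2) < x - x1" "x - x1 < d / 2" "y - a0 * (x - x1) \<in> ?B" using *(5) by (auto simp: W'_def)
        note ab = AB[OF *(4) **(3)]
        have "\<bar>a0\<bar> * \<bar>x - x1\<bar> \<le> 1 * \<bar>x - x1\<bar>" using ab d by (intro mult_right_mono) auto
        then have "\<bar>a0 * (x - x1)\<bar> < d / 2" using ** by (simp add: abs_mult)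
        then have "\<bar>y\<bar> < d" using ab by linarith
        moreover have "\<bar>x\<bar> < d" using ** x1 by linarith
        ultimately show "(x, y) \<in> square 0 0 d" by simp
      qed
      moreover have "cubic_lines W' c1 c2 f"
        unfolding cubic_lines_def
      proof (intro allI impI)
        fix a b assume "c1 < a" "a < c2"
        then obtain g where g: "cubic_curve g"
          "\<And>x. (x, a * x + (b + a * x1)) \<in> W \<Longrightarrow> g x \<noteq> 0 \<and> parallel (f (x1 + x) (a * x + (b + a * x1))) (g x)"
          using *(6) unfolding cubic_lines_def by blast
        have e: "a * (x - x1) + (b + a * x1) = a * x + b" for x by (simp add: algebra_simps)
        show "\<exists>g. cubic_curve g \<and> (\<forall>x. (x, a * x + b) \<in> W' \<longrightarrow> g x \<noteq> 0 \<and> parallel (f x (a * x + b)) (g x))"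
          using cubic_curve_shift[OF g(1), of "-x1" 1] g(2)[of "x - x1" for x] unfolding e
          by (intro exI[of _ "\<lambda>x. g (- x1 + 1 * x)"]) (simp add: W'_def)
      qed
      ultimately have ?Cub using *(3) by blast
      then show ?thesis by blast
    qed
  qed
qed

section \<open>Polynomials in one and two variables\<close>

text \<open>
  Gaussian elimination without division. A row \<open>r0\<close> with nonzero entry in the column \<open>k\<close> eliminates
  that column from all the rows, of which there may be infinitely many. Only the finitely many zeros of
  the pivot are lost from \<open>T\<close>.
\<close>

lemma polynomial_kernel:
  fixes R :: "('j \<Rightarrow> real poly) set"
  assumes "finite J" "infinite T"
    and "\<And>t. t \<in> T \<Longrightarrow> \<exists>u. (\<exists>j\<in>J. u j \<noteq> 0) \<and> (\<forall>r\<in>R. (\<Sum>j\<in>J. poly (r j) t * u j) = 0)"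
  shows "\<exists>u :: 'j \<Rightarrow> real poly. (\<exists>j\<in>J. u j \<noteq> 0) \<and> (\<forall>r\<in>R. (\<Sum>j\<in>J. r j * u j) = 0)"
  using assms
proof (induction J arbitrary: R T rule: finite_induct)
  case empty
  then obtain t where "t \<in> T" using infinite_imp_nonempty by blast
  then show ?case using empty(2) by blast
next
  case (insert k J)
  show ?case
  proof (cases "\<forall>r\<in>R. r k = 0")
    case True
    show ?thesis
      by (rule exI[of _ "\<lambda>j. if j = k then 1 else 0"]) (use True in \<open>auto intro!: sum.neutral\<close>)
  next
    case False
    then obtain r0 where r0: "r0 \<in> R" "r0 k \<noteq> 0" by blast
    define p where "p = r0 k"
    define R' where "R' = (\<lambda>r j. p * r j - r k * r0 j) ` R"
    define T' where "T' = T - {t. poly p t = 0}"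
    have infT: "infinite T'"
      unfolding T'_def using insert.prems(1) poly_roots_finite[of p] r0(2) by (simp add: p_def)
    have kern: "\<exists>u. (\<exists>j\<in>J. u j \<noteq> 0) \<and> (\<forall>r\<in>R'. (\<Sum>j\<in>J. poly (r j) t * u j) = 0)" if t: "t \<in> T'" for t
    proof -
      obtain u where u: "\<exists>j\<in>insert k J. u j \<noteq> 0" "\<And>r. r \<in> R \<Longrightarrow> (\<Sum>j\<in>insert k J. poly (r j) t * u j) = 0"
        using insert.prems(2)[of t] t by (auto simp: T'_def)
      have s: "(\<Sum>j\<in>J. poly (r j) t * u j) = - (poly (r k) t * u k)" if "r \<in> R" for r
        using u(2)[OF that] insert.hyps by simp
      have point: "poly p t \<noteq> 0" using t by (simp add: T'_def)
      have "\<exists>j\<in>J. u j \<noteq> 0"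
      proof (rule ccontr)
        assume "\<not> ?thesis"
        then have "u k \<noteq> 0" "(\<Sum>j\<in>J. poly (r0 j) t * u j) = 0" using u(1) by auto
        then show False using s[OF r0(1)] point by (simp add: p_def)
      qed
      moreover have "(\<Sum>j\<in>J. poly (r' j) t * u j) = 0" if r': "r' \<in> R'" for r'
      proof -
        obtain r where r: "r \<in> R" "r' = (\<lambda>j. p * r j - r k * r0 j)" using r' unfolding R'_def by blast
        have "(\<Sum>j\<in>J. poly (r' j) t * u j) = poly p t * (\<Sum>j\<in>J. poly (r j) t * u j) - poly (r k) t * (\<Sum>j\<in>J. poly (r0 j) t * u j)"
          by (simp add: r(2) sum_distrib_left sum_subtractf[symmetric] algebra_simps)
        also have "\<dots> = 0" by (simp add: s[OF r(1)] s[OF r0(1)] p_def)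
        finally show ?thesis .
      qed
      ultimately show ?thesis by blast
    qed
    from insert.IH[OF infT kern]
    obtain u' where u': "\<exists>j\<in>J. u' j \<noteq> 0" "\<And>r. r \<in> R' \<Longrightarrow> (\<Sum>j\<in>J. r j * u' j) = 0"
      by blast
    define u where "u j = (if j = k then - (\<Sum>j\<in>J. r0 j * u' j) else p * u' j)" for j
    have "\<exists>j\<in>insert k J. u j \<noteq> 0" using u'(1) r0(2) insert.hyps(2) by (auto simp: u_def p_def)
    moreover have "(\<Sum>j\<in>insert k J. r j * u j) = 0" if "r \<in> R" for r
    proof -
      have "(\<Sum>j\<in>J. r j * u j) = (\<Sum>j\<in>J. r j * (p * u' j))"
        by (rule sum.cong) (use insert.hyps(2) in \<open>auto simp: u_def\<close>)
      then have "(\<Sum>j\<in>insert k J. r j * u j) = r k * u k + (\<Sum>j\<in>J. r j * (p * u' j))"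
        using insert.hyps by simp
      also have "\<dots> = (\<Sum>j\<in>J. (p * r j - r k * r0 j) * u' j)"
        by (simp add: u_def sum_distrib_left sum_subtractf[symmetric] algebra_simps)
      also have "\<dots> = 0" using u'(2)[of "\<lambda>j. p * r j - r k * r0 j"] that by (auto simp: R'_def)
      finally show ?thesis .
    qed
    ultimately show ?thesis by blast
  qed
qed

text \<open>
  Evaluation of a polynomial in two variables. The outer variable is \<open>x\<close> and the coefficients are
  polynomials in \<open>y\<close>.
\<close>

definition eval2 :: "real poly poly \<Rightarrow> real \<Rightarrow> real \<Rightarrow> real" where
  "eval2 p x y = poly (poly p [:x:]) y"

lemma eval2_simps [simp]:
  "eval2 0 x y = 0" "eval2 (p + q) x y = eval2 p x y + eval2 q x y" "eval2 (p - q) x y = eval2 p x y - eval2 q x y"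
  "eval2 (p * q) x y = eval2 p x y * eval2 q x y" "eval2 (p ^ n) x y = eval2 p x y ^ n"
  "eval2 (pCons a p) x y = poly a y + x * eval2 p x y"
  by (simp_all add: eval2_def)

lemma eval2_sum: "eval2 (\<Sum>i\<in>I. p i) x y = (\<Sum>i\<in>I. eval2 (p i) x y)"
  by (simp add: eval2_def poly_sum)

lemma continuous_on_eval2: "continuous_on S (\<lambda>(x, y). eval2 p x y)"
  unfolding case_prod_unfold
  by (induction p) (auto intro!: continuous_intros)

lemma eval2_zero_on_grid:
  assumes A: "infinite A" and B: "infinite B" and z: "\<And>x y. x \<in> A \<Longrightarrow> y \<in> B \<Longrightarrow> eval2 p x y = 0"
  shows "p = 0"
proof -
  have "poly p [:x:] = 0" if "x \<in> A" for x
  proof (rule ccontr)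
    assume "poly p [:x:] \<noteq> 0"
    then have "finite {y. poly (poly p [:x:]) y = 0}" by (rule poly_roots_finite)
    moreover have "B \<subseteq> {y. poly (poly p [:x:]) y = 0}" using z[OF that] by (auto simp: eval2_def)
    ultimately show False using B finite_subset by blast
  qed
  then have "(\<lambda>x. [:x:]) ` A \<subseteq> {q. poly p q = 0}" by blast
  moreover have "infinite ((\<lambda>x. [:x:]) ` A)" using A by (subst finite_image_iff) (auto simp: inj_on_def)
  ultimately have "infinite {q. poly p q = 0}" using finite_subset by blast
  then show "p = 0" using poly_roots_finite by blast
qed

lemma infinite_real_ball: "d > 0 \<Longrightarrow> infinite (ball (x::real) d)"
  by (simp add: ball_eq_greaterThanLessThan)

definition substitute :: "real poly \<Rightarrow> real poly poly \<Rightarrow> real poly poly" where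
  "substitute u L = poly (map_poly (\<lambda>c. [:[:c:]:]) u) L"

lemma eval2_substitute: "eval2 (substitute u L) x y = poly u (eval2 L x y)"
  unfolding substitute_def by (induction u) (simp_all add: map_poly_pCons)

text \<open>
  The vectors \<open>P\<close> and \<open>Q\<close> are proportional over the field of fractions. Since \<open>P i0\<close> divides
  \<open>P i * Q i0\<close> for every \<open>i\<close>, it divides the greatest common divisor of these products, which is
  \<open>Q i0\<close> because \<open>P\<close> is primitive. The quotient is the factor of proportionality.
\<close>

lemma proportional_to_primitive:
  fixes P Q :: "'i::finite \<Rightarrow> 'a::factorial_ring_gcd"
  assumes pq: "\<And>i j. P i * Q j = P j * Q i"
    and nz: "P i0 \<noteq> 0" and prim: "\<And>d. (\<And>i. d dvd P i) \<Longrightarrow> is_unit d"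
  shows "\<exists>g. \<forall>m. Q m = g * P m"
proof -
  have "P i0 dvd P i * Q i0" for i using pq[of i i0] by (metis dvd_triv_left)
  then have "P i0 dvd Q i0 * P i" for i by (simp add: mult.commute)
  then have "P i0 dvd Gcd ((*) (Q i0) ` range P)"
    by (intro Gcd_greatest) auto
  also have "Gcd ((*) (Q i0) ` range P) = normalize (Q i0 * Gcd (range P))"
    by (rule Gcd_mult)
  also have "is_unit (Gcd (range P))"
    by (rule prim) (auto intro: Gcd_dvd)
  then have "normalize (Q i0 * Gcd (range P)) dvd Q i0" by simp
  finally obtain g where g: "Q i0 = P i0 * g" by (auto elim: dvdE)
  have "Q m = g * P m" for m
  proof -
    have "P i0 * Q m = P i0 * (g * P m)" using pq[of i0 m] g by (simp add: algebra_simps)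
    then show ?thesis using nz by simp
  qed
  then show ?thesis by blast
qed

lemma primitive_part_exists:
  fixes Q :: "'i::finite \<Rightarrow> 'a::factorial_ring_gcd"
  assumes "Q i0 \<noteq> 0"
  shows "\<exists>G P. G \<noteq> 0 \<and> (\<forall>i. Q i = G * P i) \<and> (\<forall>d. (\<forall>i. d dvd P i) \<longrightarrow> is_unit d)"
proof -
  define G where "G = Gcd (range Q)"
  have G: "G dvd Q i" for i by (auto simp: G_def intro: Gcd_dvd)
  then have "G \<noteq> 0" using assms by (metis dvd_0_left_iff)
  define P where "P i = Q i div G" for i
  have QP: "Q i = G * P i" for i using G by (simp add: P_def)
  have "is_unit d" if "\<forall>i. d dvd P i" for d
  proof -
    have "G * d dvd Q i" for i using that by (simp add: QP)
    then have "G * d dvd G" unfolding G_def by (intro Gcd_greatest) auto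
    then show ?thesis using \<open>G \<noteq> 0\<close> by (metis dvd_times_left_cancel_iff mult.right_neutral)
  qed
  then show ?thesis using \<open>G \<noteq> 0\<close> QP by blast
qed

lemma coeff_mult_of_degree_le:
  fixes p q :: "'a::comm_semiring_0 poly"
  assumes "degree p \<le> m" "degree q \<le> n"
  shows "coeff (p * q) (m + n) = coeff p m * coeff q n"
proof -
  have "coeff (p * q) (m + n) = (\<Sum>i\<le>m + n. coeff p i * coeff q (m + n - i))"
    by (simp add: coeff_mult)
  also have "\<dots> = (\<Sum>i\<in>{m}. coeff p i * coeff q (m + n - i))"
  proof (rule sum.mono_neutral_right)
    show "\<forall>i\<in>{..m + n} - {m}. coeff p i * coeff q (m + n - i) = 0"
    proof
      fix i assume i: "i \<in> {..m + n} - {m}"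
      show "coeff p i * coeff q (m + n - i) = 0"
      proof (cases "i < m")
        case True
        then have "degree q < m + n - i" using assms by linarith
        then show ?thesis by (simp add: coeff_eq_0)
      next
        case False
        then have "degree p < i" using assms i by auto
        then show ?thesis by (simp add: coeff_eq_0)
      qed
    qed
  qed auto
  finally show ?thesis by simp
qed

lemma degree_linear_power_le: "degree ([:y, a:] ^ n) \<le> n"
  using degree_power_le[of "[:y, a:]" n] by (auto intro: le_trans split: if_splits)

lemma coeff_linear_power_top: "coeff ([:y, a:] ^ n) n = a ^ n"
proof (induction n)
  case (Suc n)
  have "degree [:y, a:] \<le> 1" by simp
  from coeff_mult_of_degree_le[OF this degree_linear_power_le[of y a n]] show ?case using Suc by simp
qed simp

section \<open>Maps that are cubic on lines are cubic\<close>

definition restrict_to_line :: "real poly poly \<Rightarrow> real \<Rightarrow> real \<Rightarrow> real \<Rightarrow> real poly" where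
  "restrict_to_line p x y a = (\<Sum>i\<le>degree p. pcompose (coeff p i) [:y, a:] * [:x, 1:] ^ i)"

lemma poly_restrict_to_line: "poly (restrict_to_line p x y a) \<tau> = eval2 p (x + \<tau>) (y + a * \<tau>)"
  unfolding restrict_to_line_def eval2_def poly_altdef[of p]
  by (simp add: poly_sum poly_pcompose algebra_simps)

lemma degree_pcompose_linear_le: "degree c \<le> n \<Longrightarrow> degree (pcompose c [:y, a:]) \<le> n" for a :: real
  using degree_pcompose_le[of c "[:y, a:]"] by (auto intro: le_trans split: if_splits)

lemma coeff_pcompose_linear_top:
  fixes a :: real assumes "degree c \<le> n"
  shows "coeff (pcompose c [:y, a:]) n = coeff c n * a ^ n"
proof -
  have "poly (pcompose c [:y, a:]) = poly (\<Sum>i\<le>degree c. smult (coeff c i) ([:y, a:] ^ i))"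
    by (rule ext) (simp add: poly_pcompose poly_sum poly_altdef[of c])
  then have "pcompose c [:y, a:] = (\<Sum>i\<le>degree c. smult (coeff c i) ([:y, a:] ^ i))"
    by (simp add: poly_eq_poly_eq_iff)
  then have "coeff (pcompose c [:y, a:]) n = (\<Sum>i\<le>degree c. coeff c i * coeff ([:y, a:] ^ i) n)"
    by (simp add: coeff_sum)
  also have "\<dots> = (\<Sum>i\<le>n. coeff c i * coeff ([:y, a:] ^ i) n)"
    by (rule sum.mono_neutral_left) (use assms in \<open>auto simp: coeff_eq_0\<close>)
  also have "\<dots> = (\<Sum>i\<in>{n}. coeff c i * coeff ([:y, a:] ^ i) n)"
  proof (rule sum.mono_neutral_right)
    show "\<forall>i\<in>{..n} - {n}. coeff c i * coeff ([:y, a:] ^ i) n = 0"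
    proof
      fix i assume "i \<in> {..n} - {n}"
      then have "degree ([:y, a:] ^ i) < n" using degree_linear_power_le[of y a i] by auto
      then show "coeff c i * coeff ([:y, a:] ^ i) n = 0" by (simp add: coeff_eq_0)
    qed
  qed auto
  finally show ?thesis by (simp add: coeff_linear_power_top)
qed

text \<open>
  The coefficient of degree \<open>D\<close> comes from the homogeneous part of degree \<open>D\<close> of \<open>p\<close> alone,
  evaluated at the direction \<open>(1, a)\<close>.
\<close>

lemma coeff_restrict_to_line_top:
  assumes van: "\<And>i j. i + j > D \<Longrightarrow> coeff (coeff p i) j = 0"
  shows "coeff (restrict_to_line p x y a) D = (\<Sum>i\<le>D. coeff (coeff p i) (D - i) * a ^ (D - i))"
proof -
  have dg: "degree (coeff p i) \<le> D - i" for i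
    by (rule degree_le) (use van[of i] in auto)
  have p0: "coeff p i = 0" if "i > D" for i
    by (rule poly_eqI) (use van[of i] that in auto)
  have "coeff (pcompose (coeff p i) [:y, a:] * [:x, 1:] ^ i) D = coeff (coeff p i) (D - i) * a ^ (D - i)" if "i \<le> D" for i
  proof -
    have 1: "degree (pcompose (coeff p i) [:y, a:]) \<le> D - i" by (rule degree_pcompose_linear_le[OF dg])
    have 2: "degree ([:x, 1:] ^ i) \<le> i" by (rule degree_linear_power_le)
    show ?thesis
      using coeff_mult_of_degree_le[OF 1 2] coeff_pcompose_linear_top[OF dg[of i], where y=y and a=a]
        coeff_linear_power_top[of x 1 i] that
      by simp
  qed
  then have "(\<Sum>i\<le>D. coeff (pcompose (coeff p i) [:y, a:] * [:x, 1:] ^ i) D) = (\<Sum>i\<le>D. coeff (coeff p i) (D - i) * a ^ (D - i))"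
    by simp
  moreover have "degree p \<le> D" by (rule degree_le) (use p0 in auto)
  then have "coeff (restrict_to_line p x y a) D = (\<Sum>i\<le>D. coeff (pcompose (coeff p i) [:y, a:] * [:x, 1:] ^ i) D)"
    unfolding restrict_to_line_def coeff_sum
    by (intro sum.mono_neutral_left) (auto simp: coeff_eq_0)
  ultimately show ?thesis by simp
qed

definition cubic_along :: "real \<Rightarrow> real poly poly \<Rightarrow> bool" where
  "cubic_along a p \<longleftrightarrow> (\<forall>x y. \<exists>q. degree q \<le> 3 \<and> (\<forall>\<tau>. eval2 p (x + \<tau>) (y + a * \<tau>) = poly q \<tau>))"

text \<open>
  The homogeneous part of highest degree of \<open>p\<close> is nonzero on all but finitely many directions
  \<open>(1, a)\<close>. In such a direction the degree of \<open>p\<close> along a line is its total degree, and a multiple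
  \<open>g * p\<close> has at least that degree on a line where \<open>g\<close> does not vanish identically.
\<close>

lemma total_degree_le_3:
  assumes I: "c1 < c2"
    and m: "\<And>a. c1 < a \<Longrightarrow> a < c2 \<Longrightarrow> \<exists>g. g \<noteq> 0 \<and> cubic_along a (g * p)"
    and ij: "i + j > 3"
  shows "coeff (coeff p i) j = 0"
proof (rule ccontr)
  assume nz: "coeff (coeff p i) j \<noteq> 0"
  define S where "S = {(i, j). coeff (coeff p i) j \<noteq> 0}"
  have "S \<subseteq> {..degree p} \<times> {..(\<Sum>i\<le>degree p. degree (coeff p i))}"
  proof clarify
    fix i j assume "(i, j) \<in> S"
    then have n: "coeff (coeff p i) j \<noteq> 0" by (simp add: S_def)
    then have i: "i \<le> degree p" by (metis coeff_0 le_degree)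
    have "j \<le> degree (coeff p i)" using n by (rule le_degree)
    also have "\<dots> \<le> (\<Sum>i\<le>degree p. degree (coeff p i))"
      by (rule member_le_sum) (use i in auto)
    finally show "i \<in> {..degree p} \<and> j \<in> {..(\<Sum>i\<le>degree p. degree (coeff p i))}" using i by simp
  qed
  then have fin: "finite S" by (rule finite_subset) auto
  define D where "D = Max ((\<lambda>(i, j). i + j) ` S)"
  have ijS: "(i, j) \<in> S" using nz by (simp add: S_def)
  have "D \<in> (\<lambda>(i, j). i + j) ` S" unfolding D_def by (rule Max_in) (use fin ijS in auto)
  then obtain i0 j0 where ij0: "(i0, j0) \<in> S" "D = i0 + j0" by auto
  have le: "i + j \<le> D" if "(i, j) \<in> S" for i j
    unfolding D_def by (rule Max_ge) (use fin that in \<open>auto intro: rev_image_eqI\<close>)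
  have van: "coeff (coeff p i) j = 0" if "i + j > D" for i j
    using le[of i j] that by (auto simp: S_def)
  have D3: "D > 3" using le[OF ijS] ij by simp
  define T where "T = (\<Sum>i\<le>D. monom (coeff (coeff p i) (D - i)) (D - i))"
  have Ta: "poly T a = coeff (restrict_to_line p x y a) D" for x y a
    using coeff_restrict_to_line_top[OF van, where x=x and y=y and a=a] by (simp add: T_def poly_sum poly_monom)
  have "coeff T j0 = coeff (coeff p i0) j0"
  proof -
    have "coeff T j0 = (\<Sum>i\<le>D. if i = i0 then coeff (coeff p i) j0 else 0)"
      unfolding T_def coeff_sum by (rule sum.cong) (use ij0 in auto)
    also have "\<dots> = coeff (coeff p i0) j0" using ij0 by simp
    finally show ?thesis .
  qed
  then have "T \<noteq> 0" using ij0 by (auto simp: S_def)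
  then have "finite {a. poly T a = 0}" by (rule poly_roots_finite)
  then have "\<not> {c1<..<c2} \<subseteq> {a. poly T a = 0}" using I finite_subset infinite_Ioo by blast
  then obtain a where "a \<in> {c1<..<c2}" "poly T a \<noteq> 0" by blast
  then have a: "c1 < a" "a < c2" "poly T a \<noteq> 0" by auto
  obtain g where g: "g \<noteq> 0" "cubic_along a (g * p)" using m[OF a(1,2)] by blast
  obtain x y where xy: "eval2 g x y \<noteq> 0" using eval2_zero_on_grid[of UNIV UNIV g] g(1) infinite_UNIV_char_0 by blast
  obtain q where q: "degree q \<le> 3" "\<And>\<tau>. eval2 (g * p) (x + \<tau>) (y + a * \<tau>) = poly q \<tau>"
    using g(2) unfolding cubic_along_def by blast
  have "poly (restrict_to_line g x y a * restrict_to_line p x y a) = poly q"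
    by (rule ext) (simp add: poly_restrict_to_line q(2)[symmetric])
  then have eq: "restrict_to_line g x y a * restrict_to_line p x y a = q" by (simp add: poly_eq_poly_eq_iff)
  have "poly (restrict_to_line g x y a) 0 \<noteq> 0" using xy by (simp add: poly_restrict_to_line)
  then have g0: "restrict_to_line g x y a \<noteq> 0" by auto
  have pD: "coeff (restrict_to_line p x y a) D \<noteq> 0" using Ta[of a x y] a(3) by simp
  then have "D \<le> degree (restrict_to_line p x y a)" "restrict_to_line p x y a \<noteq> 0" by (auto intro: le_degree)
  then have "D \<le> degree q" using g0 by (simp add: eq[symmetric] degree_mult_eq)
  then show False using q(1) D3 by simp
qed

lemma eval2_total_degree_3:
  assumes "\<And>i j. i + j > 3 \<Longrightarrow> coeff (coeff p i) j = 0"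
  shows "eval2 p x y = (\<Sum>i\<le>3. \<Sum>j\<le>3 - i. coeff (coeff p i) j * x ^ i * y ^ j)"
proof -
  have p0: "coeff p i = 0" if "i > 3" for i
    by (rule poly_eqI) (use assms[of i] that in auto)
  have "degree p \<le> 3" by (rule degree_le) (use p0 in auto)
  then have "poly p [:x:] = (\<Sum>i\<le>3. coeff p i * [:x:] ^ i)"
    unfolding poly_altdef by (intro sum.mono_neutral_left) (auto simp: coeff_eq_0)
  then have "eval2 p x y = (\<Sum>i\<le>3. poly (coeff p i) y * x ^ i)"
    by (simp add: eval2_def poly_sum)
  also have "\<dots> = (\<Sum>i\<le>3. \<Sum>j\<le>3 - i. coeff (coeff p i) j * x ^ i * y ^ j)"
  proof (rule sum.cong)
    fix i assume "i \<in> {..3::nat}"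
    have "degree (coeff p i) \<le> 3 - i" by (rule degree_le) (use assms[of i] in auto)
    then have "poly (coeff p i) y = (\<Sum>j\<le>3 - i. coeff (coeff p i) j * y ^ j)"
      unfolding poly_altdef by (intro sum.mono_neutral_left) (auto simp: coeff_eq_0)
    then show "poly (coeff p i) y * x ^ i = (\<Sum>j\<le>3 - i. coeff (coeff p i) j * x ^ i * y ^ j)"
      by (simp add: sum_distrib_left sum_distrib_right mult_ac)
  qed simp
  finally show ?thesis .
qed


definition eval2_vec :: "(4 \<Rightarrow> real poly poly) \<Rightarrow> real \<Rightarrow> real \<Rightarrow> real ^ 4" where
  "eval2_vec P x y = (\<chi> m. eval2 (P m) x y)"

lemma eval2_vec_nth [simp]: "eval2_vec P x y $ m = eval2 (P m) x y"
  by (simp add: eval2_vec_def)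

text \<open>
  In the coordinates \<open>(s, t)\<close> with axes of slopes \<open>a\<close> and \<open>a'\<close>, the map is a cubic curve \<open>C s\<close> in \<open>t\<close>
  for each fixed \<open>s\<close>. A polynomial vector \<open>Q\<close> that is cubic in \<open>s\<close>, with unknown coefficients in \<open>R[t]\<close>, is
  proportional to the map when its minors with all the curves \<open>C s\<close> vanish. This is a linear system for the
  coefficients over \<open>R[t]\<close>. For each single \<open>t\<close> it has a nonzero solution, namely the cubic curve \<open>G\<close> in
  \<open>s\<close>, so \<open>polynomial_kernel\<close> yields a polynomial one.
\<close>

lemma polynomial_lift_in_direction:
  fixes f :: "real \<Rightarrow> real \<Rightarrow> real ^ 4"
  assumes W: "open W" "(x0, y0) \<in> W" and nz: "\<And>x y. (x, y) \<in> W \<Longrightarrow> f x y \<noteq> 0"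
    and cubic_family: "cubic_lines W c1 c2 f"
    and a: "c1 < a" "a < c2" and a': "c1 < a'" "a' < c2" and ne: "a \<noteq> a'"
  shows "\<exists>Q V. open V \<and> (x0, y0) \<in> V \<and> V \<subseteq> W \<and> (\<exists>m. Q m \<noteq> 0) \<and> (\<forall>(x, y)\<in>V. parallel (eval2_vec Q x y) (f x y))
    \<and> (\<forall>m. cubic_along a (Q m))"
proof -
  define X where "X s t = x0 + s + t" for s t
  define Y where "Y s t = y0 + a * s + a' * t" for s t
  have "open ((\<lambda>(s, t). (X s t, Y s t)) -` W)"
    unfolding X_def Y_def case_prod_unfold
    by (rule open_vimage[OF W(1)]) (auto intro!: continuous_intros)
  moreover have "(0, 0) \<in> (\<lambda>(s, t). (X s t, Y s t)) -` W" using W by (simp add: X_def Y_def)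
  ultimately obtain \<eta> where \<eta>: "\<eta> > 0" "square 0 0 \<eta> \<subseteq> (\<lambda>(s, t). (X s t, Y s t)) -` W"
    using open_contains_square by blast
  have inW: "(X s t, Y s t) \<in> W" if "\<bar>s\<bar> < \<eta>" "\<bar>t\<bar> < \<eta>" for s t
    using subsetD[OF \<eta>(2), of "(s, t)"] that by simp
  have Gex: "\<exists>G :: 4 \<Rightarrow> real poly. \<forall>m. degree (G m) \<le> 3 \<and> (\<forall>s. \<bar>s\<bar> < \<eta> \<longrightarrow>
      (\<chi> m. poly (G m) s) \<noteq> 0 \<and> parallel (f (X s t) (Y s t)) (\<chi> m. poly (G m) s))" if t: "\<bar>t\<bar> < \<eta>" for t
  proof -
    let ?b = "y0 - a * x0 + (a' - a) * t"
    obtain g where g: "cubic_curve g" "\<And>x. (x, a * x + ?b) \<in> W \<Longrightarrow> g x \<noteq> 0 \<and> parallel (f x (a * x + ?b)) (g x)"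
      using cubic_family a unfolding cubic_lines_def by blast
    obtain G :: "4 \<Rightarrow> real poly" where G: "\<And>m. degree (G m) \<le> 3" "\<And>m s. g (x0 + t + 1 * s) $ m = poly (G m) s"
      using cubic_curve_shift[OF g(1), of "x0 + t" 1] unfolding cubic_curve_def by blast
    have "(\<chi> m. poly (G m) s) \<noteq> 0 \<and> parallel (f (X s t) (Y s t)) (\<chi> m. poly (G m) s)" if s: "\<bar>s\<bar> < \<eta>" for s
    proof -
      have 1: "a * X s t + ?b = Y s t" by (simp add: X_def Y_def algebra_simps)
      have "(\<chi> m. poly (G m) s) = g (X s t)" by (simp add: vec_eq_iff G(2)[symmetric] X_def algebra_simps)
      then show ?thesis using g(2)[of "X s t"] inW[OF s t] unfolding 1 by simp
    qed
    then show ?thesis using G(1) by blast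
  qed
  have Cex: "\<exists>C :: 4 \<Rightarrow> real poly. (\<forall>t. \<bar>t\<bar> < \<eta> \<longrightarrow>
      (\<chi> m. poly (C m) t) \<noteq> 0 \<and> parallel (f (X s t) (Y s t)) (\<chi> m. poly (C m) t))" if s: "\<bar>s\<bar> < \<eta>" for s
  proof -
    let ?b = "y0 - a' * x0 + (a - a') * s"
    obtain g where g: "cubic_curve g" "\<And>x. (x, a' * x + ?b) \<in> W \<Longrightarrow> g x \<noteq> 0 \<and> parallel (f x (a' * x + ?b)) (g x)"
      using cubic_family a' unfolding cubic_lines_def by blast
    obtain C :: "4 \<Rightarrow> real poly" where C: "\<And>m t. g (x0 + s + 1 * t) $ m = poly (C m) t"
      using cubic_curve_shift[OF g(1), of "x0 + s" 1] unfolding cubic_curve_def by blast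
    have "(\<chi> m. poly (C m) t) \<noteq> 0 \<and> parallel (f (X s t) (Y s t)) (\<chi> m. poly (C m) t)" if t: "\<bar>t\<bar> < \<eta>" for t
    proof -
      have 1: "a' * X s t + ?b = Y s t" by (simp add: X_def Y_def algebra_simps)
      have "(\<chi> m. poly (C m) t) = g (X s t)" by (simp add: vec_eq_iff C[symmetric] X_def)
      then show ?thesis using g(2)[of "X s t"] inW[OF s t] unfolding 1 by simp
    qed
    then show ?thesis by blast
  qed
  obtain C :: "real \<Rightarrow> 4 \<Rightarrow> real poly" where C: "\<And>s t. \<bar>s\<bar> < \<eta> \<Longrightarrow> \<bar>t\<bar> < \<eta> \<Longrightarrow>
      (\<chi> m. poly (C s m) t) \<noteq> 0 \<and> parallel (f (X s t) (Y s t)) (\<chi> m. poly (C s m) t)"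
    using Cex by metis
  define J where "J = {..3::nat} \<times> (UNIV :: 4 set)"
  define row :: "real \<Rightarrow> 4 \<Rightarrow> 4 \<Rightarrow> nat \<times> 4 \<Rightarrow> real poly" where
    "row s i j = (\<lambda>(k, m). [:s ^ k:] * ((if m = i then C s j else 0) - (if m = j then C s i else 0)))" for s i j
  define R where "R = {row s i j | s i j. \<bar>s\<bar> < \<eta>}"
  have row_poly: "(\<Sum>l\<in>J. row s i j l * u l) = (\<Sum>k\<le>3. [:s ^ k:] * u (k, i)) * C s j - (\<Sum>k\<le>3. [:s ^ k:] * u (k, j)) * C s i" for s i j u
  proof -
    have "(\<Sum>l\<in>J. row s i j l * u l) = (\<Sum>(k, m)\<in>{..3} \<times> UNIV. (if m = i then [:s ^ k:] * u (k, m) * C s j else 0) - (if m = j then [:s ^ k:] * u (k, m) * C s i else 0))"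
      unfolding J_def by (rule sum.cong[OF refl]) (auto simp: row_def algebra_simps)
    also have "\<dots> = (\<Sum>k\<le>3. \<Sum>m\<in>UNIV. (if m = i then [:s ^ k:] * u (k, m) * C s j else 0) - (if m = j then [:s ^ k:] * u (k, m) * C s i else 0))"
      by (rule sum.cartesian_product[symmetric])
    also have "\<dots> = (\<Sum>k\<le>3. [:s ^ k:] * u (k, i) * C s j - [:s ^ k:] * u (k, j) * C s i)"
      by (simp only: sum_subtractf sum.delta finite if_True UNIV_I)
    finally show ?thesis by (simp add: sum_subtractf sum_distrib_right)
  qed
  have "\<exists>u :: nat \<times> 4 \<Rightarrow> real poly. (\<exists>l\<in>J. u l \<noteq> 0) \<and> (\<forall>r\<in>R. (\<Sum>l\<in>J. r l * u l) = 0)"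
  proof (rule polynomial_kernel[where T="ball 0 \<eta>"])
    show "finite J" by (simp add: J_def)
    show "infinite (ball (0::real) \<eta>)" using \<eta>(1) by (rule infinite_real_ball)
    fix t assume "t \<in> ball (0::real) \<eta>"
    then have t: "\<bar>t\<bar> < \<eta>" by simp
    obtain G :: "4 \<Rightarrow> real poly" where G: "\<And>m. degree (G m) \<le> 3"
      "\<And>s. \<bar>s\<bar> < \<eta> \<Longrightarrow> (\<chi> m. poly (G m) s) \<noteq> 0" "\<And>s. \<bar>s\<bar> < \<eta> \<Longrightarrow> parallel (f (X s t) (Y s t)) (\<chi> m. poly (G m) s)"
      using Gex[OF t] by blast
    define u where "u = (\<lambda>(k, m). coeff (G m) k)"
    have Gs: "poly (G m) s = (\<Sum>k\<le>3. s ^ k * u (k, m))" for m s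
    proof -
      have "poly (G m) s = (\<Sum>k\<le>3. coeff (G m) k * s ^ k)"
        unfolding poly_altdef using G(1)[of m] by (intro sum.mono_neutral_left) (auto simp: coeff_eq_0)
      then show ?thesis by (simp add: u_def mult.commute)
    qed
    have "\<exists>l\<in>J. u l \<noteq> 0"
    proof (rule ccontr)
      assume "\<not> ?thesis"
      then have "poly (G m) 0 = 0" for m unfolding Gs by (intro sum.neutral) (auto simp: J_def)
      then show False using G(2)[of 0] \<eta>(1) by (simp add: vec_eq_iff)
    qed
    moreover have "(\<Sum>l\<in>J. poly (r l) t * u l) = 0" if r: "r \<in> R" for r
    proof -
      obtain s i j where s: "\<bar>s\<bar> < \<eta>" and rr: "r = row s i j" using r by (auto simp: R_def)
      have "(\<Sum>l\<in>J. poly (r l) t * u l) = poly (\<Sum>l\<in>J. row s i j l * [:u l:]) t"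
        by (simp add: rr poly_sum mult.commute)
      also have "\<dots> = poly (G i) s * poly (C s j) t - poly (G j) s * poly (C s i) t"
        unfolding row_poly Gs by (simp add: poly_sum mult.commute[of "u _"])
      also have "\<dots> = 0"
      proof -
        have "parallel (\<chi> m. poly (G m) s) (\<chi> m. poly (C s m) t)"
          by (rule parallel_trans[OF parallel_sym[OF G(3)[OF s]]]) (use C[OF s t] nz[OF inW[OF s t]] in auto)
        then show ?thesis by (simp add: parallel_def)
      qed
      finally show ?thesis .
    qed
    ultimately show "\<exists>u. (\<exists>j\<in>J. u j \<noteq> 0) \<and> (\<forall>r\<in>R. (\<Sum>j\<in>J. poly (r j) t * u j) = 0)" by blast
  qed
  then obtain u where u: "\<exists>l\<in>J. u l \<noteq> 0" "\<And>r. r \<in> R \<Longrightarrow> (\<Sum>l\<in>J. r l * u l) = 0" by blast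
  define q where "q m s t = (\<Sum>k\<le>3. s ^ k * poly (u (k, m)) t)" for m s t
  have qC: "q i s t * poly (C s j) t = q j s t * poly (C s i) t" if "\<bar>s\<bar> < \<eta>" for s t i j
  proof -
    have "row s i j \<in> R" using that by (auto simp: R_def)
    from arg_cong[OF u(2)[OF this, unfolded row_poly], of "\<lambda>p. poly p t"] show ?thesis
      by (simp add: poly_sum q_def)
  qed
  define e where "e = a' - a"
  have e: "e \<noteq> 0" using ne by (simp add: e_def)
  \<comment> \<open>The coordinates \<open>(s, t)\<close> as functions of \<open>(x, y)\<close>; moving along slope \<open>a\<close> changes only \<open>s\<close>.\<close>
  define S where "S x y = (a' * (x - x0) - (y - y0)) / e" for x y
  define T where "T x y = ((y - y0) - a * (x - x0)) / e" for x y
  have "S x y + T x y = e * (x - x0) / e" "a * S x y + a' * T x y = e * (y - y0) / e" for x y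
    unfolding S_def T_def e_def times_divide_eq_right add_divide_distrib[symmetric]
    by (simp_all add: algebra_simps)
  then have XS: "X (S x y) (T x y) = x" and YS: "Y (S x y) (T x y) = y" for x y
    using e by (simp_all add: X_def Y_def add.assoc)
  have SX: "S (X s t) (Y s t) = s" and TX: "T (X s t) (Y s t) = t" for s t
    using e unfolding X_def Y_def S_def T_def by (simp_all add: field_simps e_def)
  have Sl: "S (x + \<tau>) (y + a * \<tau>) = S x y + \<tau>" and Tl: "T (x + \<tau>) (y + a * \<tau>) = T x y" for x y \<tau>
    using e unfolding S_def T_def by (simp_all add: field_simps e_def)
  define LS where "LS = [:[:(y0 - a' * x0) / e, - 1 / e:], [:a' / e:]:]"
  define LT where "LT = [:[:(a * x0 - y0) / e, 1 / e:], [:- a / e:]:]"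
  have evL: "eval2 LS x y = S x y" "eval2 LT x y = T x y" for x y
    using e by (simp_all add: LS_def LT_def S_def T_def field_simps)
  define Q where "Q m = (\<Sum>k\<le>3. LS ^ k * substitute (u (k, m)) LT)" for m
  have evQ: "eval2 (Q m) x y = q m (S x y) (T x y)" for m x y
    by (simp add: Q_def eval2_sum eval2_substitute evL q_def)
  define V where "V = (\<lambda>(x, y). (S x y, T x y)) -` square 0 0 \<eta>"
  have "open V" unfolding V_def S_def T_def case_prod_unfold
    using e by (intro open_vimage) (auto intro!: open_Times continuous_intros)
  moreover have "(x0, y0) \<in> V" using \<eta>(1) by (simp add: V_def S_def T_def)
  moreover have "V \<subseteq> W"
  proof (rule subrelI)
    fix x y assume "(x, y) \<in> V"
    then have "\<bar>S x y\<bar> < \<eta>" "\<bar>T x y\<bar> < \<eta>" by (auto simp: V_def)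
    from inW[OF this] show "(x, y) \<in> W" by (simp add: XS YS)
  qed
  moreover have "\<exists>m. Q m \<noteq> 0"
  proof -
    obtain k m where km: "k \<le> 3" "u (k, m) \<noteq> 0" using u(1) by (auto simp: J_def)
    obtain t where t: "poly (u (k, m)) t \<noteq> 0" using km(2) poly_all_0_iff_0 by blast
    define h where "h = (\<Sum>k\<le>3. monom (poly (u (k, m)) t) k)"
    have "coeff h k = (\<Sum>k'\<le>3. if k' = k then poly (u (k', m)) t else 0)"
      unfolding h_def coeff_sum by (rule sum.cong) auto
    then have "coeff h k \<noteq> 0" using km t by simp
    then have "h \<noteq> 0" by auto
    then obtain s where s: "poly h s \<noteq> 0" using poly_all_0_iff_0[of h] by blast
    have "poly h s = q m s t" by (simp add: h_def q_def poly_sum poly_monom mult.commute)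
    then have "eval2 (Q m) (X s t) (Y s t) \<noteq> 0" using s by (simp add: evQ SX TX)
    then have "Q m \<noteq> 0" by auto
    then show ?thesis ..
  qed
  moreover have "\<forall>(x, y)\<in>V. parallel (eval2_vec Q x y) (f x y)"
  proof clarify
    fix x y assume "(x, y) \<in> V"
    then have st: "\<bar>S x y\<bar> < \<eta>" "\<bar>T x y\<bar> < \<eta>" by (auto simp: V_def)
    have "parallel (eval2_vec Q x y) (\<chi> m. poly (C (S x y) m) (T x y))"
      using qC[OF st(1)] by (simp add: parallel_def evQ)
    moreover have "parallel (f x y) (\<chi> m. poly (C (S x y) m) (T x y))" "(\<chi> m. poly (C (S x y) m) (T x y)) \<noteq> 0"
      using C[OF st] by (simp_all add: XS YS)
    ultimately show "parallel (eval2_vec Q x y) (f x y)" by (meson parallel_sym parallel_trans)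
  qed
  moreover have "cubic_along a (Q m)" for m
    unfolding cubic_along_def
  proof (intro allI)
    fix x y
    show "\<exists>p. degree p \<le> 3 \<and> (\<forall>\<tau>. eval2 (Q m) (x + \<tau>) (y + a * \<tau>) = poly p \<tau>)"
    proof (rule exI[of _ "\<Sum>k\<le>3. smult (poly (u (k, m)) (T x y)) ([:S x y, 1:] ^ k)"], intro conjI allI)
      show "degree (\<Sum>k\<le>3. smult (poly (u (k, m)) (T x y)) ([:S x y, 1:] ^ k)) \<le> 3"
        by (rule degree_sum_le) (auto intro!: le_trans[OF degree_smult_le] le_trans[OF degree_linear_power_le])
      show "eval2 (Q m) (x + \<tau>) (y + a * \<tau>) = poly (\<Sum>k\<le>3. smult (poly (u (k, m)) (T x y)) ([:S x y, 1:] ^ k)) \<tau>" for \<tau>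
        
          unfolding evQ Sl Tl q_def by (simp add: poly_sum mult.commute)
    qed
  qed
  ultimately show ?thesis by blast
qed

text \<open>
  The polynomial maps \<open>Q\<close> obtained from the various slopes \<open>a\<close> are all proportional to \<open>f\<close>, hence to
  each other, near the point \<open>(x0, y0)\<close> and therefore as polynomials. So each is a multiple of the
  primitive part \<open>P\<close> of one of them.
\<close>

theorem cubic_lines_imp_polynomial:
  fixes f :: "real \<Rightarrow> real \<Rightarrow> real ^ 4"
  assumes W: "open W" "W \<noteq> {}" and nonzero: "\<forall>(x, y)\<in>W. f x y \<noteq> 0"
    and c12: "c1 < c2" and cubic_family: "cubic_lines W c1 c2 f"
  shows "\<exists>V P. open V \<and> V \<noteq> {} \<and> V \<subseteq> W \<and> (\<forall>m i j. i + j > 3 \<longrightarrow> coeff (coeff (P m) i) j = 0) \<and>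
    (\<forall>(x, y)\<in>V. eval2_vec P x y \<noteq> 0 \<and> parallel (f x y) (eval2_vec P x y))"
proof -
  have nz: "f x y \<noteq> 0" if "(x, y) \<in> W" for x y using nonzero that by blast
  obtain x0 y0 where p: "(x0, y0) \<in> W" using W(2) by auto
  have lift: "\<exists>Q V. open V \<and> (x0, y0) \<in> V \<and> V \<subseteq> W \<and> (\<exists>m. Q m \<noteq> 0) \<and> (\<forall>(x, y)\<in>V. parallel (eval2_vec Q x y) (f x y))
    \<and> (\<forall>m. cubic_along a (Q m))" if a: "c1 < a" "a < c2" for a
  proof -
    obtain a' where "a < a'" "a' < c2" using dense[OF a(2)] by blast
    then show ?thesis using polynomial_lift_in_direction[OF W(1) p nz cubic_family a, of a'] a by auto
  qed
  obtain b where b: "c1 < b" "b < c2" using dense[OF c12] by blast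
  obtain Q V i0 where Q: "open V" "(x0, y0) \<in> V" "V \<subseteq> W" "Q i0 \<noteq> 0" "\<And>x y. (x, y) \<in> V \<Longrightarrow> parallel (eval2_vec Q x y) (f x y)"
    using lift[OF b] by blast
  obtain G P where G: "G \<noteq> 0" "\<And>i. Q i = G * P i" "\<And>d. (\<And>i. d dvd P i) \<Longrightarrow> is_unit d"
    using primitive_part_exists[of Q i0] Q(4) by blast
  have P0: "P i0 \<noteq> 0" using Q(4) G(2)[of i0] by auto
  have grid: "p = 0" if N: "open N" "(x0, y0) \<in> N" and z: "\<And>x y. (x, y) \<in> N \<Longrightarrow> eval2 p x y = 0" for p N
  proof -
    obtain d where "d > 0" "square x0 y0 d \<subseteq> N" using open_contains_square[OF N] by blast
    then show ?thesis by (intro eval2_zero_on_grid[of "ball x0 d" "ball y0 d"] infinite_real_ball z) auto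
  qed
  have deg: "coeff (coeff (P m) i) j = 0" if "i + j > 3" for m i j
  proof (rule total_degree_le_3[OF c12 _ that])
    fix a assume a: "c1 < a" "a < c2"
    obtain Q' V' i' where Q': "open V'" "(x0, y0) \<in> V'" "V' \<subseteq> W" "Q' i' \<noteq> 0"
      "\<And>x y. (x, y) \<in> V' \<Longrightarrow> parallel (eval2_vec Q' x y) (f x y)" "\<And>m. cubic_along a (Q' m)"
      using lift[OF a] by blast
    have "P i * Q' j = P j * Q' i" for i j
    proof -
      have "Q i * Q' j - Q j * Q' i = 0"
      proof (rule grid[of "V \<inter> V'"])
        fix x y assume xy: "(x, y) \<in> V \<inter> V'"
        then have "parallel (eval2_vec Q x y) (f x y)" "parallel (f x y) (eval2_vec Q' x y)" "f x y \<noteq> 0"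
          using Q(3,5) Q'(5) nz by (auto intro: parallel_sym)
        then have "parallel (eval2_vec Q x y) (eval2_vec Q' x y)" by (rule parallel_trans)
        then show "eval2 (Q i * Q' j - Q j * Q' i) x y = 0" by (simp add: parallel_def)
      qed (use Q(1,2) Q'(1,2) in auto)
      then have "G * (P i * Q' j) = G * (P j * Q' i)" by (simp add: G(2) mult.assoc)
      then show ?thesis using G(1) by simp
    qed
    from proportional_to_primitive[of P Q', OF this P0 G(3)] obtain g where g: "\<And>m. Q' m = g * P m" by blast
    have "g \<noteq> 0" using Q'(4) g[of i'] by auto
    then show "\<exists>g. g \<noteq> 0 \<and> cubic_along a (g * P m)" using Q'(6)[of m] g[of m] by auto
  qed
  have "\<exists>x y. (x, y) \<in> V \<and> eval2 (Q i0) x y \<noteq> 0" using grid[OF Q(1,2), of "Q i0"] Q(4) by blast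
  then obtain x1 y1 where xy1: "(x1, y1) \<in> V" "eval2 (Q i0) x1 y1 \<noteq> 0" by blast
  define N where "N = V \<inter> (\<lambda>(x, y). eval2 (Q i0) x y) -` (- {0})"
  have "open N" unfolding N_def
    by (rule continuous_open_preimage[OF continuous_on_eval2 Q(1)]) auto
  moreover have "(x1, y1) \<in> N" using xy1 by (simp add: N_def)
  moreover have "eval2_vec P x y \<noteq> 0 \<and> parallel (f x y) (eval2_vec P x y)" if "(x, y) \<in> N" for x y
  proof -
    have xy: "(x, y) \<in> V" and n: "eval2 G x y \<noteq> 0" "eval2 (P i0) x y \<noteq> 0" using that by (auto simp: N_def G(2))
    have "eval2_vec Q x y = eval2 G x y *\<^sub>R eval2_vec P x y" by (simp add: vec_eq_iff G(2))
    then have "parallel (eval2_vec P x y) (f x y)" using Q(5)[OF xy] n by (simp add: parallel_def)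
    moreover have "eval2_vec P x y \<noteq> 0"
    proof
      assume "eval2_vec P x y = 0"
      then have "eval2_vec P x y $ i0 = 0" by simp
      then show False using n(2) by simp
    qed
    ultimately show ?thesis by (simp add: parallel_sym)
  qed
  moreover have "N \<subseteq> W" using Q(3) by (auto simp: N_def)
  ultimately show ?thesis using deg
    by (intro exI[of _ N] exI[of _ P]) auto
qed

section \<open>Homogeneous polynomials and rational maps\<close>

definition monomial_value :: "('v::finite \<Rightarrow>\<^sub>0 nat) \<Rightarrow> real ^ 'v \<Rightarrow> real" where
  "monomial_value m x = (\<Prod>i\<in>UNIV. x $ i ^ Poly_Mapping.lookup m i)"

definition total_degree :: "('v::finite \<Rightarrow>\<^sub>0 nat) \<Rightarrow> nat" where
  "total_degree m = (\<Sum>i\<in>UNIV. Poly_Mapping.lookup m i)"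

lemma monomial_value_add: "monomial_value (m + n) x = monomial_value m x * monomial_value n x"
  by (simp add: monomial_value_def lookup_add power_add prod.distrib)

lemma total_degree_add: "total_degree (m + n) = total_degree m + total_degree n"
  by (simp add: total_degree_def lookup_add sum.distrib)

lemma total_degree_0_iff: "total_degree m = 0 \<longleftrightarrow> m = 0"
  by (auto simp: total_degree_def intro!: poly_mapping_eqI)

lemma homogeneous_iff: "homogeneous d P \<longleftrightarrow> (\<forall>m\<in>Poly_Mapping.keys P. total_degree m = d)"
  by (simp add: homogeneous_def total_degree_def)

lemma eval_poly_superset:
  assumes "finite S" "Poly_Mapping.keys P \<subseteq> S"
  shows "eval_poly P x = (\<Sum>m\<in>S. Poly_Mapping.lookup P m * monomial_value m x)"
  unfolding eval_poly_def monomial_value_def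
  by (rule sum.mono_neutral_left) (use assms in \<open>auto simp: in_keys_iff\<close>)

lemma eval_poly_add: "eval_poly (P + Q) x = eval_poly P x + eval_poly Q x"
proof -
  let ?S = "Poly_Mapping.keys P \<union> Poly_Mapping.keys Q"
  have "eval_poly (P + Q) x = (\<Sum>m\<in>?S. Poly_Mapping.lookup (P + Q) m * monomial_value m x)"
    by (rule eval_poly_superset) (use keys_add[of P Q] in auto)
  then show ?thesis
    by (simp add: eval_poly_superset[of ?S P] eval_poly_superset[of ?S Q] lookup_add algebra_simps sum.distrib)
qed

lemma eval_poly_zero [simp]: "eval_poly 0 x = 0"
  by (simp add: eval_poly_def)

lemma eval_poly_sum: "eval_poly (\<Sum>i\<in>I. P i) x = (\<Sum>i\<in>I. eval_poly (P i) x)"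
  by (induction I rule: infinite_finite_induct) (simp_all add: eval_poly_add)

lemma eval_poly_single: "eval_poly (Poly_Mapping.single m c) x = c * monomial_value m x"
  using eval_poly_superset[of "{m}" "Poly_Mapping.single m c" x] by (simp split: if_splits)

lemma sum_of_monomials:
  "(\<Sum>m\<in>Poly_Mapping.keys P. Poly_Mapping.single m (Poly_Mapping.lookup P m)) = P"
  by (rule poly_mapping_eqI) (simp add: lookup_sum lookup_single when_def in_keys_iff)

lemma eval_poly_mult: "eval_poly (P * Q) x = eval_poly P x * eval_poly Q x"
proof -
  have "P * Q = (\<Sum>m\<in>Poly_Mapping.keys P. \<Sum>n\<in>Poly_Mapping.keys Q.
      Poly_Mapping.single (m + n) (Poly_Mapping.lookup P m * Poly_Mapping.lookup Q n))"
    by (subst sum_of_monomials[of P, symmetric], subst sum_of_monomials[of Q, symmetric])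
      (simp add: sum_product mult_single)
  then have "eval_poly (P * Q) x = (\<Sum>m\<in>Poly_Mapping.keys P. \<Sum>n\<in>Poly_Mapping.keys Q.
      (Poly_Mapping.lookup P m * monomial_value m x) * (Poly_Mapping.lookup Q n * monomial_value n x))"
    by (simp add: eval_poly_sum eval_poly_single monomial_value_add mult_ac)
  also have "\<dots> = eval_poly P x * eval_poly Q x"
    by (simp only: eval_poly_superset[OF finite_keys order_refl, of P] eval_poly_superset[OF finite_keys order_refl, of Q]
        sum_product)
  finally show ?thesis .
qed

lemma eval_poly_power: "eval_poly (P ^ n) x = eval_poly P x ^ n"
proof (induction n)
  case 0
  then show ?case using eval_poly_single[of 0 1 x] by (simp add: monomial_value_def)
qed (simp add: eval_poly_mult)

lemma homogeneous_add: "homogeneous d P \<Longrightarrow> homogeneous d Q \<Longrightarrow> homogeneous d (P + Q)"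
  unfolding homogeneous_iff using keys_add[of P Q] by blast

lemma homogeneous_zero [simp]: "homogeneous d 0"
  by (simp add: homogeneous_iff)

lemma homogeneous_sum: "(\<And>i. i \<in> I \<Longrightarrow> homogeneous d (P i)) \<Longrightarrow> homogeneous d (\<Sum>i\<in>I. P i)"
  by (induction I rule: infinite_finite_induct) (auto intro: homogeneous_add)

lemma homogeneous_mult: "homogeneous d P \<Longrightarrow> homogeneous e Q \<Longrightarrow> homogeneous (d + e) (P * Q)"
  unfolding homogeneous_iff using keys_mult[of P Q] by (auto simp: total_degree_add dest!: subsetD)

lemma homogeneous_single: "total_degree m = d \<Longrightarrow> homogeneous d (Poly_Mapping.single m c)"
  by (simp add: homogeneous_iff)

lemma homogeneous_power: "homogeneous d P \<Longrightarrow> homogeneous (n * d) (P ^ n)"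
proof (induction n)
  case 0
  then show ?case using homogeneous_single[of 0 0 1] by (simp add: total_degree_0_iff)
qed (auto intro: homogeneous_mult)

definition linear_form :: "real ^ 'v \<Rightarrow> 'v::finite rpoly" where
  "linear_form w = (\<Sum>i\<in>UNIV. Poly_Mapping.single (Poly_Mapping.single i 1) (w $ i))"

lemma eval_linear_form: "eval_poly (linear_form w) x = w \<bullet> x"
proof -
  have "monomial_value (Poly_Mapping.single i 1) x = x $ i" for i
  proof -
    have "monomial_value (Poly_Mapping.single i 1) x = (\<Prod>j\<in>UNIV. if j = i then x $ j else 1)"
      unfolding monomial_value_def by (rule prod.cong) (auto simp: lookup_single when_def)
    then show ?thesis by simp
  qed
  then show ?thesis by (simp add: linear_form_def eval_poly_sum eval_poly_single inner_vec_def)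
qed

lemma homogeneous_linear_form: "homogeneous 1 (linear_form w)"
  unfolding linear_form_def
  by (intro homogeneous_sum homogeneous_single) (simp add: total_degree_def lookup_single when_def)

text \<open>
  The homogeneous component of degree \<open>d\<close>.
\<close>

definition component :: "nat \<Rightarrow> 'v::finite rpoly \<Rightarrow> 'v rpoly" where
  "component d P = (\<Sum>m\<in>{m\<in>Poly_Mapping.keys P. total_degree m = d}. Poly_Mapping.single m (Poly_Mapping.lookup P m))"

lemma lookup_component: "Poly_Mapping.lookup (component d P) m = (if total_degree m = d then Poly_Mapping.lookup P m else 0)"
  by (auto simp: component_def lookup_sum lookup_single when_def in_keys_iff)

lemma homogeneous_component: "homogeneous d (component d P)"
  unfolding component_def by (intro homogeneous_sum homogeneous_single) auto

lemma component_homogeneous: "homogeneous d P \<Longrightarrow> component e P = (if d = e then P else 0)"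
  by (rule poly_mapping_eqI) (auto simp: lookup_component homogeneous_iff in_keys_iff)

lemma component_add: "component d (P + Q) = component d P + component d Q"
  by (rule poly_mapping_eqI) (auto simp: lookup_component lookup_add)

lemma component_zero_of_degree_less:
  "(\<And>m. m \<in> Poly_Mapping.keys P \<Longrightarrow> total_degree m < d) \<Longrightarrow> component d P = 0"
  by (rule poly_mapping_eqI) (auto simp: lookup_component in_keys_iff)

lemma component_mult_top:
  fixes P Q :: "'v::finite rpoly"
  assumes P: "\<And>m. m \<in> Poly_Mapping.keys P \<Longrightarrow> total_degree m \<le> d"
    and Q: "\<And>m. m \<in> Poly_Mapping.keys Q \<Longrightarrow> total_degree m \<le> e"
  shows "component (d + e) (P * Q) = component d P * component e Q"
proof -
  define P' where "P' = P - component d P"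
  define Q' where "Q' = Q - component e Q"
  have kP: "total_degree m < d" if "m \<in> Poly_Mapping.keys P'" for m
    using that P[of m] by (auto simp: P'_def in_keys_iff lookup_minus lookup_component le_neq_implies_less split: if_splits)
  have kQ: "total_degree m < e" if "m \<in> Poly_Mapping.keys Q'" for m
    using that Q[of m] by (auto simp: Q'_def in_keys_iff lookup_minus lookup_component le_neq_implies_less split: if_splits)
  have PQ: "P * Q = component d P * component e Q + (component d P * Q' + P' * Q)"
    by (simp add: P'_def Q'_def algebra_simps)
  have 1: "component (d + e) (component d P * Q') = 0"
  proof (rule component_zero_of_degree_less)
    fix m assume "m \<in> Poly_Mapping.keys (component d P * Q')"
    then obtain a b where "m = a + b" "a \<in> Poly_Mapping.keys (component d P)" "b \<in> Poly_Mapping.keys Q'"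
      using keys_mult by blast
    then show "total_degree m < d + e"
      using homogeneous_component[of d P] kQ[of b] by (auto simp: homogeneous_iff total_degree_add)
  qed
  have 2: "component (d + e) (P' * Q) = 0"
  proof (rule component_zero_of_degree_less)
    fix m assume "m \<in> Poly_Mapping.keys (P' * Q)"
    then obtain a b where "m = a + b" "a \<in> Poly_Mapping.keys P'" "b \<in> Poly_Mapping.keys Q"
      using keys_mult by blast
    then show "total_degree m < d + e"
      using kP[of a] Q[of b] by (auto simp: total_degree_add)
  qed
  have "homogeneous (d + e) (component d P * component e Q)"
    by (intro homogeneous_mult homogeneous_component)
  then show ?thesis unfolding PQ
    by (simp add: component_add 1 2 component_homogeneous)
qed

text \<open>
  If \<open>Q\<close> has degree \<open>dQ\<close> and \<open>dR\<close> is the largest degree among the cofactors, the components of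
  degree \<open>dQ + dR\<close> of the products are the products of the top components. They do not all vanish, so
  \<open>dQ + dR = d\<close>, and the top components alone give a factorization into homogeneous polynomials.
\<close>

lemma homogeneous_common_factor:
  fixes P R :: "'n::finite \<Rightarrow> 'v::{finite,linorder} rpoly"
  assumes h: "\<And>j. homogeneous d (P j)" and nz: "P j0 \<noteq> 0"
    and PQ: "\<And>j. P j = Q * R j" and nc: "\<not> constant_poly Q"
  shows "\<exists>e Q' R'. e < d \<and> (\<forall>j. homogeneous e (R' j)) \<and> (\<forall>j. P j = Q' * R' j)"
proof -
  define dQ where "dQ = Max (total_degree ` Poly_Mapping.keys Q)"
  define K where "K = (\<Union>j. Poly_Mapping.keys (R j))"
  define dR where "dR = Max (total_degree ` K)"
  obtain m0 where m0: "m0 \<in> Poly_Mapping.keys Q" "m0 \<noteq> 0" using nc by (auto simp: constant_poly_def)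
  have Q: "total_degree m \<le> dQ" if "m \<in> Poly_Mapping.keys Q" for m
    unfolding dQ_def by (rule Max_ge) (use that in auto)
  have dQ: "dQ > 0" using Q[OF m0(1)] m0(2) total_degree_0_iff[of m0] by linarith
  have finK: "finite K" by (simp add: K_def)
  have "R j0 \<noteq> 0" using nz PQ[of j0] by auto
  then have "K \<noteq> {}" by (auto simp: K_def)
  have R: "total_degree m \<le> dR" if "m \<in> Poly_Mapping.keys (R j)" for m j
    unfolding dR_def by (rule Max_ge) (use that finK in \<open>auto simp: K_def\<close>)
  have "dQ \<in> total_degree ` Poly_Mapping.keys Q" unfolding dQ_def by (rule Max_in) (use m0 in auto)
  then obtain mQ where mQ: "mQ \<in> Poly_Mapping.keys Q" "total_degree mQ = dQ" by auto
  have "dR \<in> total_degree ` K" unfolding dR_def by (rule Max_in) (use finK \<open>K \<noteq> {}\<close> in auto)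
  then obtain mR j1 where mR: "mR \<in> Poly_Mapping.keys (R j1)" "total_degree mR = dR" by (auto simp: K_def)
  have "component dQ Q \<noteq> 0" using mQ lookup_component[of dQ Q mQ] by (auto simp: in_keys_iff)
  moreover have "component dR (R j1) \<noteq> 0" using mR lookup_component[of dR "R j1" mR] by (auto simp: in_keys_iff)
  ultimately have ne: "component dQ Q * component dR (R j1) \<noteq> 0" by simp
  have c: "component (dQ + dR) (P j) = component dQ Q * component dR (R j)" for j
    unfolding PQ by (rule component_mult_top[OF Q R])
  have d: "d = dQ + dR" using c[of j1] ne component_homogeneous[OF h[of j1], of "dQ + dR"] by (auto split: if_splits)
  have "P j = component dQ Q * component dR (R j)" for j
    using c[of j] component_homogeneous[OF h[of j], of "dQ + dR"] d by simp
  moreover have "dR < d" using d dQ by simp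
  ultimately show ?thesis
    by (intro exI[of _ dR] exI[of _ "component dQ Q"] exI[of _ "\<lambda>j. component dR (R j)"])
      (simp add: homogeneous_component)
qed

lemma proj_scale: "v \<noteq> 0 \<Longrightarrow> c \<noteq> 0 \<Longrightarrow> proj (c *\<^sub>R v) = proj v"
  by (metis proj_eq_iff scaleR_eq_0_iff)

text \<open>
  A common factor could be cancelled to give a homogeneous representation of smaller degree. The
  map is then still represented on all of \<open>U\<close>, because a factor of polynomials without common zero at a
  point does not vanish there.
\<close>

lemma rational_map_of_minimal_degree:
  fixes F :: "3 rproj \<Rightarrow> 'n::finite rproj"
  assumes U: "U \<noteq> {}" and h: "\<forall>j. homogeneous d (P $ j)" and r: "restriction_of_rational U F P"
  shows "\<exists>d' P'. d' \<le> d \<and> rational_map_of_degree d' P' \<and> restriction_of_rational U F P'"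
proof -
  define good where "good k \<longleftrightarrow> (\<exists>P. (\<forall>j. homogeneous k (P $ j)) \<and> restriction_of_rational U F P)" for k
  have gd: "good d" using h r by (auto simp: good_def)
  define k where "k = (LEAST k. good k)"
  have k: "good k" "k \<le> d" using gd unfolding k_def by (auto intro: LeastI Least_le)
  obtain P where P: "\<forall>j. homogeneous k (P $ j)" "restriction_of_rational U F P" using k(1) by (auto simp: good_def)
  obtain x0 where x0: "x0 \<noteq> 0" "proj x0 \<in> U" using U proj_surj by (metis ex_in_conv)
  have "(\<chi> j. eval_poly (P $ j) x0) \<noteq> 0" using P(2) x0 by (auto simp: restriction_of_rational_def)
  then obtain j0 where "eval_poly (P $ j0) x0 \<noteq> 0" by (auto simp: vec_eq_iff)
  then have j0: "P $ j0 \<noteq> 0" by auto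
  have "constant_poly Q" if Q: "\<forall>j. Q dvd P $ j" for Q
  proof (rule ccontr)
    assume nc: "\<not> constant_poly Q"
    have "\<forall>j. \<exists>R. P $ j = Q * R" using Q by (auto elim: dvdE)
    then obtain R where R: "\<And>j. P $ j = Q * R j" by metis
    obtain e Q' R' where e: "e < k" "\<And>j. homogeneous e (R' j)" "\<And>j. P $ j = Q' * R' j"
      using homogeneous_common_factor[of k "\<lambda>j. P $ j" j0 Q R] P(1) j0 R nc by blast
    have "restriction_of_rational U F (\<chi> j. R' j)"
      unfolding restriction_of_rational_def
    proof (intro allI impI)
      fix x assume x: "x \<noteq> 0 \<and> proj x \<in> U"
      have eval2: "(\<chi> j. eval_poly (P $ j) x) = eval_poly Q' x *\<^sub>R (\<chi> j. eval_poly (R' j) x)"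
        by (simp add: vec_eq_iff e(3) eval_poly_mult)
      have nz: "(\<chi> j. eval_poly (P $ j) x) \<noteq> 0" and F: "F (proj x) = proj (\<chi> j. eval_poly (P $ j) x)"
        using P(2) x by (auto simp: restriction_of_rational_def)
      have n: "eval_poly Q' x \<noteq> 0" "(\<chi> j. eval_poly (R' j) x) \<noteq> 0" using nz eval2 by auto
      then have "F (proj x) = proj (\<chi> j. eval_poly (R' j) x)" unfolding F eval2 by (intro proj_scale)
      then show "(\<chi> j. eval_poly ((\<chi> j. R' j) $ j) x) \<noteq> 0 \<and> F (proj x) = proj (\<chi> j. eval_poly ((\<chi> j. R' j) $ j) x)"
        using n(2) by simp
    qed
    then have "good e" unfolding good_def using e(2) by (intro exI[of _ "\<chi> j. R' j"]) simp
    then show False using e(1) not_less_Least unfolding k_def by blast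
  qed
  then have "rational_map_of_degree k P" using P(1) j0 by (auto simp: rational_map_of_degree_def)
  then show ?thesis using k(2) P(2) by blast
qed

text \<open>
  The polynomial with coefficients \<open>c\<close> in the affine coordinates \<open>w1 / w0\<close> and \<open>w2 / w0\<close>, cleared of
  denominators.
\<close>

definition homogenized_cubic :: "real ^ 3 \<Rightarrow> real ^ 3 \<Rightarrow> real ^ 3 \<Rightarrow> (nat \<Rightarrow> nat \<Rightarrow> real) \<Rightarrow> 3 rpoly" where
  "homogenized_cubic w0 w1 w2 c = (\<Sum>i\<le>3. \<Sum>j\<le>3 - i. Poly_Mapping.single 0 (c i j) *
     (linear_form w1 ^ i * (linear_form w2 ^ j * linear_form w0 ^ (3 - i - j))))"

lemma homogeneous_homogenized_cubic: "homogeneous 3 (homogenized_cubic w0 w1 w2 c)"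
  unfolding homogenized_cubic_def
proof (intro homogeneous_sum)
  fix i j assume ij: "i \<in> {..3::nat}" "j \<in> {..3 - i}"
  have "homogeneous (0 + (i * 1 + (j * 1 + (3 - i - j) * 1))) (Poly_Mapping.single 0 (c i j) *
     (linear_form w1 ^ i * (linear_form w2 ^ j * linear_form w0 ^ (3 - i - j))))"
    by (intro homogeneous_mult homogeneous_power homogeneous_linear_form homogeneous_single) (simp add: total_degree_0_iff)
  then show "homogeneous 3 (Poly_Mapping.single 0 (c i j) *
     (linear_form w1 ^ i * (linear_form w2 ^ j * linear_form w0 ^ (3 - i - j))))"
    using ij by simp
qed

lemma eval_homogenized_cubic:
  assumes "w0 \<bullet> x \<noteq> 0"
  shows "eval_poly (homogenized_cubic w0 w1 w2 c) x =
    (w0 \<bullet> x) ^ 3 * (\<Sum>i\<le>3. \<Sum>j\<le>3 - i. c i j * (w1 \<bullet> x / (w0 \<bullet> x)) ^ i * (w2 \<bullet> x / (w0 \<bullet> x)) ^ j)"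
proof -
  have *: "c i j * ((w1 \<bullet> x) ^ i * ((w2 \<bullet> x) ^ j * (w0 \<bullet> x) ^ (3 - i - j)))
    = (w0 \<bullet> x) ^ 3 * (c i j * (w1 \<bullet> x / (w0 \<bullet> x)) ^ i * (w2 \<bullet> x / (w0 \<bullet> x)) ^ j)"
    if "i \<le> 3" "j \<le> 3 - i" for i j
  proof -
    have "3 = i + (j + (3 - i - j))" using that by simp
    then have "(w0 \<bullet> x) ^ 3 = (w0 \<bullet> x) ^ i * ((w0 \<bullet> x) ^ j * (w0 \<bullet> x) ^ (3 - i - j))"
      by (metis power_add)
    then show ?thesis using assms by (simp add: power_divide)
  qed
  have m1: "monomial_value 0 x = 1" by (simp add: monomial_value_def)
  show ?thesis
    unfolding homogenized_cubic_def eval_poly_sum eval_poly_mult eval_poly_power eval_linear_form eval_poly_single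
      m1 mult_1_right sum_distrib_left
    by (intro sum.cong refl *) auto
qed

section \<open>Adapted coordinates on the projective plane\<close>

lemma proj_rel_refl: "x \<noteq> 0 \<Longrightarrow> proj_rel x x"
  by (auto simp: proj_rel_def intro: exI[of _ 1])

lemma incident_proj: "a \<noteq> 0 \<Longrightarrow> x \<noteq> 0 \<Longrightarrow> incident (proj a) (proj x) \<longleftrightarrow> a \<bullet> x = 0"
  unfolding proj_def by (rule incident.abs_eq) (simp_all add: proj_rel_refl)

lemma in_chart_proj: "x \<noteq> 0 \<Longrightarrow> in_chart j (proj x) \<longleftrightarrow> x $ j \<noteq> 0"
  unfolding proj_def by (rule in_chart.abs_eq) (simp add: proj_rel_refl)

lemma affine_coord_proj: "x \<noteq> 0 \<Longrightarrow> affine_coord j k (proj x) = x $ k / x $ j"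
  unfolding proj_def by (rule affine_coord.abs_eq) (simp add: proj_rel_refl)

lemma proj_in_hyperplane: "a \<noteq> 0 \<Longrightarrow> x \<noteq> 0 \<Longrightarrow> proj x \<in> hyperplane (proj a) \<longleftrightarrow> a \<bullet> x = 0"
  by (simp add: hyperplane_def incident_proj)

lemma open_proj_iff: "open A \<longleftrightarrow> open {x. x \<noteq> 0 \<and> proj x \<in> A}"
  by (rule open_rproj_def)

lemma open_in_chart: "open {q. in_chart j q}"
proof -
  have "{x. x \<noteq> 0 \<and> proj x \<in> {q. in_chart j q}} = {x. x $ j \<noteq> 0}"
    by (auto simp: in_chart_proj) (metis in_chart_proj zero_index)
  moreover have "open {x :: real ^ 'a. x $ j \<noteq> 0}"
    by (intro open_Collect_neq continuous_intros)
  ultimately show ?thesis by (simp add: open_proj_iff)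
qed

lemma proj_affine_coords:
  assumes "in_chart j q"
  shows "q = proj (\<chi> k. affine_coord j k q)" "(\<chi> k. affine_coord j k q) $ j = 1"
proof -
  obtain x where x: "x \<noteq> 0" "q = proj x" using proj_surj by blast
  have xj: "x $ j \<noteq> 0" using assms x by (simp add: in_chart_proj)
  have e: "(\<chi> k. affine_coord j k q) = (1 / x $ j) *\<^sub>R x"
    using x by (simp add: vec_eq_iff affine_coord_proj)
  have "proj x = proj ((1 / x $ j) *\<^sub>R x)"
    using proj_eq_iff[of x "(1 / x $ j) *\<^sub>R x"] x(1) xj by (auto intro!: exI[of _ "1 / x $ j"])
  then show "q = proj (\<chi> k. affine_coord j k q)" using e x(2) by simp
  show "(\<chi> k. affine_coord j k q) $ j = 1" unfolding e using xj by simp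
qed

lemma proj_eq_of_parallel: "parallel u v \<Longrightarrow> u \<noteq> 0 \<Longrightarrow> v \<noteq> 0 \<Longrightarrow> proj u = proj v"
  by (metis parallel_scale proj_eq_iff scaleR_eq_0_iff)

text \<open>
  A basis \<open>v0\<close>, \<open>v1\<close>, \<open>v2\<close> of \<open>real ^ 3\<close> and its dual basis. They define the affine chart in which
  \<open>v0\<close> is the origin and \<open>v1\<close>, \<open>v2\<close> span the coordinate directions.
\<close>

locale dual_bases =
  fixes v0 v1 v2 w0 w1 w2 :: "real ^ 3"
  assumes dual: "w0 \<bullet> v0 = 1" "w0 \<bullet> v1 = 0" "w0 \<bullet> v2 = 0"
      "w1 \<bullet> v0 = 0" "w1 \<bullet> v1 = 1" "w1 \<bullet> v2 = 0"
      "w2 \<bullet> v0 = 0" "w2 \<bullet> v1 = 0" "w2 \<bullet> v2 = 1"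
    and expansion: "\<And>X. X = (w0 \<bullet> X) *\<^sub>R v0 + (w1 \<bullet> X) *\<^sub>R v1 + (w2 \<bullet> X) *\<^sub>R v2"
begin

definition point :: "real \<Rightarrow> real \<Rightarrow> real ^ 3" where
  "point x y = v0 + x *\<^sub>R v1 + y *\<^sub>R v2"

definition chart_image :: "(real \<times> real) set \<Rightarrow> 3 rproj set" where
  "chart_image B = {proj (point x y) | x y. (x, y) \<in> B}"

text \<open>
  Homogeneous dual coordinates of the line \<open>y = a x + b\<close>.
\<close>

definition line :: "real \<Rightarrow> real \<Rightarrow> real ^ 3" where
  "line a b = w2 - a *\<^sub>R w1 - b *\<^sub>R w0"

lemma point_coords [simp]: "w0 \<bullet> point x y = 1" "w1 \<bullet> point x y = x" "w2 \<bullet> point x y = y"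
  by (simp_all add: point_def inner_add_right dual)

lemma point_nonzero [simp]: "point x y \<noteq> 0"
proof
  assume "point x y = 0"
  then have "w0 \<bullet> point x y = w0 \<bullet> 0" by (rule arg_cong)
  then show False by simp
qed

lemma line_point: "line a b \<bullet> point x y = y - a * x - b"
  by (simp add: line_def inner_diff_left)

lemma line_nonzero [simp]: "line a b \<noteq> 0"
proof
  assume "line a b = 0"
  then have "line a b \<bullet> v2 = 0" by simp
  then show False by (simp add: line_def inner_diff_left dual)
qed

lemma proj_point_of_coords:
  assumes "w0 \<bullet> X \<noteq> 0"
  shows "proj X = proj (point (w1 \<bullet> X / (w0 \<bullet> X)) (w2 \<bullet> X / (w0 \<bullet> X)))"
proof -
  have "X \<noteq> 0" using assms by auto
  have "(w0 \<bullet> X) *\<^sub>R point (w1 \<bullet> X / (w0 \<bullet> X)) (w2 \<bullet> X / (w0 \<bullet> X)) =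
      (w0 \<bullet> X) *\<^sub>R v0 + (w1 \<bullet> X) *\<^sub>R v1 + (w2 \<bullet> X) *\<^sub>R v2"
    using assms by (simp add: point_def scaleR_add_right)
  also have "\<dots> = X" by (rule expansion[symmetric])
  finally have "(w0 \<bullet> X) *\<^sub>R point (w1 \<bullet> X / (w0 \<bullet> X)) (w2 \<bullet> X / (w0 \<bullet> X)) = X" .
  then show ?thesis
    using assms \<open>X \<noteq> 0\<close> by (subst eq_commute, subst proj_eq_iff) (auto intro!: exI[of _ "w0 \<bullet> X"])
qed

lemma proj_in_chart_image:
  assumes "X \<noteq> 0"
  shows "proj X \<in> chart_image B \<longleftrightarrow> w0 \<bullet> X \<noteq> 0 \<and> (w1 \<bullet> X / (w0 \<bullet> X), w2 \<bullet> X / (w0 \<bullet> X)) \<in> B"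
proof
  assume "proj X \<in> chart_image B"
  then obtain x y where xy: "(x, y) \<in> B" "proj X = proj (point x y)" by (auto simp: chart_image_def)
  then obtain c where "c \<noteq> 0" "X = c *\<^sub>R point x y"
    using proj_eq_iff[of "point x y" X] assms by auto
  then show "w0 \<bullet> X \<noteq> 0 \<and> (w1 \<bullet> X / (w0 \<bullet> X), w2 \<bullet> X / (w0 \<bullet> X)) \<in> B" using xy(1) by simp
next
  assume *: "w0 \<bullet> X \<noteq> 0 \<and> (w1 \<bullet> X / (w0 \<bullet> X), w2 \<bullet> X / (w0 \<bullet> X)) \<in> B"
  then show "proj X \<in> chart_image B" using proj_point_of_coords[of X] by (auto simp: chart_image_def)
qed


lemma open_chart_image:
  assumes "open B" shows "open (chart_image B)"
proof -
  let ?g = "\<lambda>X. (w1 \<bullet> X / (w0 \<bullet> X), w2 \<bullet> X / (w0 \<bullet> X))"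
  have "open {X. w0 \<bullet> X \<noteq> 0}" by (intro open_Collect_neq continuous_intros)
  then have "open ({X. w0 \<bullet> X \<noteq> 0} \<inter> ?g -` B)"
    by (intro continuous_open_preimage continuous_intros assms) auto
  moreover have "{X. X \<noteq> 0 \<and> proj X \<in> chart_image B} = {X. w0 \<bullet> X \<noteq> 0} \<inter> ?g -` B"
  proof -
    have "X \<noteq> 0" if "w0 \<bullet> X \<noteq> 0" for X using that by auto
    then show ?thesis using proj_in_chart_image[of _ B] by blast
  qed
  ultimately show ?thesis by (simp add: open_proj_iff)
qed

lemma open_coords:
  assumes "open A" shows "open {(x, y). proj (point x y) \<in> A}"
proof -
  have "open ((\<lambda>(x, y). point x y) -` {X. X \<noteq> 0 \<and> proj X \<in> A})"
    unfolding point_def case_prod_unfold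
    by (rule open_vimage) (use assms in \<open>auto simp: open_proj_iff intro!: continuous_intros\<close>)
  moreover have "(\<lambda>(x, y). point x y) -` {X. X \<noteq> 0 \<and> proj X \<in> A} = {(x, y). proj (point x y) \<in> A}"
    by auto
  ultimately show ?thesis by simp
qed

text \<open>
  The coordinates \<open>(a, b)\<close> of lines are themselves an affine chart, of the dual plane: the one in
  which \<open>line\<close> takes the place of \<open>point\<close>. Statements about open sets of points thus carry over to lines.
\<close>

lemma dual_bases_of_lines: "dual_bases w2 (- w1) (- w0) v2 (- v1) (- v0)"
proof
  fix X :: "real ^ 3"
  have "X \<bullet> Y = ((v2 \<bullet> X) *\<^sub>R w2 + (- v1 \<bullet> X) *\<^sub>R (- w1) + (- v0 \<bullet> X) *\<^sub>R (- w0)) \<bullet> Y" for Y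
    by (subst expansion[of Y]) (simp add: inner_add_left inner_add_right inner_commute mult.commute)
  then show "X = (v2 \<bullet> X) *\<^sub>R w2 + (- v1 \<bullet> X) *\<^sub>R (- w1) + (- v0 \<bullet> X) *\<^sub>R (- w0)"
    using vector_eq_rdot by blast
qed (use dual in \<open>simp_all add: inner_commute\<close>)

lemma open_lines: assumes "open B" shows "open {proj (line a b) | a b. (a, b) \<in> B}"
proof -
  interpret L: dual_bases w2 "- w1" "- w0" v2 "- v1" "- v0" by (rule dual_bases_of_lines)
  have "L.point = line" by (intro ext) (simp add: L.point_def line_def)
  then show ?thesis using L.open_chart_image[OF assms] by (simp add: L.chart_image_def)
qed

lemma open_line_coords:
  assumes "open A" shows "open {(a, b). proj (line a b) \<in> A}"
proof -
  interpret L: dual_bases w2 "- w1" "- w0" v2 "- v1" "- v0" by (rule dual_bases_of_lines)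
  have "L.point = line" by (intro ext) (simp add: L.point_def line_def)
  then show ?thesis using L.open_coords[OF assms] by simp
qed

end

text \<open>
  Homogeneous coordinates with \<open>i\<close>-th coordinate \<open>c\<close>, the other two in the cyclic order of
  \<open>affine_point\<close>.
\<close>

definition chart_vector :: "3 \<Rightarrow> real \<Rightarrow> real ^ 2 \<Rightarrow> real ^ 3" where
  "chart_vector i c u = (\<chi> k. if k = i then c else if k = i + 1 then u $ 1 else u $ 2)"

lemma chart_vector_inner: "chart_vector i c u \<bullet> chart_vector i d v = c * d + u \<bullet> v"
  using exhaust_3[of i] by (auto simp: chart_vector_def inner_vec_def sum_3 sum_2)

lemma chart_vector_surj: "\<exists>u. X = chart_vector i (X $ i) u"
proof
  show "X = chart_vector i (X $ i) (vector [X $ (i + 1), X $ (i + 2)])"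
  proof -
    have 41: "(4::3) = 1" and 03: "(0::3) = 3" by simp_all
    have "X $ 4 = X $ 1" "X $ 0 = X $ 3" by (simp_all only: 41 03)
    then show ?thesis using exhaust_3[of i] by (auto simp: chart_vector_def vec_eq_iff forall_3)
  qed
qed

lemma chart_vector_add: "chart_vector i c u + chart_vector i d v = chart_vector i (c + d) (u + v)"
  by (simp add: chart_vector_def vec_eq_iff)

lemma chart_vector_scale: "k *\<^sub>R chart_vector i c u = chart_vector i (k * c) (k *\<^sub>R u)"
  by (simp add: chart_vector_def vec_eq_iff)

lemma affine_point_chart_vector: "affine_point i u = proj (chart_vector i 1 u)"
  by (simp add: affine_point_def chart_vector_def)

lemma chart_vector_nth [simp]: "chart_vector i c u $ i = c"
  by (simp add: chart_vector_def)

text \<open>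
  The point \<open>p\<close> becomes the origin and the line \<open>L\<close> the \<open>x\<close>-axis. The vector \<open>v0\<close> has \<open>i\<close>-th
  coordinate 1 and \<open>v1\<close>, \<open>v2\<close> have \<open>i\<close>-th coordinate 0, so these coordinates differ from the standard
  chart number \<open>i\<close> only by an affine map, under which differentiability is preserved. For \<open>v1\<close> and
  \<open>v2\<close> one can take a direction vector \<open>e\<close> and a normal vector \<open>n\<close> of \<open>L\<close> in that chart.
\<close>

lemma adapted_dual_bases:
  fixes L p :: "3 rproj"
  assumes "p \<in> hyperplane L"
  shows "\<exists>i u0 e n w0 w1 w2. dual_bases (chart_vector i 1 u0) (chart_vector i 0 e) (chart_vector i 0 n) w0 w1 w2 \<and>
    p = proj (chart_vector i 1 u0) \<and> L = proj w2"
proof -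
  obtain a where a: "a \<noteq> 0" "L = proj a" using proj_surj by blast
  obtain X where X: "X \<noteq> 0" "p = proj X" using proj_surj by blast
  have aX: "a \<bullet> X = 0" using assms a X by (simp add: proj_in_hyperplane)
  obtain i where i: "X $ i \<noteq> 0" using X(1) by (auto simp: vec_eq_iff)
  obtain u where u: "X = chart_vector i (X $ i) u" using chart_vector_surj by blast
  define u0 where "u0 = (1 / X $ i) *\<^sub>R u"
  have Xu: "X = (X $ i) *\<^sub>R chart_vector i 1 u0" using i by (subst u) (simp add: chart_vector_scale u0_def)
  have nz: "chart_vector i 1 u0 \<noteq> 0" by (metis chart_vector_nth zero_index zero_neq_one)
  have p: "p = proj (chart_vector i 1 u0)" unfolding X(2) using i nz proj_eq_iff[of "chart_vector i 1 u0" X] Xu X(1) by metis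
  obtain n where n: "a = chart_vector i (a $ i) n" using chart_vector_surj by blast
  have "a \<bullet> chart_vector i 1 u0 = 0" using aX Xu i by (metis inner_scaleR_right mult_eq_0_iff)
  then have ai: "a $ i = - (n \<bullet> u0)" using n by (metis add.commute chart_vector_inner eq_neg_iff_add_eq_0 mult.right_neutral)
  have "n \<noteq> 0"
  proof
    assume "n = 0"
    then have "a = chart_vector i 0 0" using n ai by simp
    moreover have "chart_vector i 0 0 = 0" by (simp add: chart_vector_def vec_eq_iff)
    ultimately show False using a(1) by simp
  qed
  define \<rho> where "\<rho> = n \<bullet> n"
  have \<rho>: "\<rho> \<noteq> 0" using \<open>n \<noteq> 0\<close> by (simp add: \<rho>_def)
  define e :: "real ^ 2" where "e = vector [- n $ 2, n $ 1]"
  have en: "e \<bullet> n = 0" "n \<bullet> e = 0" "e \<bullet> e = \<rho>" "n \<bullet> n = \<rho>"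
    by (simp_all add: e_def \<rho>_def inner_vec_def sum_2)
  define w1 where "w1 = chart_vector i (- (e \<bullet> u0) / \<rho>) ((1 / \<rho>) *\<^sub>R e)"
  define w2 where "w2 = chart_vector i (- (n \<bullet> u0) / \<rho>) ((1 / \<rho>) *\<^sub>R n)"
  have e2: "z = ((e \<bullet> z) / \<rho>) *\<^sub>R e + ((n \<bullet> z) / \<rho>) *\<^sub>R n" for z
  proof -
    have "\<rho> * z $ 1 = (e \<bullet> z) * e $ 1 + (n \<bullet> z) * n $ 1" "\<rho> * z $ 2 = (e \<bullet> z) * e $ 2 + (n \<bullet> z) * n $ 2"
      by (simp_all add: e_def \<rho>_def inner_vec_def sum_2 algebra_simps)
    then show ?thesis using \<rho> by (simp add: vec_eq_iff forall_2 field_simps)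
  qed
  have "dual_bases (chart_vector i 1 u0) (chart_vector i 0 e) (chart_vector i 0 n) (chart_vector i 1 0) w1 w2"
  proof
    fix Y :: "real ^ 3"
    obtain y where y: "Y = chart_vector i (Y $ i) y" using chart_vector_surj by blast
    define c where "c = Y $ i"
    have Y: "Y = chart_vector i c y" using y c_def by simp
    have "y = c *\<^sub>R u0 + (((e \<bullet> (y - c *\<^sub>R u0)) / \<rho>) *\<^sub>R e + ((n \<bullet> (y - c *\<^sub>R u0)) / \<rho>) *\<^sub>R n)"
      using e2[of "y - c *\<^sub>R u0"] by (simp add: algebra_simps)
    moreover have "chart_vector i 1 0 \<bullet> Y = c" by (simp add: Y chart_vector_inner)
    moreover have "w1 \<bullet> Y = (e \<bullet> (y - c *\<^sub>R u0)) / \<rho>"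
      by (simp add: Y w1_def chart_vector_inner inner_diff_right diff_divide_distrib)
    moreover have "w2 \<bullet> Y = (n \<bullet> (y - c *\<^sub>R u0)) / \<rho>"
      by (simp add: Y w2_def chart_vector_inner inner_diff_right diff_divide_distrib)
    ultimately show "Y = (chart_vector i 1 0 \<bullet> Y) *\<^sub>R chart_vector i 1 u0 + (w1 \<bullet> Y) *\<^sub>R chart_vector i 0 e + (w2 \<bullet> Y) *\<^sub>R chart_vector i 0 n"
      by (simp add: chart_vector_scale chart_vector_add Y add.assoc)
  qed (use \<rho> in \<open>simp_all add: w1_def w2_def chart_vector_inner en\<close>)
  moreover have "L = proj w2"
  proof -
    have w2a: "w2 = (1 / \<rho>) *\<^sub>R a" by (subst n) (simp add: w2_def ai chart_vector_scale)
    have "w2 \<noteq> 0" using w2a a(1) \<rho> by simp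
    then show ?thesis unfolding a(2) using a(1) w2a \<rho> by (subst proj_eq_iff) (auto intro!: exI[of _ "1 / \<rho>"])
  qed
  ultimately show ?thesis using p by blast
qed

section \<open>Differentiability in affine coordinates\<close>

lemma has_derivative_vec_lambda:
  fixes g :: "'n::finite \<Rightarrow> 'a::real_normed_vector \<Rightarrow> real"
  assumes "\<And>k. (g k has_derivative g' k) (at z)"
  shows "((\<lambda>z. \<chi> k. g k z) has_derivative (\<lambda>v. \<chi> k. g' k v)) (at z)"
  by (subst has_derivative_componentwise_within)
    (auto simp: Basis_vec_def inner_axis intro: assms)

text \<open>
  The derivative of \<open>g\<close> composed with an affine map has as partial derivatives the directional
  derivatives of \<open>g\<close> along \<open>e\<close> and \<open>n\<close>, which are again of the form considered.
\<close>

lemma C_on_imp_smooth2: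
  fixes g :: "real ^ 2 \<Rightarrow> real"
  assumes "C_on r S g"
  shows "smooth2 r {(x, y). u + x *\<^sub>R e + y *\<^sub>R n \<in> S} (\<lambda>x y. g (u + x *\<^sub>R e + y *\<^sub>R n))"
  using assms
proof (induction r arbitrary: g)
  case 0
  have "continuous_on S g" using 0 by simp
  then have "continuous_on {(x, y). u + x *\<^sub>R e + y *\<^sub>R n \<in> S} (\<lambda>z. g (u + fst z *\<^sub>R e + snd z *\<^sub>R n))"
    by (rule continuous_on_compose2) (auto intro!: continuous_intros)
  then show ?case by (simp add: case_prod_unfold)
next
  case (Suc r)
  let ?l = "\<lambda>z. u + fst z *\<^sub>R e + snd z *\<^sub>R n"
  have "total_derivative (\<lambda>x y. g (u + x *\<^sub>R e + y *\<^sub>R n))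
     (\<lambda>x y. frechet_derivative g (at (u + x *\<^sub>R e + y *\<^sub>R n)) e)
     (\<lambda>x y. frechet_derivative g (at (u + x *\<^sub>R e + y *\<^sub>R n)) n) {(x, y). u + x *\<^sub>R e + y *\<^sub>R n \<in> S}"
    unfolding total_derivative_def
  proof clarify
    fix x y assume "u + x *\<^sub>R e + y *\<^sub>R n \<in> S"
    then have d: "(g has_derivative frechet_derivative g (at (?l (x, y)))) (at (?l (x, y)))"
      using Suc.prems frechet_derivative_works by (simp, blast)
    have l: "(?l has_derivative (\<lambda>v. fst v *\<^sub>R e + snd v *\<^sub>R n)) (at (x, y))"
      by (auto intro!: derivative_eq_intros)
    interpret D: bounded_linear "frechet_derivative g (at (?l (x, y)))" using d by (rule has_derivative_bounded_linear)
    show "((\<lambda>z. g (u + fst z *\<^sub>R e + snd z *\<^sub>R n)) has_derivative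
      (\<lambda>v. fst v *\<^sub>R frechet_derivative g (at (u + x *\<^sub>R e + y *\<^sub>R n)) e +
           snd v *\<^sub>R frechet_derivative g (at (u + x *\<^sub>R e + y *\<^sub>R n)) n)) (at (x, y))"
      using has_derivative_compose[OF l d] unfolding D.add D.scaleR by simp
  qed
  moreover have "smooth2 r {(x, y). u + x *\<^sub>R e + y *\<^sub>R n \<in> S} (\<lambda>x y. frechet_derivative g (at (u + x *\<^sub>R e + y *\<^sub>R n)) v)" for v
    by (rule Suc.IH) (use Suc.prems in simp)
  ultimately show ?case by (intro smooth2.simps(2)[THEN iffD2] exI conjI)
qed

lemma smooth2_vec_lambda:
  fixes g :: "'n::finite \<Rightarrow> real \<Rightarrow> real \<Rightarrow> real"
  assumes "\<And>k. smooth2 r D (g k)"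
  shows "smooth2 r D (\<lambda>x y. \<chi> k. g k x y)"
  using assms
proof (induction r arbitrary: g)
  case 0
  then show ?case by (auto simp: case_prod_unfold intro!: continuous_on_vec_lambda)
next
  case (Suc r)
  have "\<exists>g1 g2. total_derivative (g k) g1 g2 D \<and> smooth2 r D g1 \<and> smooth2 r D g2" for k
    by (rule smooth2.simps(2)[THEN iffD1]) (rule Suc.prems)
  then obtain g1 g2 where g: "\<And>k. total_derivative (g k) (g1 k) (g2 k) D" "\<And>k. smooth2 r D (g1 k)" "\<And>k. smooth2 r D (g2 k)"
    by metis
  have "total_derivative (\<lambda>x y. \<chi> k. g k x y) (\<lambda>x y. \<chi> k. g1 k x y) (\<lambda>x y. \<chi> k. g2 k x y) D"
    unfolding total_derivative_def
  proof clarify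
    fix x y assume xy: "(x, y) \<in> D"
    have "((\<lambda>z. \<chi> k. g k (fst z) (snd z)) has_derivative (\<lambda>v. \<chi> k. fst v *\<^sub>R g1 k x y + snd v *\<^sub>R g2 k x y)) (at (x, y))"
      by (rule has_derivative_vec_lambda) (use g(1) xy in \<open>auto simp: total_derivative_def\<close>)
    moreover have "(\<lambda>v. \<chi> k. fst v *\<^sub>R g1 k x y + snd v *\<^sub>R g2 k x y) =
      (\<lambda>v. fst v *\<^sub>R (\<chi> k. g1 k x y) + snd v *\<^sub>R (\<chi> k. g2 k x y))"
      by (simp add: fun_eq_iff vec_eq_iff)
    ultimately show "((\<lambda>z. \<chi> k. g k (fst z) (snd z)) has_derivative
      (\<lambda>v. fst v *\<^sub>R (\<chi> k. g1 k x y) + snd v *\<^sub>R (\<chi> k. g2 k x y))) (at (x, y))" by simp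
  qed
  moreover have "smooth2 r D (\<lambda>x y. \<chi> k. g1 k x y)" "smooth2 r D (\<lambda>x y. \<chi> k. g2 k x y)"
    by (intro Suc.IH g)+
  ultimately show ?case by (intro smooth2.simps(2)[THEN iffD2] exI conjI)
qed

lemma smooth2_subset: "smooth2 r D g \<Longrightarrow> D' \<subseteq> D \<Longrightarrow> smooth2 r D' g"
proof (induction r arbitrary: g)
  case 0 then show ?case by (auto intro: continuous_on_subset)
next
  case (Suc r)
  obtain g1 g2 where g: "total_derivative g g1 g2 D" "smooth2 r D g1" "smooth2 r D g2"
    using smooth2.simps(2)[THEN iffD1, OF Suc.prems(1)] by (elim exE conjE)
  have "total_derivative g g1 g2 D'" using g(1) Suc.prems(2) by (auto simp: total_derivative_def)
  moreover have "smooth2 r D' g1" "smooth2 r D' g2" using Suc g by blast+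
  ultimately show ?case by (intro smooth2.simps(2)[THEN iffD2] exI conjI)
qed

section \<open>Planarizations of the projective plane\<close>

text \<open>
  A line of the given open set meets \<open>U\<close> in some point \<open>p\<close>. In coordinates adapted to this line and
  \<open>p\<close>, all lines of small slope and intercept belong to the open set as well. The lift \<open>f\<close> is normalized
  by having coordinate number \<open>j\<close> equal to 1, where \<open>j\<close> is the number of a chart containing \<open>F p\<close>.
\<close>

theorem planarization_local_form:
  fixes F :: "3 rproj \<Rightarrow> 4 rproj"
  assumes pl: "planarization U F" and C4: "C_map_on 4 U F"
  shows "\<exists>v0 v1 v2 w0 w1 w2 d f. dual_bases v0 v1 v2 w0 w1 w2 \<and> 0 < d \<and> d \<le> (1::real) \<and>
    smooth2 4 (square 0 0 (2 * d)) f \<and>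
    (\<forall>x y. (x, y) \<in> square 0 0 (2 * d) \<longrightarrow> f x y \<noteq> 0 \<and> proj (dual_bases.point v0 v1 v2 x y) \<in> U \<and>
       F (proj (dual_bases.point v0 v1 v2 x y)) = proj (f x y)) \<and>
    (\<forall>a b. \<bar>a\<bar> < d \<longrightarrow> \<bar>b\<bar> < d \<longrightarrow> (\<exists>\<xi>. \<xi> \<noteq> 0 \<and> (\<forall>x. \<bar>x\<bar> < d \<longrightarrow> \<xi> \<bullet> f x (a * x + b) = 0)))"
proof -
  obtain \<L> where U: "open U" and L: "open \<L>" "\<L> \<noteq> {}"
    "\<And>l. l \<in> \<L> \<Longrightarrow> U \<inter> hyperplane l \<noteq> {} \<and> (\<exists>h. F ` (U \<inter> hyperplane l) \<subseteq> hyperplane h)"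
    using pl unfolding planarization_def by blast
  obtain L0 where L0: "L0 \<in> \<L>" using L(2) by blast
  obtain p where p: "p \<in> U" "p \<in> hyperplane L0" using L(3)[OF L0] by blast
  obtain i u0 e n w0 w1 w2 where db: "dual_bases (chart_vector i 1 u0) (chart_vector i 0 e) (chart_vector i 0 n) w0 w1 w2"
    and p0: "p = proj (chart_vector i 1 u0)" and L0w: "L0 = proj w2"
    using adapted_dual_bases[OF p(2)] by blast
  interpret dual_bases "chart_vector i 1 u0" "chart_vector i 0 e" "chart_vector i 0 n" w0 w1 w2 by (rule db)
  have point: "proj (point x y) = affine_point i (u0 + x *\<^sub>R e + y *\<^sub>R n)" for x y
    by (simp add: point_def affine_point_chart_vector chart_vector_scale chart_vector_add)
  have pt00: "proj (point 0 0) = p" by (simp add: point_def p0)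
  have line00: "proj (line 0 0) = L0" by (simp add: line_def L0w)
  obtain j where j: "in_chart j (F p)"
  proof -
    obtain v where v: "v \<noteq> 0" "F p = proj v" using proj_surj by blast
    then obtain j where "v $ j \<noteq> 0" by (auto simp: vec_eq_iff)
    then show ?thesis using that v by (simp add: in_chart_proj)
  qed
  have cF: "continuous_on U F" using C4 by (simp add: C_map_on_def)
  define U1 where "U1 = F -` {q. in_chart j q} \<inter> U"
  have U1: "open U1" unfolding U1_def
    using cF continuous_on_open_vimage[OF U] open_in_chart by blast
  have "(0, 0) \<in> {(x, y). proj (point x y) \<in> U1}" using p(1) j by (simp add: U1_def pt00)
  then obtain d1 where d1: "d1 > 0" "square 0 0 d1 \<subseteq> {(x, y). proj (point x y) \<in> U1}"
    using open_contains_square[OF open_coords[OF U1]] by blast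
  have "(0, 0) \<in> {(a, b). proj (line a b) \<in> \<L>}" using L0 by (simp add: line00)
  then obtain d2 where d2: "d2 > 0" "square 0 0 d2 \<subseteq> {(a, b). proj (line a b) \<in> \<L>}"
    using open_contains_square[OF open_line_coords[OF L(1)]] by blast
  define d where "d = min 1 (min (d1 / 2) d2)"
  have d: "0 < d" "d \<le> 1" "2 * d \<le> d1" "d \<le> d2" using d1 d2 by (auto simp: d_def)
  define f :: "real \<Rightarrow> real \<Rightarrow> real ^ 4" where "f x y = (\<chi> k. affine_coord j k (F (affine_point i (u0 + x *\<^sub>R e + y *\<^sub>R n))))" for x y
  have inU1: "proj (point x y) \<in> U1" if "(x, y) \<in> square 0 0 (2 * d)" for x y
  proof -
    have "(x, y) \<in> square 0 0 d1" using that d(3) by auto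
    from subsetD[OF d1(2) this] show ?thesis by simp
  qed
  have f: "f x y \<noteq> 0 \<and> proj (point x y) \<in> U \<and> F (proj (point x y)) = proj (f x y)" if "(x, y) \<in> square 0 0 (2 * d)" for x y
  proof -
    have U: "proj (point x y) \<in> U" and c: "in_chart j (F (proj (point x y)))" using inU1[OF that] by (auto simp: U1_def)
    have fe: "f x y = (\<chi> k. affine_coord j k (F (proj (point x y))))" by (simp add: f_def point)
    have "f x y $ j = 1" unfolding fe by (rule proj_affine_coords(2)[OF c])
    then have "f x y \<noteq> 0" by (metis zero_index zero_neq_one)
    then show ?thesis using U proj_affine_coords(1)[OF c] fe by simp
  qed
  have sm: "smooth2 4 (square 0 0 (2 * d)) f"
  proof -
    let ?S = "{u. affine_point i u \<in> U \<and> in_chart j (F (affine_point i u))}"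
    have "smooth2 4 (square 0 0 (2 * d)) (\<lambda>x y. affine_coord j k (F (affine_point i (u0 + x *\<^sub>R e + y *\<^sub>R n))))" for k
    proof (rule smooth2_subset)
      have "C_on 4 ?S (\<lambda>u. affine_coord j k (F (affine_point i u)))" using C4 unfolding C_map_on_def by blast
      then show "smooth2 4 {(x, y). u0 + x *\<^sub>R e + y *\<^sub>R n \<in> ?S} (\<lambda>x y. affine_coord j k (F (affine_point i (u0 + x *\<^sub>R e + y *\<^sub>R n))))"
        by (rule C_on_imp_smooth2)
      show "square 0 0 (2 * d) \<subseteq> {(x, y). u0 + x *\<^sub>R e + y *\<^sub>R n \<in> ?S}"
      proof (rule subrelI)
        fix x y assume "(x, y) \<in> square 0 0 (2 * d)"
        then have "proj (point x y) \<in> U1" by (rule inU1)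
        then show "(x, y) \<in> {(x, y). u0 + x *\<^sub>R e + y *\<^sub>R n \<in> ?S}" by (simp add: U1_def point)
      qed
    qed
    then show ?thesis unfolding f_def[abs_def] by (rule smooth2_vec_lambda)
  qed
  have lines: "\<exists>\<xi>. \<xi> \<noteq> 0 \<and> (\<forall>x. \<bar>x\<bar> < d \<longrightarrow> \<xi> \<bullet> f x (a * x + b) = 0)" if ab: "\<bar>a\<bar> < d" "\<bar>b\<bar> < d" for a b
  proof -
    have "(a, b) \<in> square 0 0 d2" using ab d(4) by simp
    from subsetD[OF d2(2) this] have "proj (line a b) \<in> \<L>" by simp
    from L(3)[OF this] obtain h where h: "F ` (U \<inter> hyperplane (proj (line a b))) \<subseteq> hyperplane h" by blast
    obtain \<xi> where \<xi>: "\<xi> \<noteq> 0" "h = proj \<xi>" using proj_surj by blast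
    have "\<xi> \<bullet> f x (a * x + b) = 0" if x: "\<bar>x\<bar> < d" for x
    proof -
      have "\<bar>a\<bar> * \<bar>x\<bar> \<le> 1 * \<bar>x\<bar>" using ab d by (intro mult_right_mono) auto
      then have "\<bar>a * x\<bar> < d" using x by (simp add: abs_mult)
      then have "\<bar>a * x + b\<bar> < 2 * d" using ab by linarith
      then have xy: "(x, a * x + b) \<in> square 0 0 (2 * d)" using x
        unfolding mem_Times_iff mem_ball dist_real_def fst_conv snd_conv by linarith
      note fx = f[OF xy]
      have "proj (point x (a * x + b)) \<in> hyperplane (proj (line a b))"
        by (simp add: proj_in_hyperplane line_point)
      then have "F (proj (point x (a * x + b))) \<in> hyperplane h" using h fx by blast
      then show ?thesis using fx \<xi> by (simp add: proj_in_hyperplane)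
    qed
    then show ?thesis using \<xi>(1) by blast
  qed
  show ?thesis
    by (rule exI, rule exI, rule exI, rule exI, rule exI, rule exI, rule exI[of _ d], rule exI[of _ f])
      (use db d f sm lines in blast)
qed

text \<open>
  The neighbourhood is the image in the projective plane of the planar region provided by
  \<open>local_trichotomy\<close> or \<open>cubic_lines_imp_polynomial\<close>. In the co-trivial case the common point of the
  planes is \<open>\<omega>\<close>, and in the rational case homogenizing the cubic representation gives degree 3 before
  common factors are cancelled.
\<close>

theorem theorem1p1:
  shows "\<exists>r::nat. \<forall>(U :: 3 rproj set) (F :: 3 rproj \<Rightarrow> 4 rproj).
    open U \<and> U \<noteq> {} \<and> planarization U F \<and> C_map_on r U F \<longrightarrow>
    (\<exists>U'. open U' \<and> U' \<noteq> {} \<and> U' \<subseteq> U \<and>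
      (trivial_planarization U' F \<or>
       cotrivial_planarization U' F \<or>
       (\<exists>d P. d \<le> 3 \<and> rational_map_of_degree d P \<and> restriction_of_rational U' F P)))"
proof (rule exI[of _ 4], intro allI impI)
  fix U :: "3 rproj set" and F :: "3 rproj \<Rightarrow> 4 rproj"
  assume "open U \<and> U \<noteq> {} \<and> planarization U F \<and> C_map_on 4 U F"
  then have pl: "planarization U F" and C4: "C_map_on 4 U F" by auto
  obtain v0 v1 v2 w0 w1 w2 and d :: real and f where db: "dual_bases v0 v1 v2 w0 w1 w2" and d: "0 < d" "d \<le> 1"
    and sm: "smooth2 4 (square 0 0 (2 * d)) f"
    and f: "\<forall>x y. (x, y) \<in> square 0 0 (2 * d) \<longrightarrow> f x y \<noteq> 0 \<and> proj (dual_bases.point v0 v1 v2 x y) \<in> U \<and>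
       F (proj (dual_bases.point v0 v1 v2 x y)) = proj (f x y)"
    and lines: "\<forall>a b. \<bar>a\<bar> < d \<longrightarrow> \<bar>b\<bar> < d \<longrightarrow> (\<exists>\<xi>. \<xi> \<noteq> 0 \<and> (\<forall>x. \<bar>x\<bar> < d \<longrightarrow> \<xi> \<bullet> f x (a * x + b) = 0))"
    using planarization_local_form[OF pl C4] by (elim exE conjE)
  interpret dual_bases v0 v1 v2 w0 w1 w2 by (rule db)
  have sqd: "square 0 0 d \<subseteq> square 0 0 (2 * d)" using d by auto
  have nz: "f x y \<noteq> 0" and inU: "proj (point x y) \<in> U" and Ff: "F (proj (point x y)) = proj (f x y)"
    if "(x, y) \<in> square 0 0 d" for x y
    using f subsetD[OF sqd that] by blast+
  have sub: "chart_image B \<subseteq> U" if "B \<subseteq> square 0 0 d" for B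
    using that inU by (auto simp: chart_image_def subset_iff)
  have ne: "chart_image B \<noteq> {}" if "B \<noteq> {}" for B
    using that by (auto simp: chart_image_def)
  have nonzero: "\<forall>x y. (x, y) \<in> square 0 0 (2 * d) \<longrightarrow> f x y \<noteq> 0" using f by blast
  from local_trichotomy[OF d sm nonzero lines] show "\<exists>U'. open U' \<and> U' \<noteq> {} \<and> U' \<subseteq> U \<and>
      (trivial_planarization U' F \<or> cotrivial_planarization U' F \<or>
       (\<exists>d P. d \<le> 3 \<and> rational_map_of_degree d P \<and> restriction_of_rational U' F P))"
  proof (elim disjE exE conjE)
    fix x0 y0 e \<xi>
    assume e: "e > 0" "square x0 y0 e \<subseteq> square 0 0 d" and \<xi>: "\<xi> \<noteq> 0" "\<forall>(x, y)\<in>square x0 y0 e. \<xi> \<bullet> f x y = 0"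
    let ?U' = "chart_image (square x0 y0 e)"
    have op: "open ?U'" by (intro open_chart_image open_Times) auto
    have "F q \<in> hyperplane (proj \<xi>)" if q: "q \<in> ?U'" for q
    proof -
      obtain x y where xy: "(x, y) \<in> square x0 y0 e" "q = proj (point x y)" using q by (auto simp: chart_image_def)
      have "(x, y) \<in> square 0 0 d" using e(2) xy(1) by (rule subsetD)
      then show ?thesis using \<xi> xy nz Ff by (auto simp: proj_in_hyperplane)
    qed
    then have "trivial_planarization ?U' F" using op unfolding trivial_planarization_def by blast
    then show ?thesis using op sub[OF e(2)] ne[of "square x0 y0 e"] e(1) by (intro exI[of _ ?U']) auto
  next
    fix M \<omega>
    assume M: "open M" "M \<noteq> {}" "M \<subseteq> square 0 0 d" and \<omega>: "\<omega> \<noteq> 0"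
      and h: "\<forall>(a, b)\<in>M. \<exists>\<xi>. \<xi> \<noteq> 0 \<and> \<xi> \<bullet> \<omega> = 0 \<and> (\<forall>x. \<bar>x\<bar> < d \<longrightarrow> \<xi> \<bullet> f x (a * x + b) = 0)"
    let ?U' = "chart_image (square 0 0 d)"
    let ?L = "{proj (line a b) | a b. (a, b) \<in> M}"
    have op: "open ?U'" by (intro open_chart_image open_Times) auto
    have opL: "open ?L" using M(1) by (rule open_lines)
    have neL: "?L \<noteq> {}" using M(2) by auto
    have *: "?U' \<inter> hyperplane l \<noteq> {} \<and> (\<exists>h. proj \<omega> \<in> hyperplane h \<and> F ` (?U' \<inter> hyperplane l) \<subseteq> hyperplane h)" if l: "l \<in> ?L" for l
    proof -
      obtain a b where ab: "(a, b) \<in> M" "l = proj (line a b)" using l by blast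
      obtain \<xi> where \<xi>: "\<xi> \<noteq> 0" "\<xi> \<bullet> \<omega> = 0" "\<And>x. \<bar>x\<bar> < d \<Longrightarrow> \<xi> \<bullet> f x (a * x + b) = 0"
        using h ab(1) by blast
      have "(a, b) \<in> square 0 0 d" using M(3) ab(1) by (rule subsetD)
      then have "(0, b) \<in> square 0 0 d" using d by simp
      then have "proj (point 0 b) \<in> ?U'" unfolding chart_image_def by blast
      moreover have "proj (point 0 b) \<in> hyperplane l" using ab(2) by (simp add: proj_in_hyperplane line_point)
      moreover have "F q \<in> hyperplane (proj \<xi>)" if q: "q \<in> ?U' \<inter> hyperplane l" for q
      proof -
        obtain x y where xy: "(x, y) \<in> square 0 0 d" "q = proj (point x y)" using q by (auto simp: chart_image_def)
        have "y = a * x + b" using q xy(2) ab(2) by (simp add: proj_in_hyperplane line_point)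
        then have "\<xi> \<bullet> f x y = 0" using \<xi>(3)[of x] xy(1) by simp
        then show ?thesis using \<xi>(1) nz[OF xy(1)] Ff[OF xy(1)] xy(2) by (simp add: proj_in_hyperplane)
      qed
      moreover have "proj \<omega> \<in> hyperplane (proj \<xi>)" using \<xi> \<omega> by (simp add: proj_in_hyperplane)
      ultimately show ?thesis by blast
    qed
    have "cotrivial_planarization ?U' F"
      unfolding cotrivial_planarization_def planarization_def
    proof (intro conjI)
      show "\<exists>\<L>. open \<L> \<and> \<L> \<noteq> {} \<and> (\<forall>l\<in>\<L>. ?U' \<inter> hyperplane l \<noteq> {} \<and> (\<exists>h. F ` (?U' \<inter> hyperplane l) \<subseteq> hyperplane h))"
        by (rule exI[of _ ?L]) (use opL neL * in blast)
      show "\<exists>o'. \<exists>\<L>. open \<L> \<and> \<L> \<noteq> {} \<and> (\<forall>l\<in>\<L>. ?U' \<inter> hyperplane l \<noteq> {} \<and> (\<exists>h. o' \<in> hyperplane h \<and> F ` (?U' \<inter> hyperplane l) \<subseteq> hyperplane h))"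
        by (rule exI[of _ "proj \<omega>"], rule exI[of _ ?L]) (use opL neL * in blast)
    qed (rule op)
    then show ?thesis using op sub[OF order_refl] ne[of "square 0 0 d"] d(1) by (intro exI[of _ ?U']) auto
  next
    fix W c1 c2
    assume W: "open W" "W \<noteq> {}" "W \<subseteq> square 0 0 d" and c: "c1 < c2" "cubic_lines W c1 c2 f"
    have Wnz: "\<forall>(x, y)\<in>W. f x y \<noteq> 0" using nz W(3) by blast
    from cubic_lines_imp_polynomial[OF W(1,2) Wnz c] obtain V P where V: "open V" "V \<noteq> {}" "V \<subseteq> W"
      and P': "\<forall>m i j. i + j > 3 \<longrightarrow> coeff (coeff (P m) i) j = 0"
      and fP: "\<forall>(x, y)\<in>V. eval2_vec P x y \<noteq> 0 \<and> parallel (f x y) (eval2_vec P x y)"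
      by (elim exE conjE)
    have P: "\<And>m i j. i + j > 3 \<Longrightarrow> coeff (coeff (P m) i) j = 0" using P' by blast
    have Vd: "V \<subseteq> square 0 0 d" using V(3) W(3) by (rule order_trans)
    let ?U' = "chart_image V"
    have op: "open ?U'" by (rule open_chart_image[OF V(1)])
    define R :: "(3 rpoly) ^ 4" where "R = (\<chi> m. homogenized_cubic w0 w1 w2 (\<lambda>i j. coeff (coeff (P m) i) j))"
    have hom: "\<forall>m. homogeneous 3 (R $ m)" by (simp add: R_def homogeneous_homogenized_cubic)
    have "restriction_of_rational ?U' F R"
      unfolding restriction_of_rational_def
    proof (intro allI impI)
      fix X assume X: "X \<noteq> 0 \<and> proj X \<in> ?U'"
      define x where "x = w1 \<bullet> X / (w0 \<bullet> X)"
      define y where "y = w2 \<bullet> X / (w0 \<bullet> X)"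
      have w0: "w0 \<bullet> X \<noteq> 0" and xy: "(x, y) \<in> V" using X proj_in_chart_image[of X V] unfolding x_def y_def by blast+
      have evP: "eval2 (P m) x y = (\<Sum>i\<le>3. \<Sum>j\<le>3 - i. coeff (coeff (P m) i) j * x ^ i * y ^ j)" for m
        by (rule eval2_total_degree_3) (rule P)
      have "eval_poly (R $ m) X = (w0 \<bullet> X) ^ 3 * eval2 (P m) x y" for m
        unfolding evP by (simp add: R_def eval_homogenized_cubic[OF w0] x_def y_def)
      then have evR: "(\<chi> m. eval_poly (R $ m) X) = (w0 \<bullet> X) ^ 3 *\<^sub>R eval2_vec P x y"
        by (simp add: vec_eq_iff)
      have ne: "eval2_vec P x y \<noteq> 0" and parallel: "parallel (f x y) (eval2_vec P x y)" using fP xy by auto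
      have xyd: "(x, y) \<in> square 0 0 d" using Vd xy by (rule subsetD)
      have "F (proj X) = proj (f x y)"
        using proj_point_of_coords[OF w0] Ff[OF xyd] by (simp add: x_def y_def)
      also have "\<dots> = proj (eval2_vec P x y)" by (rule proj_eq_of_parallel[OF parallel nz[OF xyd] ne])
      also have "\<dots> = proj ((w0 \<bullet> X) ^ 3 *\<^sub>R eval2_vec P x y)" using ne w0 by (intro proj_scale[symmetric]) auto
      finally show "(\<chi> m. eval_poly (R $ m) X) \<noteq> 0 \<and> F (proj X) = proj (\<chi> m. eval_poly (R $ m) X)"
        using ne w0 unfolding evR by simp
    qed
    from rational_map_of_minimal_degree[OF ne[OF V(2)] hom this]
    show ?thesis using op sub[OF Vd] ne[OF V(2)] by (intro exI[of _ ?U']) auto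
  qed
qed

end
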